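(* Let $\{w_t\}_{t\ge0}$ be sampled from a joint distribution $\mathcal{W}$ for which there is $m>0$ with $\mathbb{E}[w_t^\top w_{t'}]\le m$ for all $t,t'$. Then the optimal dynamic regret with $k$ predictions over horizon $T$ ($1\le k\le T$) satisfies $${\mathit{Reg}^S_k}^* = \mathit{STO}_k^T - \mathit{STO}_T^T = O(\|F^k\|^2\, T + 1) = O(\lambda^{2k}\, T + 1),$$ and there exist $A$, $B$, $Q$, $R$, $Q_f$, $x_0$, and $\mathcal{W}$ such that ${\mathit{Reg}^S_k}^* = \Theta(\|F^k\|^2 (T - k))$. The constants in $O$ and $\Theta$ do not depend on $k$ or $T$.
   Context: System and cost: $x_{t+1} = A x_t + B u_t + w_t$ with $x_t\in\mathbb{R}^n$, $u_t\in\mathbb{R}^d$, given $x_0$, and for horizon $T\ge1$ the cost is $J(u,w) = \sum_{t=0}^{T-1} (x_t^\top Q x_t + u_t^\top R u_t) + x_T^\top Q_f x_T$. Standing assumptions: $Q,Q_f\succeq 0$, $R\succ 0$ (symmetric); $(A,B)$ is stabilizable, i.e. there is $K_0$ with $\rho(A-BK_0)<1$ ($\rho$ = spectral radius); $(A,Q)$ is detectable, i.e. $(A^\top,Q)$ is stabilizable. $P$ is the (unique positive semidefinite) solution of $P = Q + A^\top P A - A^\top P B(R + B^\top P B)^{-1} B^\top PA$; $F=A-B(R+B^\top PB)^{-1}B^\top PA$, which satisfies $\rho(F)<1$; $\lambda=\frac{1+\rho(F)}2<1$. $\|\cdot\|$ is the spectral norm. Predictions: $\mathcal{W}$ is known to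 the controller; with $k$ (exact) predictions $u_t$ may be any function of $x_0,w_0,\dots,w_{t+k-1}$. Below, each expectation over $w_t$ is with respect to its conditional distribution given $w_0,\dots,w_{t-1}$. $$\mathit{STO}^T_k = \mathbb{E}_{w_0,\dots,w_{k-1}} \min_{u_0} \mathbb{E}_{w_k} \cdots \min_{u_{T-k-1}} \mathbb{E}_{w_{T-1}} \min_{u_{T-k}, \dots, u_{T-1}} J(u,w),$$ $${\mathit{Reg}^S_k}^* = \mathbb{E}_{w_0, \dots, w_{k-1}} \min_{u_0} \mathbb{E}_{w_k} \cdots \min_{u_{T-k-1}} \mathbb{E}_{w_{T-1}} \min_{u_{T-k}, \dots, u_{T-1}} \Big(J(u, w) - \min_{u'_0, \dots, u'_{T-1}} J(u', w)\Big).$$ In particular $\mathit{STO}^T_T=\mathbb{E}_{w_0,\dots,w_{T-1}}\min_{u_0,\dots,u_{T-1}}J(u,w)$. Notation: $f=O(g)$ means $|f|\le C\,g$, and $f=\Omega(g)$ means $|f|\ge C\,g$, for a constant $C>0$ and all admissible $k$ and $T$; $\Theta$ means both. *)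

theory Defs
  imports "HOL-Probability.Probability" "HOL-Library.Landau_Symbols"
begin

section \<open>Matrices\<close>

definition sym_psd :: "real^'n^'n \<Rightarrow> bool" where
  "sym_psd M \<longleftrightarrow> transpose M = M \<and> (\<forall>x. 0 \<le> x \<bullet> (M *v x))"

definition sym_pd :: "real^'n^'n \<Rightarrow> bool" where
  "sym_pd M \<longleftrightarrow> transpose M = M \<and> (\<forall>x. x \<noteq> 0 \<longrightarrow> 0 < x \<bullet> (M *v x))"

definition complex_eigenvalues :: "real^'n^'n \<Rightarrow> complex set" where
  "complex_eigenvalues M =
     {c. \<exists>v. v \<noteq> 0 \<and> map_matrix complex_of_real M *v v = c *s v}"

definition spectral_radius :: "real^'n^'n \<Rightarrow> real" where
  "spectral_radius M = Max (cmod ` complex_eigenvalues M)"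

text \<open>The type class norm on matrices is the Frobenius norm and the type class product is
  componentwise; hence the operator norm and an explicit power.\<close>

definition spectral_norm :: "real^'n^'m \<Rightarrow> real" where
  "spectral_norm M = onorm ((*v) M)"

definition matpow :: "real^'n^'n \<Rightarrow> nat \<Rightarrow> real^'n^'n" where
  "matpow M k = (((**) M) ^^ k) (mat 1)"

section \<open>Linear quadratic control\<close>

definition stabilizable :: "real^'n^'n \<Rightarrow> real^'d^'n \<Rightarrow> bool" where
  "stabilizable A B \<longleftrightarrow> (\<exists>K0. spectral_radius (A - B ** K0) < 1)"

definition detectable :: "real^'n^'n \<Rightarrow> real^'n^'n \<Rightarrow> bool" where
  "detectable A Q \<longleftrightarrow> stabilizable (transpose A) Q"

definition solves_riccati ::
    "real^'n^'n \<Rightarrow> real^'d^'n \<Rightarrow> real^'n^'n \<Rightarrow> real^'d^'d \<Rightarrow> real^'n^'n \<Rightarrow> bool" where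
  "solves_riccati A B Q R P \<longleftrightarrow>
     P = Q + transpose A ** P ** A
         - transpose A ** P ** B ** matrix_inv (R + transpose B ** P ** B) ** transpose B ** P ** A"

definition closed_loop ::
    "real^'n^'n \<Rightarrow> real^'d^'n \<Rightarrow> real^'d^'d \<Rightarrow> real^'n^'n \<Rightarrow> real^'n^'n" where
  "closed_loop A B R P =
     A - B ** matrix_inv (R + transpose B ** P ** B) ** transpose B ** P ** A"

definition lqr_setting ::
    "real^'n^'n \<Rightarrow> real^'d^'n \<Rightarrow> real^'n^'n \<Rightarrow> real^'d^'d \<Rightarrow> real^'n^'n \<Rightarrow> real^'n^'n \<Rightarrow> bool" where
  "lqr_setting A B Q R Qf P \<longleftrightarrow>
     sym_psd Q \<and> sym_psd Qf \<and> sym_pd R \<and> stabilizable A B \<and> detectable A Q \<and>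
     sym_psd P \<and> solves_riccati A B Q R P"

primrec state ::
    "real^'n^'n \<Rightarrow> real^'d^'n \<Rightarrow> real^'n \<Rightarrow> (nat \<Rightarrow> real^'d) \<Rightarrow> (nat \<Rightarrow> real^'n) \<Rightarrow> nat \<Rightarrow> real^'n" where
  "state A B x0 u w 0 = x0"
| "state A B x0 u w (Suc t) = A *v state A B x0 u w t + B *v u t + w t"

definition cost ::
    "real^'n^'n \<Rightarrow> real^'d^'n \<Rightarrow> real^'n^'n \<Rightarrow> real^'d^'d \<Rightarrow> real^'n^'n \<Rightarrow> real^'n \<Rightarrow> nat
      \<Rightarrow> (nat \<Rightarrow> real^'d) \<Rightarrow> (nat \<Rightarrow> real^'n) \<Rightarrow> real" where
  "cost A B Q R Qf x0 T u w =
     (let x = state A B x0 u w in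
       (\<Sum>t<T. x t \<bullet> (Q *v x t) + u t \<bullet> (R *v u t)) + x T \<bullet> (Qf *v x T))"

section \<open>Disturbances\<close>

abbreviation seq_space :: "(nat \<Rightarrow> real^'n) measure" where
  "seq_space \<equiv> PiM UNIV (\<lambda>_. borel)"

abbreviation prefix_space :: "nat \<Rightarrow> (nat \<Rightarrow> real^'n) measure" where
  "prefix_space t \<equiv> PiM {..<t} (\<lambda>_. borel)"

definition joint_law :: "(nat \<Rightarrow> real^'n) measure \<Rightarrow> bool" where
  "joint_law W \<longleftrightarrow> prob_space W \<and> sets W = sets seq_space"

text \<open>\<open>K t\<close> is a (regular) conditional distribution of \<open>w t\<close> given \<open>w 0, \<dots>, w (t - 1)\<close>. Such
  kernels exist for every joint law on this space and are unique up to null sets.\<close>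

definition cond_laws ::
    "(nat \<Rightarrow> real^'n) measure \<Rightarrow> (nat \<Rightarrow> (nat \<Rightarrow> real^'n) \<Rightarrow> (real^'n) measure) \<Rightarrow> bool" where
  "cond_laws W K \<longleftrightarrow>
     (\<forall>t. K t \<in> prefix_space t \<rightarrow>\<^sub>M prob_algebra borel \<and>
       (\<forall>S \<in> sets (prefix_space t). \<forall>X \<in> sets borel.
          emeasure W {w \<in> space W. restrict w {..<t} \<in> S \<and> w t \<in> X} =
          (\<integral>\<^sup>+w. indicator S (restrict w {..<t}) * emeasure (K t (restrict w {..<t})) X \<partial>W)))"

definition second_moments_le :: "(nat \<Rightarrow> real^'n) measure \<Rightarrow> real \<Rightarrow> bool" where
  "second_moments_le W m \<longleftrightarrow>
     (\<forall>t t'. integrable W (\<lambda>w. w t \<bullet> w t') \<and> (\<integral>w. w t \<bullet> w t' \<partial>W) \<le> m)"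

section \<open>Optimal control with predictions\<close>

text \<open>For an objective \<open>G u w\<close>, \<open>stages K k T G j u w\<close> is
  \[\min_{u_t} E_{w_{t+k}} \cdots \min_{u_{T-k-1}} E_{w_{T-1}} \min_{u_{T-k},\dots,u_{T-1}} G(u,w)\]
  with \<open>t = T - k - j\<close>, that is, with \<open>j\<close> expectations still to be taken; only the controls before
  \<open>t\<close> and the disturbances before \<open>t + k\<close> in the arguments \<open>u\<close>, \<open>w\<close> matter. Both objectives
  below are nonnegative, so values in \<open>ennreal\<close> make every integral meaningful. The objectives
  are coercive convex quadratics in the controls when \<open>R\<close> is positive definite, so the infima are
  minima.\<close>

primrec stages ::
    "(nat \<Rightarrow> (nat \<Rightarrow> real^'n) \<Rightarrow> (real^'n) measure) \<Rightarrow> nat \<Rightarrow> nat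
      \<Rightarrow> ((nat \<Rightarrow> real^'d) \<Rightarrow> (nat \<Rightarrow> real^'n) \<Rightarrow> ennreal)
      \<Rightarrow> nat \<Rightarrow> (nat \<Rightarrow> real^'d) \<Rightarrow> (nat \<Rightarrow> real^'n) \<Rightarrow> ennreal" where
  "stages K k T G 0 u w = (INF v \<in> {v. \<forall>i < T - k. v i = u i}. G v w)"
| "stages K k T G (Suc j) u w =
     (let t = T - k - Suc j in
       INF a. \<integral>\<^sup>+y. stages K k T G j (u(t := a)) (w(t + k := y)) \<partial>K (t + k) (restrict w {..<t + k}))"

text \<open>The initial control sequence \<open>\<lambda>_. 0\<close> is a placeholder: every control is overwritten.\<close>

definition predictive_value ::
    "(nat \<Rightarrow> real^'n) measure \<Rightarrow> (nat \<Rightarrow> (nat \<Rightarrow> real^'n) \<Rightarrow> (real^'n) measure) \<Rightarrow> nat \<Rightarrow> nat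
      \<Rightarrow> ((nat \<Rightarrow> real^'d) \<Rightarrow> (nat \<Rightarrow> real^'n) \<Rightarrow> ennreal) \<Rightarrow> ennreal" where
  "predictive_value W K k T G = (\<integral>\<^sup>+w. stages K k T G (T - k) (\<lambda>_. 0) w \<partial>W)"

definition STO ::
    "real^'n^'n \<Rightarrow> real^'d^'n \<Rightarrow> real^'n^'n \<Rightarrow> real^'d^'d \<Rightarrow> real^'n^'n \<Rightarrow> real^'n
      \<Rightarrow> (nat \<Rightarrow> real^'n) measure \<Rightarrow> (nat \<Rightarrow> (nat \<Rightarrow> real^'n) \<Rightarrow> (real^'n) measure)
      \<Rightarrow> nat \<Rightarrow> nat \<Rightarrow> ennreal" where
  "STO A B Q R Qf x0 W K k T =
     predictive_value W K k T (\<lambda>u w. ennreal (cost A B Q R Qf x0 T u w))"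

definition Reg ::
    "real^'n^'n \<Rightarrow> real^'d^'n \<Rightarrow> real^'n^'n \<Rightarrow> real^'d^'d \<Rightarrow> real^'n^'n \<Rightarrow> real^'n
      \<Rightarrow> (nat \<Rightarrow> real^'n) measure \<Rightarrow> (nat \<Rightarrow> (nat \<Rightarrow> real^'n) \<Rightarrow> (real^'n) measure)
      \<Rightarrow> nat \<Rightarrow> nat \<Rightarrow> ennreal" where
  "Reg A B Q R Qf x0 W K k T =
     predictive_value W K k T
       (\<lambda>u w. ennreal (cost A B Q R Qf x0 T u w - (INF u'. cost A B Q R Qf x0 T u' w)))"

text \<open>Landau symbols over this filter on pairs \<open>(k, T)\<close> hold for all admissible \<open>k\<close> and \<open>T\<close>
  with one constant.\<close>

definition admissible :: "(nat \<times> nat) filter" where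
  "admissible = principal {(k, T). 1 \<le> k \<and> k \<le> T}"

end

theory Submission
  imports Defs "HOL-Computational_Algebra.Fundamental_Theorem_Algebra"
begin

text \<open>Completing the square with the stationary solution \<open>P\<close>, the derivative of the cost in a
  direction \<open>\<delta>\<close> is \<open>2 (\<Sum>t. \<epsilon> t \<bullet> S (\<delta> t + K y t)) + 2 x T \<bullet> (Qf - P) y T\<close>, where \<open>S = R + B\<^sup>T P B\<close>,
  \<open>K\<close> is the feedback gain, \<open>y\<close> is the response to \<open>\<delta>\<close>, and \<open>\<epsilon> t\<close> is the deviation of \<open>u t\<close> from the
  clairvoyant control for terminal weight \<open>P\<close>. By detectability the quadratic part of the cost is
  coercive in \<open>(\<delta> + K y, y T)\<close>, uniformly in the horizon, so the regret of any control is at most a constant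
  times \<open>(\<Sum>t. |\<epsilon> t|\<^sup>2) + |x T|\<^sup>2\<close>; convergence of the Riccati recursion started at \<open>Qf\<close> is never needed.
  Truncating the clairvoyant control to the prediction window leaves the deviation
  \<open>S\<^sup>-\<^sup>1 B\<^sup>T (F\<^sup>T)\<^sup>k (\<Sum>i. (F\<^sup>T)\<^sup>i P w (t + k + i))\<close>, whose second moment is \<open>O(|F\<^sup>k|\<^sup>2)\<close>. The
  value functions need not be measurable: lower integrals are monotone, and additive when one summand
  is measurable, which suffices both for the upper bound by a fixed controller and for splitting off the
  clairvoyant cost.

  For tightness, a scalar system with \<open>Qf = P\<close> driven by fair signs has regret at least
  \<open>\<Sum>t. (\<epsilon> t)\<^sup>2\<close>, and each of the first \<open>T - k\<close> deviations contains \<open>w (t + k) / 2 ^ (k + 1)\<close>, which is independent of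
  everything known when \<open>u t\<close> is chosen.\<close>

section \<open>Powers of a matrix and its spectral radius\<close>

text \<open>Two obstacles shape the estimates. Disturbances may be correlated in time, so every
  bound is made path by path, as a constant plus weighted squares of the \<open>norm (w s)\<close>,
  and is integrated only at the end. Jensen's inequality in \<open>convex_sq_le\<close> keeps cross
  terms out, at the price of a factor \<open>1 / (1 - l)\<close>. Moreover, all constants must be
  uniform in k and T. This uniformity comes from stability: of A - L Q with an observer gain L in
  the coercivity estimate, and of F in the estimates for the controller. Stability of F is itself
  derived: the closed-loop cost from x is at most \<open>x \<bullet> (P *v x)\<close>, and
  detectability turns finite cost into square summable states. Geometric decay of matrix powers is
  obtained without Jordan forms, from a polynomial annihilating the matrix, one linear factor at a
  time. The summand 1 in the rate accounts for Qf differing from P: it bounds the second moment of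
  the terminal state. The example takes Qf = P, which removes it and leaves exactly T - k nonzero
  deviations.\<close>

lemma matpow_0 [simp]: "matpow M 0 = mat 1"
  by (simp add: matpow_def)

lemma matpow_Suc: "matpow M (Suc k) = M ** matpow M k"
  by (simp add: matpow_def)

lemma matpow_add: "matpow M (i + j) = matpow M i ** matpow M j"
  by (induction i) (simp_all add: matpow_Suc matrix_mul_assoc)

lemma matpow_Suc_vec: "matpow M (Suc k) *v x = matpow M k *v (M *v x)"
proof -
  have "matpow M 1 = M" by (simp add: matpow_Suc)
  then show ?thesis
    using matpow_add[of M k 1] by (simp add: matrix_vector_mul_assoc)
qed

lemma transpose_matpow: "transpose (matpow M k) = matpow (transpose M) k"
proof (induction k)
  case (Suc k)
  have "matpow M (Suc k) = matpow M k ** M"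
    using matpow_add[of M k 1] by (simp add: matpow_Suc)
  then show ?case using Suc by (simp add: matrix_transpose_mul matpow_Suc)
qed (simp add: transpose_mat)

section \<open>Polynomials of a complex matrix\<close>

lemma norm_scale_complex: "norm (c *s v) = cmod c * norm v" for v :: "complex^'n"
proof -
  have "norm (c *s v) = L2_set (\<lambda>i. cmod c * norm (v $ i)) UNIV"
    by (simp add: norm_vec_def norm_mult)
  then show ?thesis by (simp add: norm_vec_def L2_set_right_distrib)
qed

text \<open>This is p(N) v in Horner form. Acting on a vector avoids evaluating polynomials at a
  matrix, since the type class product of matrices is componentwise.\<close>

definition poly_act :: "complex^'n^'n \<Rightarrow> complex poly \<Rightarrow> complex^'n \<Rightarrow> complex^'n" where
  "poly_act N p v = fold_coeffs (\<lambda>a y. a *s v + N *v y) p 0"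

lemma poly_act_0 [simp]: "poly_act N 0 v = 0"
  by (simp add: poly_act_def)

lemma poly_act_pCons [simp]: "poly_act N (pCons a p) v = a *s v + N *v poly_act N p v"
proof (cases "a = 0 \<and> p = 0")
  case False
  then show ?thesis unfolding poly_act_def by (cases "p = 0") auto
qed auto

lemma matrix_vector_mult_scale: "N *v (c *s v) = c *s (N *v v)" for N :: "complex^'n^'n"
  by (simp add: matrix_vector_mult_def vec_eq_iff sum_distrib_left mult_ac)

lemma poly_act_add: "poly_act N (p + q) v = poly_act N p v + poly_act N q v"
  by (induction p q rule: poly_induct2)
    (simp_all add: vec.add matrix_vector_right_distrib vector_sadd_rdistrib algebra_simps)

lemma poly_act_smult: "poly_act N (smult c p) v = c *s poly_act N p v"
  by (induction p) (simp_all add: matrix_vector_mult_scale vector_add_ldistrib)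

lemma poly_act_linear_factor: "poly_act N ([:-c, 1:] * q) v = N *v poly_act N q v - c *s poly_act N q v"
proof -
  have "[:-c, 1:] * q = smult (-c) q + pCons 0 q" by simp
  then show ?thesis by (simp only: poly_act_add poly_act_smult poly_act_pCons) simp
qed

text \<open>N - c commutes with q(N). Together with \<open>poly_act_linear_factor\<close> this moves
  a linear factor of an annihilating polynomial onto the vector, so that inductions can lower the
  degree while changing the vector.\<close>

lemma poly_act_commute: "poly_act N q (N *v v - c *s v) = N *v poly_act N q v - c *s poly_act N q v"
proof (induction q)
  case (pCons a q)
  have "N *v poly_act N q (N *v v - c *s v) = N *v (N *v poly_act N q v) - c *s (N *v poly_act N q v)"
    unfolding pCons by (simp add: matrix_vector_mult_scale matrix_vector_mult_diff_distrib)
  then show ?case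
    by (simp add: matrix_vector_mult_scale matrix_vector_right_distrib vector_add_ldistrib
        vector_ssub_ldistrib vector_smult_assoc mult.commute)
qed simp

lemma poly_act_eigenvector: "N *v v = c *s v \<Longrightarrow> poly_act N p v = poly p c *s v"
  by (induction p)
    (simp_all add: matrix_vector_mult_scale vector_sadd_rdistrib mult.commute)

text \<open>Linear factors are stripped off p one at a time. The last nonzero vector q(N) v before
  the product vanishes is an eigenvector, and the process must stop because a nonzero constant does
  not annihilate v.\<close>

lemma annihilated_has_eigenvalue:
  fixes v :: "complex^'n"
  assumes "p \<noteq> 0" "poly_act N p v = 0" "v \<noteq> 0"
  shows "\<exists>c w. w \<noteq> 0 \<and> N *v w = c *s w"
  using assms
proof (induction "degree p" arbitrary: p)
  case 0
  then obtain a where "p = [:a:]" "a \<noteq> 0" by (metis degree_eq_zeroE pCons_0_0)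
  with 0 show ?case by (auto simp: )
next
  case (Suc d)
  then have "degree p \<noteq> 0" by simp
  then have "\<not> constant (poly p)" by (simp add: constant_degree)
  then obtain c where "poly p c = 0" using fundamental_theorem_of_algebra by blast
  then obtain q where q: "p = [:-c, 1:] * q" by (auto simp: poly_eq_0_iff_dvd elim: dvdE)
  with Suc.prems have "q \<noteq> 0" by auto
  then have "degree q = d"
    using Suc.hyps(2) unfolding q by (subst (asm) degree_mult_eq) auto
  show ?case
  proof (cases "poly_act N q v = 0")
    case True
    with Suc.hyps(1)[of q] \<open>degree q = d\<close> \<open>q \<noteq> 0\<close> Suc.prems(3) show ?thesis by auto
  next
    case False
    then show ?thesis using Suc.prems(2) poly_act_linear_factor[of N c q v] unfolding q by auto
  qed
qed

text \<open>A substitute for the Jordan form. For a root c of p, the vector u = (N - c) v is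
  annihilated by a polynomial of smaller degree, so its orbit is \<open>O(r ^ k)\<close>. The orbit
  of v obeys a scalar recursion with factor c forced by that of u, and the gap between
  \<open>cmod c\<close> and r absorbs the forcing.\<close>

lemma annihilated_power_bound:
  fixes v :: "complex^'n"
  assumes "0 < r" and ev: "\<And>c w. w \<noteq> 0 \<Longrightarrow> N *v w = c *s w \<Longrightarrow> cmod c < r"
    and "p \<noteq> 0" "poly_act N p v = 0"
  shows "\<exists>C. \<forall>k. norm (((*v) N ^^ k) v) \<le> C * r ^ k"
  using assms(3-4)
proof (induction "degree p" arbitrary: p v)
  case 0
  then obtain a where "p = [:a:]" "a \<noteq> 0" by (metis degree_eq_zeroE pCons_0_0)
  with 0 have "v = 0" by auto
  then have "((*v) N ^^ k) v = 0" for k by (induction k) auto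
  then show ?case by (auto intro: exI[of _ 0])
next
  case (Suc d)
  then have "degree p \<noteq> 0" by simp
  then have "\<not> constant (poly p)" by (simp add: constant_degree)
  then obtain c where "poly p c = 0" using fundamental_theorem_of_algebra by blast
  then obtain q where q: "p = [:-c, 1:] * q" by (auto simp: poly_eq_0_iff_dvd elim: dvdE)
  with Suc.prems have "q \<noteq> 0" by auto
  then have dq: "degree q = d"
    using Suc.hyps(2) unfolding q by (subst (asm) degree_mult_eq) auto
  show ?case
  proof (cases "poly_act N q v = 0")
    case True
    with Suc.hyps(1)[of q v] dq \<open>q \<noteq> 0\<close> show ?thesis by auto
  next
    case False
    \<comment> \<open>Here \<open>poly_act N q v\<close> is an eigenvector for c.\<close>
    then have c: "cmod c < r"
      using ev Suc.prems(2) poly_act_linear_factor[of N c q v] unfolding q by auto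
    define u where "u = N *v v - c *s v"
    have "poly_act N q u = poly_act N p v" unfolding u_def q poly_act_commute poly_act_linear_factor ..
    with Suc.prems(2) have "poly_act N q u = 0" by simp
    then obtain C where C: "\<And>k. norm (((*v) N ^^ k) u) \<le> C * r ^ k"
      using Suc.hyps(1)[of q u] dq \<open>q \<noteq> 0\<close> by auto
    \<comment> \<open>The least constant that covers the starting vector and satisfies
      \<open>cmod c * D + C \<le> r * D\<close>, which is what the induction step needs.\<close>
    define D where "D = max (norm v) (C / (r - cmod c))"
    have "0 \<le> D" unfolding D_def by (simp add: le_max_iff_disj)
    have CD: "C \<le> (r - cmod c) * D"
    proof -
      have "C / (r - cmod c) \<le> D" by (simp add: D_def)
      then show ?thesis using c by (simp add: field_simps)
    qed
    have step: "((*v) N ^^ Suc k) v = c *s ((*v) N ^^ k) v + ((*v) N ^^ k) u" for k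
    proof (induction k)
      case 0 show ?case by (simp add: u_def)
    next
      case (Suc k)
      have "((*v) N ^^ Suc (Suc k)) v = N *v (((*v) N ^^ Suc k) v)" by simp
      also have "\<dots> = N *v (c *s ((*v) N ^^ k) v + ((*v) N ^^ k) u)"
        by (rule arg_cong[where f = "(*v) N", OF Suc])
      finally show ?case by (simp add: matrix_vector_right_distrib matrix_vector_mult_scale)
    qed
    have "norm (((*v) N ^^ k) v) \<le> D * r ^ k" for k
    proof (induction k)
      case (Suc k)
      have "norm (((*v) N ^^ Suc k) v) \<le> cmod c * norm (((*v) N ^^ k) v) + norm (((*v) N ^^ k) u)"
        unfolding step by (metis norm_triangle_ineq norm_scale_complex)
      also have "\<dots> \<le> cmod c * (D * r ^ k) + (r - cmod c) * D * r ^ k"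
        using Suc C[of k] CD \<open>0 < r\<close> by (intro add_mono mult_left_mono) (auto intro: order_trans)
      also have "\<dots> = D * r ^ Suc k" by (simp add: algebra_simps)
      finally show ?case .
    qed (simp add: D_def)
    then show ?thesis by blast
  qed
qed

lemma span_imageE:
  fixes v :: "nat \<Rightarrow> 'a::real_vector"
  assumes "x \<in> span (v ` {..<k})"
  obtains c where "x = (\<Sum>i<k. c i *\<^sub>R v i)"
proof -
  let ?S = "{x. \<exists>c. x = (\<Sum>i<k. c i *\<^sub>R v i)}"
  have "v ` {..<k} \<subseteq> ?S"
  proof safe
    fix i assume "i < k"
    have "v i = (\<Sum>j<k. (if j = i then 1 else 0) *\<^sub>R v j)"
      using \<open>i < k\<close> by (simp add: if_distrib[of "\<lambda>c. c *\<^sub>R _"] sum.If_cases)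
    then show "\<exists>c. v i = (\<Sum>j<k. c j *\<^sub>R v j)" by (rule exI[of "\<lambda>c. v i = (\<Sum>j<k. c j *\<^sub>R v j)"])
  qed
  moreover have "subspace ?S"
    unfolding subspace_def
  proof safe
    show "\<exists>c. 0 = (\<Sum>i<k. c i *\<^sub>R v i)" by (rule exI[of _ "\<lambda>_. 0"]) simp
    show "\<exists>e. (\<Sum>i<k. c i *\<^sub>R v i) + (\<Sum>i<k. d i *\<^sub>R v i) = (\<Sum>i<k. e i *\<^sub>R v i)" for c d
      by (rule exI[of _ "\<lambda>i. c i + d i"]) (simp add: scaleR_add_left sum.distrib)
    show "\<exists>e. a *\<^sub>R (\<Sum>i<k. c i *\<^sub>R v i) = (\<Sum>i<k. e i *\<^sub>R v i)" for a c
      by (rule exI[of _ "\<lambda>i. a * c i"]) (simp add: scaleR_sum_right)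
  qed
  ultimately have "span (v ` {..<k}) \<subseteq> ?S" by (rule span_minimal)
  with assms that show thesis by blast
qed

text \<open>Otherwise arbitrarily many of the vectors would be independent. Applied to the powers of
  a matrix this yields an annihilating polynomial and takes the place of Cayley-Hamilton.\<close>

lemma ex_in_span_predecessors:
  fixes v :: "nat \<Rightarrow> 'a::euclidean_space"
  shows "\<exists>k. v k \<in> span (v ` {..<k})"
proof (rule ccontr)
  assume none: "\<nexists>k. v k \<in> span (v ` {..<k})"
  have "independent (v ` {..<k}) \<and> card (v ` {..<k}) = k" for k
  proof (induction k)
    case (Suc k)
    then have "v k \<notin> v ` {..<k}" using none by (metis span_base)
    moreover have "v k \<notin> span (v ` {..<k})" using none by blast
    ultimately show ?case
      using Suc by (simp add: lessThan_Suc independent_insert)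
  qed (auto simp: independent_empty)
  from this[of "Suc DIM('a)"] show False
    using independent_card_le[of "v ` {..<Suc DIM('a)}"] by linarith
qed

section \<open>Eigenvalues and powers of real matrices\<close>

abbreviation cmat :: "real^'n^'m \<Rightarrow> complex^'n^'m" where
  "cmat \<equiv> map_matrix complex_of_real"

definition cvec :: "real^'n \<Rightarrow> complex^'n" where
  "cvec x = (\<chi> i. complex_of_real (x $ i))"

lemma cmat_mult_cvec: "cmat M *v cvec x = cvec (M *v x)"
  by (simp add: vec_eq_iff matrix_vector_mult_def cvec_def map_matrix_def)

lemma norm_cvec: "norm (cvec x) = norm x"
  by (simp add: norm_vec_def cvec_def)

lemma cmat_pow_cvec: "((*v) (cmat M) ^^ k) (cvec x) = cvec (matpow M k *v x)"
  by (induction k) (simp_all add: cmat_mult_cvec matpow_Suc matrix_vector_mul_assoc)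

lemma cmat_pow: "((*v) (cmat M) ^^ k) v = cmat (matpow M k) *v v" for M :: "real^'n^'n"
proof (induction k)
  case 0
  then show ?case by (simp add: vec_eq_iff matrix_vector_mult_def mat_def map_matrix_def
    if_distrib[of complex_of_real] if_distrib[of "\<lambda>c. c * _"] cong: if_cong)
next
  case (Suc k)
  have mult: "cmat (M ** N) = cmat M ** cmat N" for N :: "real^'n^'n"
    by (simp add: vec_eq_iff matrix_matrix_mult_def map_matrix_def)
  then have "cmat (M ** N) *v v = cmat M *v (cmat N *v v)" for N :: "real^'n^'n"
    by (simp only: mult matrix_vector_mul_assoc)
  with Suc show ?case by (simp add: matpow_Suc)
qed

lemma matrix_vector_mult_sum: "N *v (\<Sum>i\<in>S. f i) = (\<Sum>i\<in>S. N *v f i)"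
  for N :: "'a::semiring_1^'n^'m"
  by (induction S rule: infinite_finite_induct) (simp_all add: matrix_vector_right_distrib)

lemma poly_act_as_sum: "poly_act N p v = (\<Sum>i\<le>degree p. coeff p i *s ((*v) N ^^ i) v)"
proof (induction p)
  case (pCons a p)
  show ?case
  proof (cases "p = 0")
    case False
    have "N *v (\<Sum>i\<le>degree p. coeff p i *s ((*v) N ^^ i) v)
        = (\<Sum>i\<le>degree p. coeff p i *s ((*v) N ^^ Suc i) v)"
      unfolding matrix_vector_mult_sum matrix_vector_mult_scale by simp
    with False pCons show ?thesis by (simp add: sum.atMost_Suc_shift del: sum.atMost_Suc)
  qed simp
qed simp

lemma ex_annihilating_poly:
  fixes M :: "real^'n^'n"
  shows "\<exists>p. p \<noteq> 0 \<and> (\<forall>v. poly_act (cmat M) p v = 0)"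
proof -
  obtain k where "matpow M k \<in> span (matpow M ` {..<k})" using ex_in_span_predecessors by blast
  then obtain c where c: "matpow M k = (\<Sum>i<k. c i *\<^sub>R matpow M i)" by (rule span_imageE)
  \<comment> \<open>The linear dependence among the powers of M, read as a polynomial. Its leading
    coefficient is 1, so it is not zero.\<close>
  define p :: "complex poly" where "p = monom 1 k - (\<Sum>i<k. monom (complex_of_real (c i)) i)"
  have cp: "coeff p i = (if i = k then 1 else if i < k then - complex_of_real (c i) else 0)" for i
    by (auto simp: p_def coeff_sum)
  then have "p \<noteq> 0" by (metis coeff_0 zero_neq_one)
  moreover have deg: "degree p = k" using cp by (intro antisym degree_le le_degree) auto
  have "poly_act (cmat M) p v = 0" for v
  proof -
    have "cmat (matpow M k) *v v = (\<Sum>i<k. complex_of_real (c i) *s (cmat (matpow M i) *v v))"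
      unfolding c vec_eq_iff
    proof
      fix i
      have "(cmat (\<Sum>l<k. c l *\<^sub>R matpow M l) *v v) $ i
          = (\<Sum>j\<in>UNIV. \<Sum>l<k. complex_of_real (c l) * (complex_of_real (matpow M l $ i $ j) * v $ j))"
        by (simp add: matrix_vector_mult_def map_matrix_def sum_component sum_distrib_right mult.assoc
            del: sum_distrib_left)
      also have "\<dots> = (\<Sum>l<k. \<Sum>j\<in>UNIV. complex_of_real (c l) * (complex_of_real (matpow M l $ i $ j) * v $ j))"
        by (rule sum.swap)
      finally show "(cmat (\<Sum>l<k. c l *\<^sub>R matpow M l) *v v) $ i
          = (\<Sum>l<k. complex_of_real (c l) *s (cmat (matpow M l) *v v)) $ i"
        by (simp add: matrix_vector_mult_def map_matrix_def sum_distrib_left)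
    qed
    then show ?thesis
      unfolding poly_act_as_sum deg by (simp add: cp cmat_pow lessThan_Suc_atMost[symmetric] sum_negf)
  qed
  ultimately show ?thesis by blast
qed

text \<open>Eigenvalues are roots of the annihilating polynomial. Together with non-emptiness,
  finiteness makes the \<open>Max\<close> in \<open>spectral_radius\<close> an actual
  maximum.\<close>

lemma finite_complex_eigenvalues: "finite (complex_eigenvalues M)"
proof -
  obtain p where p: "p \<noteq> 0" "\<And>v. poly_act (cmat M) p v = 0" using ex_annihilating_poly by blast
  have "complex_eigenvalues M \<subseteq> {c. poly p c = 0}"
  proof
    fix c assume "c \<in> complex_eigenvalues M"
    then obtain v where "v \<noteq> 0" "cmat M *v v = c *s v" by (auto simp: complex_eigenvalues_def)
    with p(2)[of v] poly_act_eigenvector[of "cmat M" v c p] show "c \<in> {c. poly p c = 0}" by auto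
  qed
  then show ?thesis using poly_roots_finite[OF p(1)] finite_subset by blast
qed

lemma complex_eigenvalues_nonempty: "complex_eigenvalues (M :: real^'n^'n) \<noteq> {}"
proof -
  obtain p where "p \<noteq> 0" "\<And>v. poly_act (cmat M) p v = 0" using ex_annihilating_poly by blast
  moreover have "(1 :: complex^'n) \<noteq> 0" by (simp add: vec_eq_iff)
  ultimately show ?thesis
    using annihilated_has_eigenvalue[of p "cmat M" 1] by (auto simp: complex_eigenvalues_def)
qed

lemma spectral_radius_less_iff:
  "spectral_radius M < r \<longleftrightarrow> (\<forall>c \<in> complex_eigenvalues M. cmod c < r)"
  unfolding spectral_radius_def
  by (simp add: finite_complex_eigenvalues complex_eigenvalues_nonempty)

lemma spectral_radius_nonneg: "0 \<le> spectral_radius M"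
  using spectral_radius_less_iff[of M 0] complex_eigenvalues_nonempty[of M] by force

text \<open>The strict gap between the spectral radius and r absorbs the polynomial growth that
  nontrivial Jordan blocks would cause. The orbit bounds of the axis vectors are summed over
  coordinates, so C is independent of x.\<close>

lemma matpow_bound:
  fixes M :: "real^'n^'n"
  assumes "spectral_radius M < r"
  shows "\<exists>C\<ge>0. \<forall>k x. norm (matpow M k *v x) \<le> C * r ^ k * norm x"
proof -
  have "0 < r" using assms spectral_radius_nonneg[of M] by simp
  obtain p where p: "p \<noteq> 0" "\<And>v. poly_act (cmat M) p v = 0" using ex_annihilating_poly by blast
  have "\<exists>C. \<forall>k. norm (((*v) (cmat M) ^^ k) (cvec (axis i 1))) \<le> C * r ^ k" for i
    using assms by (intro annihilated_power_bound[OF \<open>0 < r\<close> _ p])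
      (auto simp: spectral_radius_less_iff complex_eigenvalues_def)
  then obtain C where C: "\<And>i k. norm (matpow M k *v axis i 1) \<le> C i * r ^ k"
    unfolding cmat_pow_cvec norm_cvec by metis
  have "0 \<le> C i" for i using C[of 0 i] norm_ge_zero order_trans by fastforce
  moreover have "norm (matpow M k *v x) \<le> (\<Sum>i\<in>UNIV. C i) * r ^ k * norm x" for k x
  proof -
    have "x = (\<Sum>i\<in>UNIV. (x $ i) *\<^sub>R axis i 1)"
      using basis_expansion[of x] by (simp add: scalar_mult_eq_scaleR)
    then have "matpow M k *v x = (\<Sum>i\<in>UNIV. (x $ i) *\<^sub>R (matpow M k *v axis i 1))"
      by (metis (mono_tags, lifting) linear_sum matrix_vector_mul_linear matrix_vector_mult_scaleR sum.cong)
    then have "norm (matpow M k *v x) \<le> (\<Sum>i\<in>UNIV. norm ((x $ i) *\<^sub>R (matpow M k *v axis i 1)))"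
      by (metis norm_sum)
    also have "\<dots> \<le> (\<Sum>i\<in>UNIV. norm x * (C i * r ^ k))"
      using C component_le_norm_cart[of x] by (intro sum_mono) (auto intro!: mult_mono)
    finally show ?thesis by (simp add: sum_distrib_left sum_distrib_right mult_ac)
  qed
  ultimately show ?thesis by (intro exI[of _ "\<Sum>i\<in>UNIV. C i"]) (auto intro: sum_nonneg)
qed

section \<open>Energy estimates\<close>

declare transpose_matrix_vector [simp del]

lemma inner_transpose: "(transpose M *v x) \<bullet> y = x \<bullet> (M *v y)" for M :: "real^'n^'m"
  by (simp add: transpose_matrix_vector dot_lmul_matrix)

lemma norm_matrix_vector_le: "norm (M *v x) \<le> spectral_norm M * norm x" for M :: "real^'n^'m"
  unfolding spectral_norm_def by (rule onorm) (rule matrix_vector_mul_bounded_linear)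

lemma spectral_norm_nonneg: "0 \<le> spectral_norm M" for M :: "real^'n^'m"
  unfolding spectral_norm_def by (rule onorm_pos_le) (rule matrix_vector_mul_bounded_linear)

text \<open>The square of the norm of \<open>transpose M *v x\<close> is
  \<open>x \<bullet> (M *v (transpose M *v x))\<close>; Cauchy-Schwarz and cancellation do the rest.
  The constant is kept arbitrary so that decay rates of powers carry over to the transpose.\<close>

lemma norm_transpose_le:
  fixes M :: "real^'n^'m"
  assumes "\<And>x. norm (M *v x) \<le> c * norm x"
  shows "norm (transpose M *v x) \<le> c * norm x"
proof (cases "transpose M *v x = 0")
  case True
  \<comment> \<open>Nonnegativity of c is read off from the hypothesis at a unit vector.\<close>
  have "0 \<le> c * norm (axis undefined 1 :: real^'n)"
    using order_trans[OF norm_ge_zero assms] by blast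
  then have "0 \<le> c" by simp
  with True show ?thesis by simp
next
  case False
  have "norm (transpose M *v x) * norm (transpose M *v x) = x \<bullet> (M *v (transpose M *v x))"
    using inner_transpose[of M x "transpose M *v x"]
    by (simp add: dot_square_norm power2_eq_square)
  also have "\<dots> \<le> norm x * (c * norm (transpose M *v x))"
    by (rule order_trans[OF norm_cauchy_schwarz]) (intro mult_left_mono assms norm_ge_zero)
  finally show ?thesis using False by (simp add: mult_ac)
qed

lemma sym_inner: "transpose M = M \<Longrightarrow> (M *v x) \<bullet> y = x \<bullet> (M *v y)" for M :: "real^'n^'n"
  using inner_transpose[of M x y] by simp

text \<open>Positivity of the form at \<open>x - (M x) / c\<close>, where \<open>c\<close> bounds the norm of \<open>M\<close>.\<close>

lemma psd_norm_sq_le: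
  fixes M :: "real^'n^'n"
  assumes "sym_psd M"
  shows "\<exists>c\<ge>0. \<forall>x. (norm (M *v x))\<^sup>2 \<le> c * (x \<bullet> (M *v x))"
proof -
  \<comment> \<open>Adding 1 makes c strictly positive, so that it can be cancelled at the
    end.\<close>
  define c where "c = spectral_norm M + 1"
  have "0 < c" using spectral_norm_nonneg[of M] by (simp add: c_def)
  have sym: "(M *v x) \<bullet> y = x \<bullet> (M *v y)" for x y
    using assms by (intro sym_inner) (simp add: sym_psd_def)
  have "(norm (M *v x))\<^sup>2 \<le> c * (x \<bullet> (M *v x))" for x
  proof -
    define y where "y = M *v x"
    have "norm (M *v y) \<le> c * norm y"
      using norm_matrix_vector_le[of M y] norm_ge_zero[of y]
      unfolding c_def by (simp add: algebra_simps del: norm_ge_zero)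
    then have "y \<bullet> (M *v y) \<le> norm y * (c * norm y)"
      by (intro order_trans[OF norm_cauchy_schwarz]) (intro mult_left_mono norm_ge_zero)
    then have le: "y \<bullet> (M *v y) \<le> c * (y \<bullet> y)" by (simp add: dot_square_norm power2_eq_square mult_ac)
    have "0 \<le> (c *\<^sub>R x - y) \<bullet> (M *v (c *\<^sub>R x - y))" using assms by (simp add: sym_psd_def)
    also have "\<dots> = c * c * (x \<bullet> (M *v x)) - 2 * c * (y \<bullet> y) + y \<bullet> (M *v y)"
      using sym[of x y] sym[of x x]
      by (simp add: matrix_vector_mult_diff_distrib matrix_vector_mult_scaleR inner_diff_left inner_diff_right
          y_def[symmetric] inner_commute) 
    finally have "c * (y \<bullet> y) \<le> c * (c * (x \<bullet> (M *v x)))" using le by (simp add: algebra_simps)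
    then show ?thesis using \<open>0 < c\<close> by (simp add: y_def dot_square_norm)
  qed
  with \<open>0 < c\<close> show ?thesis by (intro exI[of _ c]) auto
qed

lemma pd_imp_psd: "sym_pd M \<Longrightarrow> sym_psd M"
  unfolding sym_pd_def sym_psd_def by (metis inner_zero_left order_le_less)

lemma pd_imp_invertible:
  assumes "sym_pd M" shows "invertible M"
  unfolding invertible_left_inverse matrix_left_invertible_ker
proof (intro allI impI)
  fix x assume "M *v x = 0"
  then have "\<not> 0 < x \<bullet> (M *v x)" by simp
  with assms show "x = 0" by (auto simp: sym_pd_def)
qed

lemma invertible_matrix_inv_right: "invertible M \<Longrightarrow> M *v (matrix_inv M *v x) = x"
  for M :: "real^'n^'n"
proof -
  assume "invertible M"
  then obtain N where "M ** N = mat 1 \<and> N ** M = mat 1" unfolding invertible_def by blast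
  then have "M ** matrix_inv M = mat 1 \<and> matrix_inv M ** M = mat 1"
    unfolding matrix_inv_def by (rule someI)
  then show ?thesis by (simp add: matrix_vector_mul_assoc)
qed

text \<open>Coercivity without eigenvalues or compactness: x is recovered from M x by an inverse of
  M, and M x is controlled by the form through \<open>psd_norm_sq_le\<close>.\<close>

lemma pd_coercive:
  fixes M :: "real^'n^'n"
  assumes "sym_pd M"
  shows "\<exists>c\<ge>0. \<forall>x. (norm x)\<^sup>2 \<le> c * (x \<bullet> (M *v x))"
proof -
  obtain c where c: "c \<ge> 0" "\<And>x. (norm (M *v x))\<^sup>2 \<le> c * (x \<bullet> (M *v x))"
    using psd_norm_sq_le pd_imp_psd[OF assms] by blast
  obtain N where "N ** M = mat 1"
    using pd_imp_invertible[OF assms] unfolding invertible_left_inverse by blast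
  then have N: "N *v (M *v x) = x" for x by (simp add: matrix_vector_mul_assoc)
  have "(norm x)\<^sup>2 \<le> ((spectral_norm N)\<^sup>2 * c) * (x \<bullet> (M *v x))" for x
  proof -
    have "(norm x)\<^sup>2 \<le> (spectral_norm N * norm (M *v x))\<^sup>2"
      using norm_matrix_vector_le[of N "M *v x"] unfolding N by (intro power_mono) auto
    also have "\<dots> \<le> (spectral_norm N)\<^sup>2 * (c * (x \<bullet> (M *v x)))"
      unfolding power_mult_distrib by (intro mult_left_mono c) simp
    finally show ?thesis by (simp add: mult_ac)
  qed
  with c(1) show ?thesis by (intro exI[of _ "(spectral_norm N)\<^sup>2 * c"]) auto
qed

text \<open>The geometric convolution \<open>l ^ t * a\<close> plus the sum of
  \<open>l ^ (t - 1 - s) * b s\<close> over s < t, which serves as scalar majorant of stable linear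
  recursions.\<close>

primrec filt :: "real \<Rightarrow> real \<Rightarrow> (nat \<Rightarrow> real) \<Rightarrow> nat \<Rightarrow> real" where
  "filt l a b 0 = a"
| "filt l a b (Suc t) = l * filt l a b t + b t"

lemma filt_nonneg: "0 \<le> l \<Longrightarrow> 0 \<le> a \<Longrightarrow> (\<And>s. s < t \<Longrightarrow> 0 \<le> b s) \<Longrightarrow> 0 \<le> filt l a b t"
  by (induction t) auto

text \<open>Jensen's inequality for the convex combination
  \<open>l * x + (1 - l) * (y / (1 - l))\<close>. Squares thus obey a recursion with the same factor
  l and without cross terms.\<close>

lemma convex_sq_le:
  fixes l x y :: real
  assumes "0 \<le> l" "l < 1"
  shows "(l * x + y)\<^sup>2 \<le> l * x\<^sup>2 + y\<^sup>2 / (1 - l)"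
proof -
  have "0 \<le> l * ((1 - l) * x - y)\<^sup>2" using assms by simp
  then have "(1 - l) * (l * x + y)\<^sup>2 \<le> (1 - l) * (l * x\<^sup>2) + y\<^sup>2"
    by (simp add: power2_eq_square algebra_simps)
  then show ?thesis using assms by (simp add: field_simps)
qed

lemma filt_sq_le:
  assumes "0 \<le> l" "l < 1"
  shows "(filt l a b t)\<^sup>2 \<le> filt l (a\<^sup>2) (\<lambda>s. (b s)\<^sup>2 / (1 - l)) t"
proof (induction t)
  case (Suc t)
  have "(filt l a b (Suc t))\<^sup>2 \<le> l * (filt l a b t)\<^sup>2 + (b t)\<^sup>2 / (1 - l)"
    using convex_sq_le[OF assms] by simp
  also have "\<dots> \<le> filt l (a\<^sup>2) (\<lambda>s. (b s)\<^sup>2 / (1 - l)) (Suc t)"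
    using mult_left_mono[OF Suc assms(1)] by simp
  finally show ?case .
qed simp

text \<open>The recursion summed over time: an exact balance between what enters the filter and what
  it retains.\<close>

lemma sum_filt:
  "(1 - l) * (\<Sum>t\<le>T. filt l a b t) + l * filt l a b T = a + (\<Sum>t<T. b t)"
proof (induction T)
  case (Suc T)
  have "(1 - l) * (x + y) + l * y = (1 - l) * x + y" for x y by (simp add: algebra_simps)
  with Suc show ?case by simp
qed (simp add: algebra_simps)

lemma sum_filt_le:
  assumes "0 \<le> l" "l < 1" "0 \<le> a" "\<And>t. t < T \<Longrightarrow> 0 \<le> b t"
  shows "(\<Sum>t\<le>T. filt l a b t) \<le> (a + (\<Sum>t<T. b t)) / (1 - l)"
proof -
  have "0 \<le> l * filt l a b T" using assms by (intro mult_nonneg_nonneg filt_nonneg)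
  then have "(1 - l) * (\<Sum>t\<le>T. filt l a b t) \<le> a + (\<Sum>t<T. b t)"
    using sum_filt[of l a b T] by simp
  then show ?thesis using assms(2) by (simp add: field_simps)
qed

lemma filt_const_le:
  assumes "0 \<le> l" "l < 1" "0 \<le> a" "0 \<le> b"
  shows "filt l a (\<lambda>_. b) t \<le> a + b / (1 - l)"
proof (induction t)
  case (Suc t)
  have "filt l a (\<lambda>_. b) (Suc t) \<le> l * (a + b / (1 - l)) + b"
    using mult_left_mono[OF Suc assms(1)] by simp
  also have "\<dots> = l * a + b / (1 - l)" using assms by (simp add: field_simps)
  also have "\<dots> \<le> a + b / (1 - l)" using mult_right_mono[of l 1 a] assms by simp
  finally show ?case .
qed (use assms in simp)

lemma stable_recursion:
  fixes E :: "real^'n^'n"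
  assumes C: "\<And>k x. norm (matpow E k *v x) \<le> C * l ^ k * norm x"
    and y: "\<And>s. s < t \<Longrightarrow> y (Suc s) = E *v y s + r s"
  shows "norm (y t) \<le> C * filt l (norm (y 0)) (\<lambda>s. norm (r s)) t"
proof -
  \<comment> \<open>Generalised over k because C would otherwise be paid at every step. Carrying the
    pending power of E through the induction, C is paid only once.\<close>
  have "norm (matpow E k *v y t) \<le> C * l ^ k * filt l (norm (y 0)) (\<lambda>s. norm (r s)) t" for k
    using y
  proof (induction t arbitrary: k)
    case 0
    show ?case using C by simp
  next
    case (Suc t)
    have "matpow E k *v y (Suc t) = matpow E (Suc k) *v y t + matpow E k *v r t"
      using Suc.prems[of t] by (simp add: matpow_Suc_vec matrix_vector_right_distrib)
    then have "norm (matpow E k *v y (Suc t))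
        \<le> norm (matpow E (Suc k) *v y t) + norm (matpow E k *v r t)"
      by (simp add: norm_triangle_ineq)
    also have "\<dots> \<le> C * l ^ Suc k * filt l (norm (y 0)) (\<lambda>s. norm (r s)) t + C * l ^ k * norm (r t)"
      by (intro add_mono Suc.IH C Suc.prems) simp
    finally show ?case by (simp add: algebra_simps)
  qed
  from this[of 0] show ?thesis by simp
qed

lemma stable_recursion_sq:
  fixes E :: "real^'n^'n"
  assumes l: "0 \<le> l" "l < 1"
    and C: "\<And>k x. norm (matpow E k *v x) \<le> C * l ^ k * norm x"
    and y: "\<And>s. s < t \<Longrightarrow> y (Suc s) = E *v y s + r s"
  shows "(norm (y t))\<^sup>2 \<le> C\<^sup>2 * filt l ((norm (y 0))\<^sup>2) (\<lambda>s. (norm (r s))\<^sup>2 / (1 - l)) t"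
proof -
  have "(norm (y t))\<^sup>2 \<le> (C * filt l (norm (y 0)) (\<lambda>s. norm (r s)) t)\<^sup>2"
    using stable_recursion[where y = y and r = r, OF C y] by (intro power_mono) auto
  also have "\<dots> \<le> C\<^sup>2 * filt l ((norm (y 0))\<^sup>2) (\<lambda>s. (norm (r s))\<^sup>2 / (1 - l)) t"
    unfolding power_mult_distrib by (intro mult_left_mono filt_sq_le l) simp
  finally show ?thesis .
qed

section \<open>Energy bounds from detectability\<close>

lemma norm_add_sq_le: "(norm (a + b))\<^sup>2 \<le> 2 * (norm a)\<^sup>2 + 2 * (norm b)\<^sup>2"
proof -
  have "(norm (a + b))\<^sup>2 \<le> (norm a + norm b)\<^sup>2" by (intro power_mono norm_triangle_ineq) simp
  also have "\<dots> \<le> 2 * (norm a)\<^sup>2 + 2 * (norm b)\<^sup>2"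
    using zero_le_power2[of "norm a - norm b"] by (simp add: power2_eq_square algebra_simps)
  finally show ?thesis .
qed

lemma norm_matrix_vector_sq_le: "(norm (M *v x))\<^sup>2 \<le> (spectral_norm M)\<^sup>2 * (norm x)\<^sup>2"
  for M :: "real^'n^'m"
  using power_mono[OF norm_matrix_vector_le[of M x], of 2] by (simp add: power_mult_distrib)

text \<open>Duality: the transpose of a gain stabilising \<open>transpose A\<close> is an observer
  gain for A, and norm bounds on powers survive transposition.\<close>

lemma detectable_imp_observer:
  fixes A Q :: "real^'n^'n"
  assumes "detectable A Q" "transpose Q = Q"
  obtains L C l where "0 \<le> l" "l < 1"
    "\<And>k x. norm (matpow (A - L ** Q) k *v x) \<le> C * l ^ k * norm x"
proof -
  obtain K0 where K0: "spectral_radius (transpose A - Q ** K0) < 1"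
    using assms(1) unfolding detectable_def stabilizable_def by blast
  define l where "l = (1 + spectral_radius (transpose A - Q ** K0)) / 2"
  have l: "spectral_radius (transpose A - Q ** K0) < l" "0 \<le> l" "l < 1"
    using K0 spectral_radius_nonneg[of "transpose A - Q ** K0"] by (simp_all add: l_def)
  obtain C where C: "\<And>k x. norm (matpow (transpose A - Q ** K0) k *v x) \<le> C * l ^ k * norm x"
    using matpow_bound[OF l(1)] by blast
  have tdiff: "transpose (X - Y) = transpose X - transpose Y" for X Y :: "real^'n^'n"
    by (simp add: transpose_def vec_eq_iff)
  have "transpose (matpow (transpose A - Q ** K0) k) = matpow (A - transpose K0 ** Q) k" for k
    by (simp add: transpose_matpow tdiff matrix_transpose_mul assms(2))
  with norm_transpose_le[OF C] have "norm (matpow (A - transpose K0 ** Q) k *v x) \<le> C * l ^ k * norm x" for k x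
    by metis
  with l that show thesis by blast
qed

text \<open>Output injection: adding and subtracting L Q y turns y into a stable recursion with
  matrix A - L Q and input L Q y + B d. The running cost dominates the squares of Q y and d, hence
  of this input, uniformly in T.\<close>

lemma detectable_energy_bound:
  fixes A Q :: "real^'n^'n" and B :: "real^'d^'n"
  assumes "detectable A Q" "sym_psd Q" "sym_pd R"
  obtains C where "C \<ge> 0" "\<And>T y d. (\<And>t. t < T \<Longrightarrow> y (Suc t) = A *v y t + B *v d t) \<Longrightarrow>
    (\<Sum>t\<le>T. (norm (y t))\<^sup>2) \<le> C * ((norm (y 0))\<^sup>2 + (\<Sum>t<T. y t \<bullet> (Q *v y t) + d t \<bullet> (R *v d t)))"
proof -
  have "transpose Q = Q" using assms(2) by (simp add: sym_psd_def)
  from assms(1) this obtain L C l where l: "0 \<le> l" "l < 1"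
    and C: "\<And>k x. norm (matpow (A - L ** Q) k *v x) \<le> C * l ^ k * norm x"
    by (rule detectable_imp_observer) blast
  obtain q where q: "q \<ge> 0" "\<And>x. (norm (Q *v x))\<^sup>2 \<le> q * (x \<bullet> (Q *v x))"
    using psd_norm_sq_le[OF assms(2)] by blast
  obtain r where r: "r \<ge> 0" "\<And>x. (norm x)\<^sup>2 \<le> r * (x \<bullet> (R *v x))"
    using pd_coercive[OF assms(3)] by blast
  define q' where "q' = 2 * (spectral_norm L)\<^sup>2 * q + 2 * (spectral_norm B)\<^sup>2 * r"
  define D where "D = C\<^sup>2 * (1 + q' / (1 - l)) / (1 - l)"
  have pos: "0 \<le> x \<bullet> (Q *v x)" "0 \<le> z \<bullet> (R *v z)" for x z
    using assms(2) pd_imp_psd[OF assms(3)] by (simp_all add: sym_psd_def)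
  have "q' \<ge> 0" using q r by (simp add: q'_def)
  have main: "(\<Sum>t\<le>T. (norm (y t))\<^sup>2) \<le> D * ((norm (y 0))\<^sup>2 + (\<Sum>t<T. y t \<bullet> (Q *v y t) + d t \<bullet> (R *v d t)))"
    if y: "\<And>t. t < T \<Longrightarrow> y (Suc t) = A *v y t + B *v d t" for T y d
  proof -
    define e where "e t = y t \<bullet> (Q *v y t) + d t \<bullet> (R *v d t)" for t
    define f where "f t = (norm (L *v (Q *v y t) + B *v d t))\<^sup>2 / (1 - l)" for t
    have e: "0 \<le> e t" for t using pos by (simp add: e_def)
    have f: "f t \<le> q' / (1 - l) * e t" for t
    proof -
      have "(norm (L *v (Q *v y t)))\<^sup>2 \<le> (spectral_norm L)\<^sup>2 * (q * (y t \<bullet> (Q *v y t)))"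
        by (rule order_trans[OF norm_matrix_vector_sq_le]) (intro mult_left_mono q, simp)
      moreover have "(norm (B *v d t))\<^sup>2 \<le> (spectral_norm B)\<^sup>2 * (r * (d t \<bullet> (R *v d t)))"
        by (rule order_trans[OF norm_matrix_vector_sq_le]) (intro mult_left_mono r, simp)
      ultimately have "(norm (L *v (Q *v y t) + B *v d t))\<^sup>2
          \<le> 2 * ((spectral_norm L)\<^sup>2 * (q * (y t \<bullet> (Q *v y t))))
            + 2 * ((spectral_norm B)\<^sup>2 * (r * (d t \<bullet> (R *v d t))))"
        using norm_add_sq_le[of "L *v (Q *v y t)" "B *v d t"] by linarith
      also have "\<dots> \<le> q' * e t"
        using q(1) r(1) pos unfolding q'_def e_def by (simp add: algebra_simps)
      finally show ?thesis unfolding f_def using l(2) by (simp add: divide_right_mono)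
    qed
    have "(norm (y t))\<^sup>2 \<le> C\<^sup>2 * filt l ((norm (y 0))\<^sup>2) f t" if "t \<le> T" for t
      unfolding f_def
    proof (rule stable_recursion_sq[OF l C])
      show "y (Suc s) = (A - L ** Q) *v y s + (L *v (Q *v y s) + B *v d s)" if "s < t" for s
        using y that \<open>t \<le> T\<close>
        by (simp add: matrix_vector_mult_diff_rdistrib matrix_vector_mul_assoc[symmetric])
    qed
    then have "(\<Sum>t\<le>T. (norm (y t))\<^sup>2) \<le> C\<^sup>2 * (\<Sum>t\<le>T. filt l ((norm (y 0))\<^sup>2) f t)"
      unfolding sum_distrib_left by (intro sum_mono) auto
    also have "\<dots> \<le> C\<^sup>2 * (((norm (y 0))\<^sup>2 + (\<Sum>t<T. f t)) / (1 - l))"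
      using l by (intro mult_left_mono sum_filt_le) (auto simp: f_def)
    also have "\<dots> \<le> C\<^sup>2 * (((norm (y 0))\<^sup>2 + q' / (1 - l) * (\<Sum>t<T. e t)) / (1 - l))"
      using l f by (intro mult_left_mono divide_right_mono add_left_mono)
        (auto simp: sum_distrib_left intro!: sum_mono)
    also have "\<dots> \<le> C\<^sup>2 * (((1 + q' / (1 - l)) * ((norm (y 0))\<^sup>2 + (\<Sum>t<T. e t))) / (1 - l))"
    proof -
      have "0 \<le> (\<Sum>t<T. e t)" "0 \<le> q' / (1 - l) * (norm (y 0))\<^sup>2"
        using e l \<open>q' \<ge> 0\<close> by (auto intro: sum_nonneg)
      then have "(norm (y 0))\<^sup>2 + q' / (1 - l) * (\<Sum>t<T. e t)
          \<le> (1 + q' / (1 - l)) * ((norm (y 0))\<^sup>2 + (\<Sum>t<T. e t))"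
        by (simp add: algebra_simps)
      then show ?thesis using l by (intro mult_left_mono divide_right_mono) auto
    qed
    finally show ?thesis by (simp add: D_def e_def mult_ac)
  qed
  have "0 \<le> D" using l \<open>q' \<ge> 0\<close> by (simp add: D_def)
  then show thesis by (rule that) (rule main)
qed

section \<open>Completing the square with the stationary Riccati solution\<close>

locale lqr =
  fixes A :: "real^'n^'n" and B :: "real^'d^'n" and Q R Qf P
  assumes setting: "lqr_setting A B Q R Qf P"
begin

definition gram :: "real^'d^'d" where
  "gram = R + transpose B ** P ** B"

definition gain :: "real^'n^'d" where
  "gain = matrix_inv gram ** transpose B ** P ** A"

abbreviation F :: "real^'n^'n" where
  "F \<equiv> closed_loop A B R P"

lemma psd: "sym_psd Q" "sym_psd Qf" "sym_psd P" "sym_psd R" and pd_R: "sym_pd R"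
  and detectable: "detectable A Q"
  using setting by (auto simp: lqr_setting_def pd_imp_psd)

lemma form_nonneg: "0 \<le> x \<bullet> (Q *v x)" "0 \<le> x \<bullet> (Qf *v x)" "0 \<le> x \<bullet> (P *v x)" "0 \<le> u \<bullet> (R *v u)"
  using psd by (auto simp: sym_psd_def)

lemma form_sym: "(Q *v x) \<bullet> y = x \<bullet> (Q *v y)" "(Qf *v x) \<bullet> y = x \<bullet> (Qf *v y)"
  "(P *v x) \<bullet> y = x \<bullet> (P *v y)" "(R *v u) \<bullet> v = u \<bullet> (R *v v)"
  using psd by (auto simp: sym_psd_def intro: sym_inner)

lemma gram_mult: "gram *v u = R *v u + transpose B *v (P *v (B *v u))"
  by (simp add: gram_def matrix_vector_mult_add_rdistrib matrix_vector_mul_assoc matrix_mul_assoc)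

lemma gram_inner: "u \<bullet> (gram *v v) = u \<bullet> (R *v v) + (B *v u) \<bullet> (P *v (B *v v))"
  using inner_transpose[of B "P *v (B *v v)" u]
  by (simp add: gram_mult inner_add_right inner_commute)

lemma gram_sym: "(gram *v u) \<bullet> v = u \<bullet> (gram *v v)"
  using gram_inner[of v u] gram_inner[of u v] form_sym(4)[of u v] form_sym(3)[of "B *v u" "B *v v"]
  by (simp add: inner_commute)

lemma gram_inverse: "gram *v (matrix_inv gram *v u) = u"
proof (rule invertible_matrix_inv_right)
  show "invertible gram"
    unfolding invertible_left_inverse matrix_left_invertible_ker
  proof (intro allI impI)
    fix u assume "gram *v u = 0"
    then have "u \<bullet> (R *v u) + (B *v u) \<bullet> (P *v (B *v u)) = 0" using gram_inner[of u u] by simp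
    then have "u \<bullet> (R *v u) \<le> 0" using form_nonneg(3)[of "B *v u"] by linarith
    with pd_R show "u = 0" unfolding sym_pd_def by (metis not_less)
  qed
qed

lemma gain_mult: "gain *v x = matrix_inv gram *v (transpose B *v (P *v (A *v x)))"
  by (simp add: gain_def matrix_vector_mul_assoc matrix_mul_assoc)

lemma F_mult: "F *v x = A *v x - B *v (gain *v x)"
  by (simp add: closed_loop_def gain_def gram_def matrix_vector_mult_diff_rdistrib
      matrix_vector_mul_assoc matrix_mul_assoc)

text \<open>The normal equation for the gain,
  \<open>gram *v (gain *v x) = transpose B *v (P *v (A *v x))\<close>, with the B^T P B part moved
  to the other side. It is the stationarity condition behind the cancellation of cross
  terms.\<close>

lemma BPF: "transpose B *v (P *v (F *v x)) = R *v (gain *v x)"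
proof -
  have "gram *v (gain *v x) = transpose B *v (P *v (A *v x))"
    by (simp add: gain_mult gram_inverse)
  then show ?thesis
    unfolding F_mult gram_mult matrix_vector_mult_diff_distrib by (metis add_diff_cancel_right')
qed

lemma BPF_inner: "(B *v u) \<bullet> (P *v (F *v y)) = u \<bullet> (R *v (gain *v y))"
  by (metis BPF inner_transpose inner_commute)

lemma P_mult: "P *v x = Q *v x + transpose A *v (P *v (F *v x))"
proof -
  have "P = Q + transpose A ** P ** A
         - transpose A ** P ** B ** matrix_inv gram ** transpose B ** P ** A"
    using setting unfolding lqr_setting_def solves_riccati_def gram_def by blast
  then have "P *v x = (Q + transpose A ** P ** A
         - transpose A ** P ** B ** matrix_inv gram ** transpose B ** P ** A) *v x"
    by (rule arg_cong[where f = "\<lambda>M. M *v x"])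
  also have "\<dots> = Q *v x + (transpose A *v (P *v (A *v x)) - transpose A *v (P *v (B *v (gain *v x))))"
    by (simp add: gain_mult matrix_vector_mult_add_rdistrib matrix_vector_mult_diff_rdistrib
        matrix_vector_mul_assoc matrix_mul_assoc)
  finally show ?thesis
    by (simp add: F_mult matrix_vector_mult_diff_distrib)
qed

text \<open>A x splits into F x and B times the feedback, and \<open>BPF_inner\<close> converts the
  second part into control cost. The bilinear form is needed because derivatives of the cost pair
  two different trajectories.\<close>

lemma lyapunov: "x \<bullet> (P *v y) = x \<bullet> (Q *v y) + (F *v x) \<bullet> (P *v (F *v y)) + (gain *v x) \<bullet> (R *v (gain *v y))"
proof -
  have "x \<bullet> (P *v y) = x \<bullet> (Q *v y) + (A *v x) \<bullet> (P *v (F *v y))"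
    using inner_transpose[of A "P *v (F *v y)" x]
    by (subst P_mult) (simp add: inner_add_right inner_commute)
  also have "A *v x = F *v x + B *v (gain *v x)" by (simp add: F_mult)
  also have "(F *v x + B *v (gain *v x)) \<bullet> (P *v (F *v y))
      = (F *v x) \<bullet> (P *v (F *v y)) + (gain *v x) \<bullet> (R *v (gain *v y))"
    by (simp add: inner_add_left BPF_inner)
  finally show ?thesis by simp
qed

text \<open>\<open>lyapunov\<close> telescopes along the closed loop, and the terminal form that is
  dropped is nonnegative.\<close>

lemma closed_loop_energy:
  "(\<Sum>t<T. (matpow F t *v x) \<bullet> (Q *v (matpow F t *v x))
      + (gain *v (matpow F t *v x)) \<bullet> (R *v (gain *v (matpow F t *v x)))) \<le> x \<bullet> (P *v x)"
proof -
  have "(\<Sum>t<T. (matpow F t *v x) \<bullet> (Q *v (matpow F t *v x))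
      + (gain *v (matpow F t *v x)) \<bullet> (R *v (gain *v (matpow F t *v x))))
      + (matpow F T *v x) \<bullet> (P *v (matpow F T *v x)) = x \<bullet> (P *v x)"
  proof (induction T)
    case (Suc T)
    have "matpow F (Suc T) *v x = F *v (matpow F T *v x)"
      by (simp add: matpow_Suc matrix_vector_mul_assoc)
    with Suc lyapunov[of "matpow F T *v x" "matpow F T *v x"] show ?case by simp
  qed simp
  with form_nonneg(3)[of "matpow F T *v x"] show ?thesis by linarith
qed

text \<open>The closed loop is an open-loop trajectory under the input - \<open>gain\<close> y, so
  \<open>detectable_energy_bound\<close> converts its finite cost into finite energy.\<close>

lemma closed_loop_square_summable:
  "\<exists>D. \<forall>T. (\<Sum>t\<le>T. (norm (matpow F t *v x))\<^sup>2) \<le> D"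
proof -
  obtain C where C: "C \<ge> 0" and bound: "\<And>T y d. (\<And>t. t < T \<Longrightarrow> y (Suc t) = A *v y t + B *v d t) \<Longrightarrow>
      (\<Sum>t\<le>T. (norm (y t))\<^sup>2) \<le> C * ((norm (y 0))\<^sup>2 + (\<Sum>t<T. y t \<bullet> (Q *v y t) + d t \<bullet> (R *v d t)))"
    by (rule detectable_energy_bound[OF detectable psd(1) pd_R, of B]) blast
  have "(\<Sum>t\<le>T. (norm (matpow F t *v x))\<^sup>2) \<le> C * ((norm x)\<^sup>2 + x \<bullet> (P *v x))" for T
  proof -
    let ?y = "\<lambda>t. matpow F t *v x"
    have "?y (Suc t) = A *v ?y t + B *v (- (gain *v ?y t))" for t
    proof -
      have "?y (Suc t) = F *v ?y t" by (simp add: matpow_Suc matrix_vector_mul_assoc)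
      then show ?thesis by (simp add: F_mult vec.neg)
    qed
    then have "(\<Sum>t\<le>T. (norm (?y t))\<^sup>2) \<le> C * ((norm (?y 0))\<^sup>2
        + (\<Sum>t<T. ?y t \<bullet> (Q *v ?y t) + (- (gain *v ?y t)) \<bullet> (R *v (- (gain *v ?y t)))))"
      by (intro bound)
    also have "\<dots> \<le> C * ((norm x)\<^sup>2 + x \<bullet> (P *v x))"
      using closed_loop_energy[of x T] C by (intro mult_left_mono add_mono) (auto simp: vec.neg)
    finally show ?thesis .
  qed
  then show ?thesis by blast
qed

text \<open>An eigenvector v with eigenvalue of modulus at least 1 would keep the norm of
  \<open>F^t\<close> v at least that of v for ever, whereas the orbits of its real and imaginary
  parts are square summable.\<close>

lemma spectral_radius_closed_loop: "spectral_radius F < 1"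
  unfolding spectral_radius_less_iff
proof (intro ballI, rule ccontr)
  fix c assume "c \<in> complex_eigenvalues F" and "\<not> cmod c < 1"
  then obtain v where v: "v \<noteq> 0" "cmat F *v v = c *s v" and c: "1 \<le> cmod c"
    by (auto simp: complex_eigenvalues_def)
  define a b where "a = (\<chi> i. Re (v $ i))" and "b = (\<chi> i. Im (v $ i))"
  have vab: "v = cvec a + \<i> *s cvec b"
    by (simp add: vec_eq_iff cvec_def a_def b_def complex_eq_iff)
  have pow: "((*v) (cmat F) ^^ t) v = c ^ t *s v" for t
    by (induction t) (simp_all add: v matrix_vector_mult_scale vector_smult_assoc mult.commute)
  have le: "(norm v)\<^sup>2 \<le> 2 * (norm (matpow F t *v a))\<^sup>2 + 2 * (norm (matpow F t *v b))\<^sup>2" for t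
  proof -
    have "norm v \<le> cmod c ^ t * norm v"
      using one_le_power[OF c, of t] mult_right_mono[of 1 "cmod c ^ t" "norm v"] by simp
    also have "\<dots> = norm (((*v) (cmat F) ^^ t) v)"
      by (simp add: pow norm_scale_complex norm_power)
    also have "((*v) (cmat F) ^^ t) v = cvec (matpow F t *v a) + \<i> *s cvec (matpow F t *v b)"
      unfolding cmat_pow cmat_pow_cvec[symmetric] vab
      by (simp add: matrix_vector_right_distrib matrix_vector_mult_scale)
    finally have "(norm v)\<^sup>2 \<le> (norm (cvec (matpow F t *v a) + \<i> *s cvec (matpow F t *v b)))\<^sup>2"
      by (intro power_mono) auto
    also have "\<dots> \<le> 2 * (norm (matpow F t *v a))\<^sup>2 + 2 * (norm (matpow F t *v b))\<^sup>2"
      using norm_add_sq_le[of "cvec (matpow F t *v a)" "\<i> *s cvec (matpow F t *v b)"]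
      by (simp add: norm_scale_complex norm_cvec)
    finally show ?thesis .
  qed
  obtain Da where Da: "\<And>T. (\<Sum>t\<le>T. (norm (matpow F t *v a))\<^sup>2) \<le> Da"
    using closed_loop_square_summable by blast
  obtain Db where Db: "\<And>T. (\<Sum>t\<le>T. (norm (matpow F t *v b))\<^sup>2) \<le> Db"
    using closed_loop_square_summable by blast
  have "real T * (norm v)\<^sup>2 \<le> 2 * Da + 2 * Db" for T
  proof -
    have "real T * (norm v)\<^sup>2 \<le> (\<Sum>t\<le>T. (norm v)\<^sup>2)" by (simp add: mult_right_mono)
    also have "\<dots> \<le> (\<Sum>t\<le>T. 2 * (norm (matpow F t *v a))\<^sup>2 + 2 * (norm (matpow F t *v b))\<^sup>2)"
      by (intro sum_mono le)
    also have "\<dots> \<le> 2 * Da + 2 * Db"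
      unfolding sum.distrib sum_distrib_left[symmetric] using Da[of T] Db[of T] by linarith
    finally show ?thesis .
  qed
  moreover obtain T where "2 * Da + 2 * Db < real T * (norm v)\<^sup>2"
    using v(1) reals_Archimedean3[of "(norm v)\<^sup>2"] by auto
  ultimately show False by (meson not_less)
qed

text \<open>y is the difference of two trajectories from the same initial state, hence
  \<open>y 0 = 0\<close>. The squares on the left are those of the quantities that the derivative of
  the cost pairs with the deviation and with the terminal state, so this bound can absorb the linear
  part.\<close>

lemma homogeneous_coercive:
  obtains c where "c > 0" "\<And>T y d. y 0 = 0 \<Longrightarrow> (\<And>t. t < T \<Longrightarrow> y (Suc t) = A *v y t + B *v d t) \<Longrightarrow>
    c * ((\<Sum>t<T. (norm (d t + gain *v y t))\<^sup>2) + (norm (y T))\<^sup>2)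
      \<le> (\<Sum>t<T. y t \<bullet> (Q *v y t) + d t \<bullet> (R *v d t)) + y T \<bullet> (Qf *v y T)"
proof -
  obtain C where C: "C \<ge> 0" and bound: "\<And>T y d. (\<And>t. t < T \<Longrightarrow> y (Suc t) = A *v y t + B *v d t) \<Longrightarrow>
      (\<Sum>t\<le>T. (norm (y t))\<^sup>2) \<le> C * ((norm (y 0))\<^sup>2 + (\<Sum>t<T. y t \<bullet> (Q *v y t) + d t \<bullet> (R *v d t)))"
    by (rule detectable_energy_bound[OF detectable psd(1) pd_R, of B]) blast
  obtain r where r: "r \<ge> 0" "\<And>x. (norm x)\<^sup>2 \<le> r * (x \<bullet> (R *v x))"
    using pd_coercive[OF pd_R] by blast
  define g where "g = (spectral_norm gain)\<^sup>2"
  define D where "D = 2 * r + 2 * g * C + C"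
  have "0 \<le> D" using C r by (simp add: D_def g_def)
  have "(\<Sum>t<T. (norm (d t + gain *v y t))\<^sup>2) + (norm (y T))\<^sup>2
      \<le> D * ((\<Sum>t<T. y t \<bullet> (Q *v y t) + d t \<bullet> (R *v d t)) + y T \<bullet> (Qf *v y T))"
    if y: "y 0 = 0" "\<And>t. t < T \<Longrightarrow> y (Suc t) = A *v y t + B *v d t" for T y d
  proof -
    let ?E = "\<Sum>t<T. y t \<bullet> (Q *v y t) + d t \<bullet> (R *v d t)"
    have sy: "(\<Sum>t\<le>T. (norm (y t))\<^sup>2) \<le> C * ?E" using bound[where T = T and y = y and d = d, OF y(2)] y(1) by simp
    have sy': "(\<Sum>t<T. (norm (y t))\<^sup>2) + (norm (y T))\<^sup>2 = (\<Sum>t\<le>T. (norm (y t))\<^sup>2)"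
      by (simp add: lessThan_Suc_atMost[symmetric])
    have sd: "(\<Sum>t<T. (norm (d t))\<^sup>2) \<le> r * ?E"
      unfolding sum_distrib_left
    proof (intro sum_mono)
      fix t
      have "d t \<bullet> (R *v d t) \<le> y t \<bullet> (Q *v y t) + d t \<bullet> (R *v d t)" using form_nonneg(1) by simp
      from order_trans[OF r(2) mult_left_mono[OF this r(1)]]
      show "(norm (d t))\<^sup>2 \<le> r * (y t \<bullet> (Q *v y t) + d t \<bullet> (R *v d t))" .
    qed
    have "(\<Sum>t<T. (norm (d t + gain *v y t))\<^sup>2) \<le> (\<Sum>t<T. 2 * (norm (d t))\<^sup>2 + 2 * g * (norm (y t))\<^sup>2)"
    proof (intro sum_mono)
      fix t
      show "(norm (d t + gain *v y t))\<^sup>2 \<le> 2 * (norm (d t))\<^sup>2 + 2 * g * (norm (y t))\<^sup>2"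
        using norm_add_sq_le[of "d t" "gain *v y t"] norm_matrix_vector_sq_le[of gain "y t"]
        unfolding g_def by linarith
    qed
    also have "\<dots> = 2 * (\<Sum>t<T. (norm (d t))\<^sup>2) + 2 * g * (\<Sum>t<T. (norm (y t))\<^sup>2)"
      by (simp add: sum.distrib sum_distrib_left)
    also have "\<dots> \<le> 2 * (r * ?E) + 2 * g * (C * ?E)"
    proof -
      have "(\<Sum>t<T. (norm (y t))\<^sup>2) \<le> C * ?E" using sy sy' zero_le_power2[of "norm (y T)"] by linarith
      with sd show ?thesis by (intro add_mono mult_left_mono) (auto simp: g_def)
    qed
    finally have "(\<Sum>t<T. (norm (d t + gain *v y t))\<^sup>2) + (norm (y T))\<^sup>2
        \<le> 2 * (r * ?E) + 2 * g * (C * ?E) + C * ?E"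
      using sy sy' sum_nonneg[of "{..<T}" "\<lambda>t. (norm (y t))\<^sup>2"] by simp
    also have "\<dots> = D * ?E" by (simp add: D_def algebra_simps)
    also have "\<dots> \<le> D * (?E + y T \<bullet> (Qf *v y T))"
      using \<open>0 \<le> D\<close> form_nonneg(2) by (intro mult_left_mono) auto
    finally show ?thesis .
  qed
  note main = this
  show thesis
  \<comment> \<open>D may be 0; adding 1 keeps the witness positive.\<close>
  proof (rule that[of "1 / (D + 1)"])
    show "0 < 1 / (D + 1)" using \<open>0 \<le> D\<close> by simp
    fix T and y :: "nat \<Rightarrow> real^'n" and d :: "nat \<Rightarrow> real^'d"
    assume y: "y 0 = 0" "\<And>t. t < T \<Longrightarrow> y (Suc t) = A *v y t + B *v d t"
    let ?H = "(\<Sum>t<T. y t \<bullet> (Q *v y t) + d t \<bullet> (R *v d t)) + y T \<bullet> (Qf *v y T)"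
    have "0 \<le> ?H" using form_nonneg by (intro add_nonneg_nonneg sum_nonneg) auto
    with main[where T = T and y = y and d = d, OF y] have "(\<Sum>t<T. (norm (d t + gain *v y t))\<^sup>2) + (norm (y T))\<^sup>2 \<le> (D + 1) * ?H"
      by (simp add: distrib_right)
    with \<open>0 \<le> D\<close> show "1 / (D + 1) * ((\<Sum>t<T. (norm (d t + gain *v y t))\<^sup>2) + (norm (y T))\<^sup>2) \<le> ?H"
      by (simp add: field_simps)
  qed
qed

text \<open>Disturbances \<open>w t, \<dots>, w (t + n - 1)\<close> enter the optimal control at time \<open>t\<close> only through
  this vector.\<close>

definition preview :: "nat \<Rightarrow> (nat \<Rightarrow> real^'n) \<Rightarrow> nat \<Rightarrow> real^'n" where
  "preview n w t = (\<Sum>i<n. matpow (transpose F) i *v (P *v w (t + i)))"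

lemma preview_0 [simp]: "preview 0 w t = 0"
  by (simp add: preview_def)

lemma preview_Suc: "preview (Suc n) w t = P *v w t + transpose F *v preview n w (Suc t)"
  unfolding preview_def
  by (simp add: sum.lessThan_Suc_shift matrix_vector_mult_sum matpow_Suc del: sum.lessThan_Suc
      flip: matrix_vector_mul_assoc)

text \<open>Separates the prediction window from the unseen tail. The k-th power of the transposed
  closed loop in front of the tail is the source of the regret rate.\<close>

lemma preview_add: "preview (k + n) w t = preview k w t + matpow (transpose F) k *v preview n w (t + k)"
  by (induction k arbitrary: t)
    (simp_all add: preview_Suc matrix_vector_right_distrib matpow_Suc matrix_vector_mul_assoc add.assoc)

definition deviation :: "nat \<Rightarrow> (nat \<Rightarrow> real^'n) \<Rightarrow> nat \<Rightarrow> real^'n \<Rightarrow> real^'d \<Rightarrow> real^'d" where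
  "deviation T w t x u = u + gain *v x + matrix_inv gram *v (transpose B *v preview (T - t) w t)"

text \<open>One step of the telescoping sum for \<open>(P x\<^sub>t + F\<^sup>T g\<^sub>t) \<bullet> y\<^sub>t\<close>: the derivative of the cost with
  terminal weight \<open>P\<close> only sees the deviation from the optimal feedback law.\<close>

lemma costate_step:
  "(P *v (A *v x + B *v u + w) + h) \<bullet> (A *v y + B *v d) + x \<bullet> (Q *v y) + u \<bullet> (R *v d)
    = (P *v x + transpose F *v (P *v w + h)) \<bullet> y
      + (u + gain *v x + matrix_inv gram *v (transpose B *v (P *v w + h))) \<bullet> (gram *v (d + gain *v y))"
proof -
  define g where "g = P *v w + h"
  define e where "e = u + gain *v x"
  define f where "f = d + gain *v y"
  \<comment> \<open>Measured relative to the feedback, the inputs act on the dynamics F x + B e, and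
    \<open>BPF_inner\<close> cancels all terms mixing F with B.\<close>
  have u: "u = e - gain *v x" and d: "d = f - gain *v y" by (simp_all add: e_def f_def)
  have Ax: "A *v x + B *v u = F *v x + B *v e" and Ay: "A *v y + B *v d = F *v y + B *v f"
    by (simp_all add: F_mult e_def f_def matrix_vector_right_distrib)
  have 1: "(F *v x) \<bullet> (P *v (B *v f)) = (gain *v x) \<bullet> (R *v f)"
    using BPF_inner[of f x] form_sym(3)[of "F *v x" "B *v f"] form_sym(4)[of "gain *v x" f]
    by (simp add: inner_commute)
  have 3: "(matrix_inv gram *v (transpose B *v g)) \<bullet> (gram *v f) = g \<bullet> (B *v f)"
    by (simp add: gram_sym[symmetric] gram_inverse inner_transpose)
  have "(P *v (A *v x + B *v u + w) + h) = P *v (F *v x) + P *v (B *v e) + g"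
    unfolding Ax g_def by (simp add: matrix_vector_right_distrib)
  moreover have "u \<bullet> (R *v d) = (e - gain *v x) \<bullet> (R *v (f - gain *v y))"
    by (simp flip: u d)
  ultimately have "(P *v (A *v x + B *v u + w) + h) \<bullet> (A *v y + B *v d) + x \<bullet> (Q *v y) + u \<bullet> (R *v d)
    = (P *v (F *v x) + P *v (B *v e) + g) \<bullet> (F *v y + B *v f) + x \<bullet> (Q *v y)
      + (e - gain *v x) \<bullet> (R *v (f - gain *v y))"
    by (simp only: Ay)
  also have "\<dots> = x \<bullet> (P *v y) + g \<bullet> (F *v y) + e \<bullet> (gram *v f) + g \<bullet> (B *v f)"
    unfolding lyapunov[of x y] gram_inner
    by (simp add: inner_add_left inner_add_right inner_diff_left inner_diff_right
        matrix_vector_mult_diff_distrib 1 BPF_inner form_sym)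
  also have "\<dots> = (P *v x + transpose F *v g) \<bullet> y + (e + matrix_inv gram *v (transpose B *v g)) \<bullet> (gram *v f)"
    by (simp add: inner_add_left inner_transpose 3 form_sym)
  finally show ?thesis by (simp only: g_def e_def f_def)
qed

text \<open>\<open>costate_step\<close> telescopes: the product vanishes at time 0 because
  \<open>y 0 = 0\<close>, and at time T the preview is empty. With x = y and no disturbance the same
  identity evaluates the quadratic part of the cost.\<close>

lemma sum_costate:
  assumes x: "\<And>t. t < T \<Longrightarrow> x (Suc t) = A *v x t + B *v u t + w t"
    and y: "y 0 = 0" "\<And>t. t < T \<Longrightarrow> y (Suc t) = A *v y t + B *v d t"
  shows "(\<Sum>t<T. x t \<bullet> (Q *v y t) + u t \<bullet> (R *v d t)) + x T \<bullet> (P *v y T)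
    = (\<Sum>t<T. deviation T w t (x t) (u t) \<bullet> (gram *v (d t + gain *v y t)))"
proof -
  have "(P *v x s + transpose F *v preview (T - s) w s) \<bullet> y s
      + (\<Sum>t<s. x t \<bullet> (Q *v y t) + u t \<bullet> (R *v d t))
      = (\<Sum>t<s. deviation T w t (x t) (u t) \<bullet> (gram *v (d t + gain *v y t)))" if "s \<le> T" for s
    using that
  proof (induction s)
    case 0
    show ?case by (simp add: y)
  next
    case (Suc s)
    have g: "preview (T - s) w s = P *v w s + transpose F *v preview (T - Suc s) w (Suc s)"
      using Suc.prems preview_Suc[of "T - Suc s" w s] by (simp add: Suc_diff_Suc)
    from Suc show ?case
      using costate_step[of "x s" "u s" "w s" "transpose F *v preview (T - Suc s) w (Suc s)" "y s" "d s"]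
      unfolding deviation_def g[symmetric] using x[of s] y(2)[of s] by simp
  qed
  from this[of T] show ?thesis by (simp add: form_sym)
qed

lemma cost_expand:
  assumes v: "\<And>t. v t = u t + d t" and xv: "\<And>t. state A B x0 v w t = state A B x0 u w t + y t"
    and x_def: "x = state A B x0 u w"
  shows "cost A B Q R Qf x0 T v w = cost A B Q R Qf x0 T u w
      + 2 * ((\<Sum>t<T. x t \<bullet> (Q *v y t) + u t \<bullet> (R *v d t)) + x T \<bullet> (Qf *v y T))
      + ((\<Sum>t<T. y t \<bullet> (Q *v y t) + d t \<bullet> (R *v d t)) + y T \<bullet> (Qf *v y T))"
proof -
  have sq: "(a + b) \<bullet> (M *v (a + b)) = a \<bullet> (M *v a) + 2 * (a \<bullet> (M *v b)) + b \<bullet> (M *v b)"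
    if "\<And>a b. (M *v a) \<bullet> b = a \<bullet> (M *v b)" for M :: "real^'e^'e" and a b
    using that[of a b] by (simp add: matrix_vector_right_distrib inner_add_left inner_add_right inner_commute)
  show ?thesis
    unfolding cost_def Let_def xv v x_def[symmetric] sq[OF form_sym(1)] sq[OF form_sym(2)] sq[OF form_sym(4)]
    by (simp add: sum.distrib sum_distrib_left algebra_simps)
qed

text \<open>The cost of v is expanded around u. Young's inequality is weighted by the coercivity
  constant c, so it spends exactly the quadratic part and every trace of v disappears from the
  bound.\<close>

lemma cost_diff_le:
  "\<exists>C\<ge>0. \<forall>T x0 u v w. cost A B Q R Qf x0 T u w - cost A B Q R Qf x0 T v w
    \<le> C * ((\<Sum>t<T. (norm (deviation T w t (state A B x0 u w t) (u t)))\<^sup>2) + (norm (state A B x0 u w T))\<^sup>2)"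
proof (rule homogeneous_coercive)
  fix c :: real
  assume "c > 0" and coercive: "\<And>T y d. y 0 = 0 \<Longrightarrow> (\<And>t. t < T \<Longrightarrow> y (Suc t) = A *v y t + B *v d t) \<Longrightarrow>
    c * ((\<Sum>t<T. (norm (d t + gain *v y t))\<^sup>2) + (norm (y T))\<^sup>2)
      \<le> (\<Sum>t<T. y t \<bullet> (Q *v y t) + d t \<bullet> (R *v d t)) + y T \<bullet> (Qf *v y T)"
  \<comment> \<open>One bound for both matrices of the linear part: \<open>gram\<close> on the
    deviations, and P - Qf on the terminal state, because \<open>sum_costate\<close> is written for
    terminal weight P.\<close>
  define m where "m = max (spectral_norm gram) (spectral_norm (P - Qf))"
  have young: "- (2 * (a \<bullet> (M *v b))) \<le> m\<^sup>2 / c * (norm a)\<^sup>2 + c * (norm b)\<^sup>2"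
    if "spectral_norm M \<le> m" for M :: "real^'e^'e" and a b :: "real^'e"
  proof -
    have "- (a \<bullet> (M *v b)) \<le> norm a * norm (M *v b)"
      using Cauchy_Schwarz_ineq2[of a "M *v b"] by linarith
    also have "\<dots> \<le> norm a * (m * norm b)"
    proof (rule mult_left_mono)
      show "norm (M *v b) \<le> m * norm b"
        by (rule order_trans[OF norm_matrix_vector_le]) (rule mult_right_mono[OF that norm_ge_zero])
    qed simp
    also have "\<dots> = (m * norm a) * norm b" by simp
    finally have "- (2 * (a \<bullet> (M *v b))) \<le> 2 * ((m * norm a) * norm b)" by linarith
    also have "\<dots> \<le> (m * norm a)\<^sup>2 / c + c * (norm b)\<^sup>2"
    proof -
      have "0 \<le> (m * norm a - c * norm b)\<^sup>2" by simp
      then have "c * (2 * ((m * norm a) * norm b)) \<le> (m * norm a)\<^sup>2 + c * (c * (norm b)\<^sup>2)"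
        by (simp add: power2_eq_square algebra_simps)
      with \<open>c > 0\<close> show ?thesis by (simp add: field_simps)
    qed
    finally show ?thesis by (simp add: power_mult_distrib)
  qed
  have "cost A B Q R Qf x0 T u w - cost A B Q R Qf x0 T v w
    \<le> m\<^sup>2 / c * ((\<Sum>t<T. (norm (deviation T w t (state A B x0 u w t) (u t)))\<^sup>2)
      + (norm (state A B x0 u w T))\<^sup>2)" for T x0 u v w
  proof -
    define x where "x = state A B x0 u w"
    define d where "d t = v t - u t" for t
    define y where "y t = state A B x0 v w t - x t" for t
    define D where "D t = deviation T w t (x t) (u t)" for t
    define f where "f t = d t + gain *v y t" for t
    have x: "x (Suc t) = A *v x t + B *v u t + w t" for t by (simp add: x_def)
    have y: "y 0 = 0" "y (Suc t) = A *v y t + B *v d t" for t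
      by (simp_all add: y_def x_def d_def matrix_vector_mult_diff_distrib)
    have "cost A B Q R Qf x0 T v w = cost A B Q R Qf x0 T u w
      + 2 * ((\<Sum>t<T. x t \<bullet> (Q *v y t) + u t \<bullet> (R *v d t)) + x T \<bullet> (Qf *v y T))
      + ((\<Sum>t<T. y t \<bullet> (Q *v y t) + d t \<bullet> (R *v d t)) + y T \<bullet> (Qf *v y T))"
      by (rule cost_expand) (simp_all add: d_def y_def x_def)
    also have "(\<Sum>t<T. x t \<bullet> (Q *v y t) + u t \<bullet> (R *v d t)) + x T \<bullet> (Qf *v y T)
        = (\<Sum>t<T. D t \<bullet> (gram *v f t)) - x T \<bullet> ((P - Qf) *v y T)"
      using sum_costate[of T x u w y d, OF x y(1) y(2)] unfolding D_def f_def
      by (simp add: matrix_vector_mult_diff_rdistrib inner_diff_right)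
    finally have eq: "cost A B Q R Qf x0 T u w - cost A B Q R Qf x0 T v w
      = (\<Sum>t<T. - (2 * (D t \<bullet> (gram *v f t)))) + 2 * (x T \<bullet> ((P - Qf) *v y T))
        - ((\<Sum>t<T. y t \<bullet> (Q *v y t) + d t \<bullet> (R *v d t)) + y T \<bullet> (Qf *v y T))"
      by (simp add: sum_negf sum_distrib_left[symmetric])
    have 1: "(\<Sum>t<T. - (2 * (D t \<bullet> (gram *v f t))))
        \<le> m\<^sup>2 / c * (\<Sum>t<T. (norm (D t))\<^sup>2) + c * (\<Sum>t<T. (norm (f t))\<^sup>2)"
      unfolding sum_distrib_left sum.distrib[symmetric] by (intro sum_mono young) (simp add: m_def)
    have 2: "2 * (x T \<bullet> ((P - Qf) *v y T)) \<le> m\<^sup>2 / c * (norm (x T))\<^sup>2 + c * (norm (y T))\<^sup>2"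
      using young[of "P - Qf" "- x T" "y T"] by (simp add: m_def)
    have 3: "c * ((\<Sum>t<T. (norm (f t))\<^sup>2) + (norm (y T))\<^sup>2)
        \<le> (\<Sum>t<T. y t \<bullet> (Q *v y t) + d t \<bullet> (R *v d t)) + y T \<bullet> (Qf *v y T)"
      unfolding f_def by (intro coercive y)
    show ?thesis
      using eq 1 2 3 unfolding D_def[symmetric] x_def[symmetric] distrib_left by linarith
  qed
  moreover have "0 \<le> m\<^sup>2 / c" using \<open>c > 0\<close> by simp
  ultimately show ?thesis by blast
qed

end

section \<open>Nested expectations and value functions\<close>

lemma INF_ennreal_add_const_set:
  fixes f :: "'i \<Rightarrow> ennreal"
  assumes "I \<noteq> {}"
  shows "(INF i\<in>I. f i + c) = (INF i\<in>I. f i) + c"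
proof (rule antisym)
  show "(INF i\<in>I. f i) + c \<le> (INF i\<in>I. f i + c)"
    by (intro INF_greatest add_right_mono INF_lower)
  show "(INF i\<in>I. f i + c) \<le> (INF i\<in>I. f i) + c"
  proof (cases "c = top")
    case False
    have "(INF i\<in>I. f i + c) - c \<le> (INF i\<in>I. f i)"
    proof (rule INF_greatest)
      fix i assume "i \<in> I"
      then have "(INF i\<in>I. f i + c) \<le> f i + c" by (rule INF_lower)
      then show "(INF i\<in>I. f i + c) - c \<le> f i"
        using False by (simp add: ennreal_minus_le_iff add.commute)
    qed
    then show ?thesis by (simp add: ennreal_minus_le_iff add.commute)
  qed simp
qed

text \<open>The integral of an arbitrary function is the lower integral, which is additive as soon as one
  summand is measurable. Hence nothing needs to be known about measurability of value functions.\<close>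

lemma nn_integral_add_right_measurable:
  assumes g: "g \<in> borel_measurable M"
  shows "(\<integral>\<^sup>+x. f x + g x \<partial>M) = (\<integral>\<^sup>+x. f x \<partial>M) + (\<integral>\<^sup>+x. g x \<partial>M)"
proof (rule antisym)
  let ?S = "{s. simple_function M s \<and> s \<le> f}"
  have ne: "?S \<noteq> {}"
    using simple_function_const[of M 0] by (auto simp: le_fun_def intro!: exI[of _ "\<lambda>_. 0"])
  have "(\<integral>\<^sup>+x. f x \<partial>M) + (\<integral>\<^sup>+x. g x \<partial>M) = (SUP s\<in>?S. integral\<^sup>S M s + (\<integral>\<^sup>+x. g x \<partial>M))"
    unfolding nn_integral_def[of M f] by (rule ennreal_SUP_add_left[OF ne, symmetric])
  also have "\<dots> \<le> (\<integral>\<^sup>+x. f x + g x \<partial>M)"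
  proof (rule SUP_least)
    fix s assume s: "s \<in> ?S"
    then have "integral\<^sup>S M s + (\<integral>\<^sup>+x. g x \<partial>M) = (\<integral>\<^sup>+x. s x + g x \<partial>M)"
      using g by (simp add: nn_integral_eq_simple_integral nn_integral_add borel_measurable_simple_function)
    also have "\<dots> \<le> (\<integral>\<^sup>+x. f x + g x \<partial>M)"
      using s by (intro nn_integral_mono add_right_mono) (auto simp: le_fun_def)
    finally show "integral\<^sup>S M s + (\<integral>\<^sup>+x. g x \<partial>M) \<le> (\<integral>\<^sup>+x. f x + g x \<partial>M)" .
  qed
  finally show "(\<integral>\<^sup>+x. f x \<partial>M) + (\<integral>\<^sup>+x. g x \<partial>M) \<le> (\<integral>\<^sup>+x. f x + g x \<partial>M)" .
next
  show "(\<integral>\<^sup>+x. f x + g x \<partial>M) \<le> (\<integral>\<^sup>+x. f x \<partial>M) + (\<integral>\<^sup>+x. g x \<partial>M)"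
  proof (cases "(\<integral>\<^sup>+x. g x \<partial>M) = top")
    case False
    \<comment> \<open>In \<open>ennreal\<close>, \<open>top - x\<close> is \<open>top\<close> even
      for \<open>x = top\<close>, so the estimate \<open>s x - g x \<le> f x\<close> below is made
      only where g is finite.\<close>
    then have fin: "AE x in M. g x \<noteq> \<infinity>" using g by (intro nn_integral_noteq_infinite) auto
    show ?thesis
      unfolding nn_integral_def[of M "\<lambda>x. f x + g x"]
    proof (rule SUP_least)
      fix s assume s: "s \<in> {s. simple_function M s \<and> s \<le> (\<lambda>x. f x + g x)}"
      then have m: "s \<in> borel_measurable M" by (simp add: borel_measurable_simple_function)
      have "integral\<^sup>S M s = (\<integral>\<^sup>+x. s x \<partial>M)" using s by (simp add: nn_integral_eq_simple_integral)
      also have "\<dots> \<le> (\<integral>\<^sup>+x. (s x - g x) + g x \<partial>M)"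
        by (intro nn_integral_mono) (auto simp: diff_add_self_ennreal)
      also have "\<dots> = (\<integral>\<^sup>+x. s x - g x \<partial>M) + (\<integral>\<^sup>+x. g x \<partial>M)"
        using m g by (intro nn_integral_add) auto
      also have "(\<integral>\<^sup>+x. s x - g x \<partial>M) \<le> (\<integral>\<^sup>+x. f x \<partial>M)"
        using fin s by (intro nn_integral_mono_AE)
          (auto simp: le_fun_def ennreal_minus_le_iff add.commute elim!: eventually_mono)
      finally show "integral\<^sup>S M s \<le> (\<integral>\<^sup>+x. f x \<partial>M) + (\<integral>\<^sup>+x. g x \<partial>M)" by (simp add: add_right_mono)
    qed
  qed simp
qed

text \<open>Adaptedness as functional dependence on the first s coordinates, so that causality of a
  controller involves no sigma-algebra.\<close>

definition depends_below :: "nat \<Rightarrow> ((nat \<Rightarrow> 'a) \<Rightarrow> 'b) \<Rightarrow> bool" where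
  "depends_below s f \<longleftrightarrow> (\<forall>w w'. (\<forall>i<s. w i = w' i) \<longrightarrow> f w = f w')"

lemma depends_belowD: "depends_below s f \<Longrightarrow> (\<And>i. i < s \<Longrightarrow> w i = w' i) \<Longrightarrow> f w = f w'"
  unfolding depends_below_def by blast

locale disturbance =
  fixes W :: "(nat \<Rightarrow> real^'n) measure" and K :: "nat \<Rightarrow> (nat \<Rightarrow> real^'n) \<Rightarrow> (real^'n) measure"
  assumes law: "joint_law W" and cond: "cond_laws W K"
begin

lemma prob_space_W: "prob_space W" and sets_W: "sets W = sets seq_space"
  using law by (auto simp: joint_law_def)

lemma measurable_W: "measurable W N = measurable seq_space N"
  by (rule measurable_cong_sets[OF sets_W refl])

lemma kernel: "K t \<in> prefix_space t \<rightarrow>\<^sub>M prob_algebra borel"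
  using cond by (auto simp: cond_laws_def)

lemma measurable_prefix: "(\<lambda>w. restrict w {..<t}) \<in> seq_space \<rightarrow>\<^sub>M prefix_space t"
  by (rule measurable_restrict_subset) simp

lemma kernel_prefix: "(\<lambda>w. K t (restrict w {..<t})) \<in> seq_space \<rightarrow>\<^sub>M prob_algebra borel"
  by (rule measurable_compose[OF measurable_prefix kernel])

lemma sets_kernel_prefix: "sets (K t (restrict w {..<t})) = sets borel"
proof -
  have "restrict w {..<t} \<in> space (prefix_space t)" by (simp add: space_PiM)
  then show ?thesis using measurable_space[OF kernel] by (auto simp: space_prob_algebra)
qed

lemma measurable_update: "(\<lambda>(w, y). w(s := y)) \<in> seq_space \<Otimes>\<^sub>M borel \<rightarrow>\<^sub>M (seq_space :: (nat \<Rightarrow> real^'n) measure)"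
  using measurable_add_dim[of s UNIV "\<lambda>_. borel :: (real^'n) measure"] by simp

lemma measurable_update_snd: "(\<lambda>y. w(s := y)) \<in> borel \<rightarrow>\<^sub>M (seq_space :: (nat \<Rightarrow> real^'n) measure)"
proof -
  have "(\<lambda>y. (w, y)) \<in> borel \<rightarrow>\<^sub>M seq_space \<Otimes>\<^sub>M (borel :: (real^'n) measure)"
    by (rule measurable_Pair1') (simp add: space_PiM)
  from measurable_compose[OF this measurable_update[of s]] show ?thesis by simp
qed

lemma measurable_kernel_integral:
  assumes "f \<in> borel_measurable seq_space"
  shows "(\<lambda>w. \<integral>\<^sup>+y. f (w(s := y)) \<partial>K s (restrict w {..<s})) \<in> borel_measurable seq_space"
proof (rule nn_integral_measurable_subprob_algebra2)
  show "(\<lambda>(w, y). f (w(s := y))) \<in> borel_measurable (seq_space \<Otimes>\<^sub>M borel)"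
    using measurable_compose[OF measurable_update[of s] assms] by (simp add: case_prod_beta)
  show "(\<lambda>w. K s (restrict w {..<s})) \<in> seq_space \<rightarrow>\<^sub>M subprob_algebra borel"
    by (rule measurable_prob_algebraD[OF kernel_prefix])
qed

lemma measurable_prefix_component:
  "(\<lambda>w. (restrict w {..<s}, w s)) \<in> W \<rightarrow>\<^sub>M prefix_space s \<Otimes>\<^sub>M (borel :: (real^'n) measure)"
  unfolding measurable_W
  by (intro measurable_Pair measurable_prefix measurable_component_singleton) simp

lemma measurable_kernel_pair:
  "(\<lambda>w. distr (K s (restrict w {..<s})) (prefix_space s \<Otimes>\<^sub>M borel) (Pair (restrict w {..<s})))
    \<in> W \<rightarrow>\<^sub>M subprob_algebra (prefix_space s \<Otimes>\<^sub>M borel)"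
  unfolding measurable_W
proof (rule measurable_distr2[where M = borel])
  show "(\<lambda>(w, y). (restrict w {..<s}, y)) \<in> seq_space \<Otimes>\<^sub>M borel \<rightarrow>\<^sub>M prefix_space s \<Otimes>\<^sub>M (borel :: (real^'n) measure)"
    unfolding case_prod_beta
    by (intro measurable_Pair measurable_compose[OF measurable_fst measurable_prefix] measurable_snd)
  show "(\<lambda>w. K s (restrict w {..<s})) \<in> seq_space \<rightarrow>\<^sub>M subprob_algebra borel"
    by (rule measurable_prob_algebraD[OF kernel_prefix])
qed

text \<open>\<open>cond_laws\<close> states this identity on rectangles. They are stable under
  intersection and generate the product sigma-algebra, so the two finite measures agree.\<close>

lemma disintegration:
  "distr W (prefix_space s \<Otimes>\<^sub>M borel) (\<lambda>w. (restrict w {..<s}, w s))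
    = W \<bind> (\<lambda>w. distr (K s (restrict w {..<s})) (prefix_space s \<Otimes>\<^sub>M borel) (Pair (restrict w {..<s})))"
    (is "?D = W \<bind> ?N")
proof -
  let ?P = "prefix_space s :: (nat \<Rightarrow> real^'n) measure"
  let ?B = "borel :: (real^'n) measure"
  interpret prob_space W by (rule prob_space_W)
  note pair = measurable_prefix_component[of s] and N = measurable_kernel_pair[of s]
  show ?thesis
  proof (rule measure_eqI_generator_eq[OF Int_stable_pair_measure_generator[of ?P ?B]])
    let ?E = "{a \<times> b |a b. a \<in> sets ?P \<and> b \<in> sets ?B}"
    show "?E \<subseteq> Pow (space (?P \<Otimes>\<^sub>M ?B))"
      using sets.space_closed[of ?P] sets.space_closed[of ?B] by (auto simp: space_pair_measure)
    show "sets ?D = sigma_sets (space (?P \<Otimes>\<^sub>M ?B)) ?E"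
      by (simp add: sets_pair_measure space_pair_measure)
    have "sets (W \<bind> ?N) = sets (?P \<Otimes>\<^sub>M ?B)"
      by (rule sets_bind_measurable[OF N not_empty])
    then show "sets (W \<bind> ?N) = sigma_sets (space (?P \<Otimes>\<^sub>M ?B)) ?E"
      by (simp add: sets_pair_measure space_pair_measure)
    show "range (\<lambda>_. space ?P \<times> space ?B) \<subseteq> ?E"
      using sets.top[of ?P] sets.top[of ?B] by blast
    show "(\<Union>i::nat. space ?P \<times> space ?B) = space (?P \<Otimes>\<^sub>M ?B)"
      by (simp add: space_pair_measure)
    show "emeasure ?D (space ?P \<times> space ?B) \<noteq> \<infinity>" for i :: nat
    proof -
      have "prob_space ?D"
        by (rule prob_space_distr[OF pair])
      then show ?thesis
        using finite_measure.emeasure_finite[OF prob_space.finite_measure] by auto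
    qed
    fix X assume "X \<in> ?E"
    then obtain S Y where X: "X = S \<times> Y" and S: "S \<in> sets ?P" and Y: "Y \<in> sets ?B" by auto
    have "emeasure ?D X = emeasure W ((\<lambda>w. (restrict w {..<s}, w s)) -` X \<inter> space W)"
      using S Y unfolding X by (intro emeasure_distr[OF pair]) auto
    also have "(\<lambda>w. (restrict w {..<s}, w s)) -` X \<inter> space W = {w \<in> space W. restrict w {..<s} \<in> S \<and> w s \<in> Y}"
      by (auto simp: X)
    also have "emeasure W \<dots>
        = (\<integral>\<^sup>+w. indicator S (restrict w {..<s}) * emeasure (K s (restrict w {..<s})) Y \<partial>W)"
      using cond S Y by (auto simp: cond_laws_def)
    also have "\<dots> = (\<integral>\<^sup>+w. emeasure (?N w) X \<partial>W)"
    proof (rule nn_integral_cong)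
      fix w :: "nat \<Rightarrow> real^'n"
      define r where "r = restrict w {..<s}"
      have p: "r \<in> space ?P" by (simp add: r_def space_PiM)
      have K: "sets (K s r) = sets ?B" unfolding r_def by (rule sets_kernel_prefix)
      have "Pair r \<in> K s r \<rightarrow>\<^sub>M ?P \<Otimes>\<^sub>M ?B"
        unfolding measurable_cong_sets[OF K refl] by (rule measurable_Pair1'[OF p])
      then have "emeasure (distr (K s r) (?P \<Otimes>\<^sub>M ?B) (Pair r)) X
          = emeasure (K s r) (Pair r -` X \<inter> space (K s r))"
        using S Y unfolding X by (intro emeasure_distr) auto
      also have "Pair r -` X \<inter> space (K s r) = (if r \<in> S then Y else {})"
        using sets_eq_imp_space_eq[OF K] by (auto simp: X)
      finally show "indicator S (restrict w {..<s}) * emeasure (K s (restrict w {..<s})) Y = emeasure (?N w) X"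
        unfolding r_def[symmetric] by simp
    qed
    also have "\<dots> = emeasure (W \<bind> ?N) X"
      using S Y unfolding X by (intro emeasure_bind[OF not_empty N, symmetric]) auto
    finally show "emeasure ?D X = emeasure (W \<bind> ?N) X" .
  qed
qed

text \<open>A function of the first s + 1 coordinates factors through the pair of prefix and current
  disturbance, where \<open>disintegration\<close> applies.\<close>

lemma tower:
  assumes f: "f \<in> borel_measurable seq_space" and dep: "depends_below (Suc s) f"
  shows "(\<integral>\<^sup>+w. \<integral>\<^sup>+y. f (w(s := y)) \<partial>K s (restrict w {..<s}) \<partial>W) = (\<integral>\<^sup>+w. f w \<partial>W)"
proof -
  let ?P = "prefix_space s :: (nat \<Rightarrow> real^'n) measure"
  let ?B = "borel :: (real^'n) measure"
  \<comment> \<open>Coordinates beyond s are filled with 0, which f cannot see.\<close>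
  define ext :: "(nat \<Rightarrow> real^'n) \<times> (real^'n) \<Rightarrow> nat \<Rightarrow> real^'n"
    where "ext z i = (if i < s then fst z i else if i = s then snd z else 0)" for z i
  define g where "g z = f (ext z)" for z
  have "(\<lambda>z. ext z i) \<in> ?P \<Otimes>\<^sub>M ?B \<rightarrow>\<^sub>M ?B" for i
  proof -
    consider "i < s" | "i = s" | "s < i" by linarith
    then show ?thesis
    proof cases
      case 1
      then have "(\<lambda>p. p i) \<in> ?P \<rightarrow>\<^sub>M ?B" by (intro measurable_component_singleton) simp
      from measurable_compose[OF measurable_fst this] have "(\<lambda>z. fst z i) \<in> ?P \<Otimes>\<^sub>M ?B \<rightarrow>\<^sub>M ?B" .
      moreover have "(\<lambda>z. ext z i) = (\<lambda>z. fst z i)" using 1 by (simp add: ext_def fun_eq_iff)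
      ultimately show ?thesis by simp
    next
      case 2
      then have "(\<lambda>z. ext z i) = snd" by (simp add: ext_def fun_eq_iff)
      then show ?thesis by simp
    next
      case 3
      then have "(\<lambda>z. ext z i) = (\<lambda>z. 0)" by (simp add: ext_def fun_eq_iff)
      then show ?thesis by simp
    qed
  qed
  then have "ext \<in> ?P \<Otimes>\<^sub>M ?B \<rightarrow>\<^sub>M seq_space"
    by (intro measurable_PiM_single') (auto simp: space_PiM)
  then have g: "g \<in> borel_measurable (?P \<Otimes>\<^sub>M ?B)"
    unfolding g_def by (rule measurable_compose[OF _ f])
  have 1: "g (restrict w {..<s}, w s) = f w" for w
    unfolding g_def by (rule depends_belowD[OF dep]) (auto simp: ext_def less_Suc_eq)
  have 2: "g (restrict w {..<s}, y) = f (w(s := y))" for w y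
    unfolding g_def by (rule depends_belowD[OF dep]) (auto simp: ext_def less_Suc_eq)
  have pr: "Pair (restrict w {..<s}) \<in> K s (restrict w {..<s}) \<rightarrow>\<^sub>M ?P \<Otimes>\<^sub>M ?B" for w
    unfolding measurable_cong_sets[OF sets_kernel_prefix refl]
    by (rule measurable_Pair1') (simp add: space_PiM)
  have "(\<integral>\<^sup>+w. f w \<partial>W) = (\<integral>\<^sup>+z. g z \<partial>distr W (?P \<Otimes>\<^sub>M ?B) (\<lambda>w. (restrict w {..<s}, w s)))"
    using g by (subst nn_integral_distr[OF measurable_prefix_component]) (simp_all add: 1)
  also have "\<dots> = (\<integral>\<^sup>+w. \<integral>\<^sup>+z. g z \<partial>distr (K s (restrict w {..<s})) (?P \<Otimes>\<^sub>M ?B) (Pair (restrict w {..<s})) \<partial>W)"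
    unfolding disintegration by (rule nn_integral_bind[OF g measurable_kernel_pair])
  also have "\<dots> = (\<integral>\<^sup>+w. \<integral>\<^sup>+y. f (w(s := y)) \<partial>K s (restrict w {..<s}) \<partial>W)"
    using g by (intro nn_integral_cong, subst nn_integral_distr[OF pr]) (simp_all add: 2)
  finally show ?thesis ..
qed

text \<open>The conditional expectation of f given the first T - j disturbances. It is indexed from
  the end so as to run in step with \<open>stages\<close>, of which it is the version without
  minimisation.\<close>

primrec cexp :: "nat \<Rightarrow> ((nat \<Rightarrow> real^'n) \<Rightarrow> ennreal) \<Rightarrow> nat \<Rightarrow> (nat \<Rightarrow> real^'n) \<Rightarrow> ennreal" where
  "cexp T f 0 w = f w"
| "cexp T f (Suc j) w
    = (\<integral>\<^sup>+y. cexp T f j (w(T - Suc j := y)) \<partial>K (T - Suc j) (restrict w {..<T - Suc j}))"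

lemma cexp_fun:
  "cexp T f 0 = f"
  "cexp T f (Suc j) = (\<lambda>w. \<integral>\<^sup>+y. cexp T f j (w(T - Suc j := y)) \<partial>K (T - Suc j) (restrict w {..<T - Suc j}))"
  by auto

lemma cexp_measurable: "f \<in> borel_measurable seq_space \<Longrightarrow> cexp T f j \<in> borel_measurable seq_space"
  by (induction j) (simp_all add: measurable_kernel_integral cexp_fun del: cexp.simps)

lemma cexp_depends: "depends_below T f \<Longrightarrow> j \<le> T \<Longrightarrow> depends_below (T - j) (cexp T f j)"
proof (induction j)
  case 0
  then show ?case by (simp add: depends_below_def)
next
  case (Suc j)
  define s where "s = T - Suc j"
  have s: "T - j = Suc s" using Suc.prems(2) by (simp add: s_def)
  have dep: "depends_below (Suc s) (cexp T f j)" using Suc unfolding s by simp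
  show ?case
    unfolding depends_below_def s_def[symmetric]
  proof (intro allI impI)
    fix w w' :: "nat \<Rightarrow> real^'n" assume eq: "\<forall>i<s. w i = w' i"
    then have r: "restrict w {..<s} = restrict w' {..<s}" by auto
    have "cexp T f j (w(s := y)) = cexp T f j (w'(s := y))" for y
      by (rule depends_belowD[OF dep]) (use eq in \<open>auto simp: less_Suc_eq\<close>)
    then show "cexp T f (Suc j) w = cexp T f (Suc j) w'"
      by (simp add: s_def[symmetric] r)
  qed
qed

lemma nn_integral_cexp:
  assumes f: "f \<in> borel_measurable seq_space" "depends_below T f"
  shows "j \<le> T \<Longrightarrow> (\<integral>\<^sup>+w. cexp T f j w \<partial>W) = (\<integral>\<^sup>+w. f w \<partial>W)"
proof (induction j)
  case (Suc j)
  have "depends_below (Suc (T - Suc j)) (cexp T f j)"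
    using cexp_depends[OF f(2), of j] Suc.prems by (simp add: Suc_diff_Suc)
  from tower[OF cexp_measurable[OF f(1)] this] Suc show ?case by simp
qed (simp add: cexp_fun(1))

text \<open>V does not involve the controls, so it passes through each infimum as a constant, and
  each integral splits because the summand coming from V is measurable.\<close>

lemma stages_add:
  assumes V: "V \<in> borel_measurable seq_space"
  shows "j \<le> T - k \<Longrightarrow> stages K k T (\<lambda>u w. G u w + V w) j u w = stages K k T G j u w + cexp T V j w"
proof (induction j arbitrary: u w)
  case 0
  have "{v. \<forall>i<T - k. v i = u i} \<noteq> {}" by blast
  then show ?case by (simp add: INF_ennreal_add_const_set)
next
  case (Suc j)
  define t where "t = T - k - Suc j"
  define s where "s = T - Suc j"
  \<comment> \<open>The disturbance integrated by \<open>stages\<close> at this step is the one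
    integrated by \<open>cexp\<close>.\<close>
  have s: "t + k = s" using Suc.prems by (simp add: t_def s_def)
  let ?K = "K s (restrict w {..<s})"
  have m: "(\<lambda>y. cexp T V j (w(s := y))) \<in> borel_measurable ?K"
    unfolding measurable_cong_sets[OF sets_kernel_prefix refl]
    by (rule measurable_compose[OF measurable_update_snd cexp_measurable[OF V]])
  have "stages K k T (\<lambda>u w. G u w + V w) (Suc j) u w
      = (INF a. \<integral>\<^sup>+y. stages K k T G j (u(t := a)) (w(s := y)) + cexp T V j (w(s := y)) \<partial>?K)"
  proof -
    have "stages K k T (\<lambda>u w. G u w + V w) j u w = stages K k T G j u w + cexp T V j w" for u w
      using Suc by simp
    then show ?thesis by (simp only: stages.simps Let_def t_def[symmetric] s)
  qed
  also have "\<dots> = (INF a. \<integral>\<^sup>+y. stages K k T G j (u(t := a)) (w(s := y)) \<partial>?K) + cexp T V (Suc j) w"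
    by (simp only: nn_integral_add_right_measurable[OF m] INF_ennreal_add_const_set[OF UNIV_not_empty]
        cexp.simps s_def[symmetric])
  finally show ?case by (simp only: stages.simps Let_def t_def[symmetric] s)
qed

lemma predictive_value_add:
  assumes "V \<in> borel_measurable seq_space" "depends_below T V"
  shows "predictive_value W K k T (\<lambda>u w. G u w + V w) = predictive_value W K k T G + (\<integral>\<^sup>+w. V w \<partial>W)"
proof -
  have m: "cexp T V (T - k) \<in> borel_measurable W"
    using cexp_measurable[OF assms(1)] by (simp add: measurable_W)
  have "predictive_value W K k T (\<lambda>u w. G u w + V w)
      = (\<integral>\<^sup>+w. stages K k T G (T - k) (\<lambda>_. 0) w + cexp T V (T - k) w \<partial>W)"
    unfolding predictive_value_def by (intro nn_integral_cong stages_add assms) simp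
  then show ?thesis
    unfolding nn_integral_add_right_measurable[OF m]
    by (simp add: predictive_value_def nn_integral_cexp[OF assms])
qed

text \<open>Each infimum is bounded by the choice that p makes. Causality enters when the
  disturbance at t + k is redrawn: the controls chosen up to t must still be those of p along the
  new path.\<close>

lemma stages_le_policy:
  assumes causal: "\<And>t. depends_below (t + k) (\<lambda>w. p w t)" and "\<And>w. G (p w) w \<le> h w"
  shows "j \<le> T - k \<Longrightarrow> (\<And>i. i < T - k - j \<Longrightarrow> u i = p w i) \<Longrightarrow> stages K k T G j u w \<le> cexp T h j w"
proof (induction j arbitrary: u w)
  case 0
  then have "stages K k T G 0 u w \<le> G (p w) w" by (auto intro!: INF_lower)
  with assms(2)[of w] show ?case by simp
next
  case (Suc j)
  define t where "t = T - k - Suc j"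
  define s where "s = T - Suc j"
  have s: "t + k = s" using Suc.prems by (simp add: t_def s_def)
  have "stages K k T G (Suc j) u w
      \<le> (\<integral>\<^sup>+y. stages K k T G j (u(t := p w t)) (w(s := y)) \<partial>K s (restrict w {..<s}))"
    unfolding stages.simps Let_def t_def[symmetric] s by (intro INF_lower) simp
  also have "\<dots> \<le> (\<integral>\<^sup>+y. cexp T h j (w(s := y)) \<partial>K s (restrict w {..<s}))"
  proof (intro nn_integral_mono Suc.IH)
    show "j \<le> T - k" using Suc.prems by simp
    fix y i assume "i < T - k - j"
    then have "i \<le> t" by (simp add: t_def)
    have "p w i = p (w(s := y)) i"
      by (rule depends_belowD[OF causal]) (use \<open>i \<le> t\<close> s in auto)
    with \<open>i \<le> t\<close> Suc.prems(2)[of i] show "(u(t := p w t)) i = p (w(s := y)) i"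
      by (auto simp: t_def)
  qed
  finally show ?case by (simp add: s_def)
qed

lemma predictive_value_le_policy:
  assumes "\<And>t. depends_below (t + k) (\<lambda>w. p w t)" "\<And>w. G (p w) w \<le> h w"
    and h: "h \<in> borel_measurable seq_space" "depends_below T h"
  shows "predictive_value W K k T G \<le> (\<integral>\<^sup>+w. h w \<partial>W)"
proof -
  have "predictive_value W K k T G \<le> (\<integral>\<^sup>+w. cexp T h (T - k) w \<partial>W)"
    unfolding predictive_value_def
    by (intro nn_integral_mono stages_le_policy[where p = p]) (use assms(1,2) in auto)
  then show ?thesis by (simp add: nn_integral_cexp[OF h])
qed

end

section \<open>State and cost as functions of the disturbances\<close>

lemma state_depends: "depends_below t (\<lambda>w. state A B x0 u w t)"
  by (induction t) (auto simp: depends_below_def, metis less_Suc_eq)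

lemma cost_depends: "depends_below T (cost A B Q R Qf x0 T u)"
  unfolding depends_below_def
proof (intro allI impI)
  fix w w' :: "nat \<Rightarrow> real^'a" assume eq: "\<forall>i<T. w i = w' i"
  have "state A B x0 u w t = state A B x0 u w' t" if "t \<le> T" for t
    by (rule depends_belowD[OF state_depends]) (use eq that in auto)
  then show "cost A B Q R Qf x0 T u w = cost A B Q R Qf x0 T u w'"
    by (simp add: cost_def Let_def)
qed

lemma continuous_on_state: "continuous_on UNIV (\<lambda>w. state A B x0 u w t)"
  by (induction t)
    (auto intro!: continuous_intros continuous_on_product_coordinates
      bounded_linear.continuous_on[OF matrix_vector_mul_bounded_linear])

lemma continuous_on_cost: "continuous_on UNIV (cost A B Q R Qf x0 T u)"
  unfolding cost_def[abs_def] Let_def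
  by (intro continuous_intros continuous_on_state
      bounded_linear.continuous_on[OF matrix_vector_mul_bounded_linear])

text \<open>The infimum ranges over uncountably many controls, but the cost is continuous in w for
  the product topology, so the infimum is upper semicontinuous: its strict sublevel sets are unions
  of open sets.\<close>

lemma borel_measurable_INF_cost:
  fixes A :: "real^'n^'n"
  assumes nonneg: "\<And>u w. 0 \<le> cost A B Q R Qf x0 T u w"
  shows "(\<lambda>w. INF u. cost A B Q R Qf x0 T u w) \<in> borel_measurable seq_space"
proof -
  let ?V = "\<lambda>w. INF u. cost A B Q R Qf x0 T u w"
  have eq: "{w. ?V w < a} = (\<Union>u. {w. cost A B Q R Qf x0 T u w < a})" for a
    using nonneg by (subst cINF_less_iff) (auto intro!: bdd_belowI[of _ 0])
  have "open {w. ?V w < a}" for a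
    unfolding eq by (intro open_UN ballI open_Collect_less continuous_on_cost continuous_on_const)
  then have "{w. ?V w < a} \<in> sets borel" for a by simp
  then have "?V \<in> borel_measurable borel"
    by (simp add: borel_measurable_iff_less)
  then show ?thesis
    using measurable_cong_sets[OF sets_PiM_equal_borel refl] by blast
qed

lemma INF_ennreal_eq:
  fixes f :: "'i \<Rightarrow> real"
  assumes "\<And>i. 0 \<le> f i"
  shows "(INF i. ennreal (f i)) = ennreal (INF i. f i)"
proof (rule antisym)
  have bdd: "bdd_below (range f)" using assms by (auto intro!: bdd_belowI[of _ 0])
  show "ennreal (INF i. f i) \<le> (INF i. ennreal (f i))"
    by (intro INF_greatest ennreal_leI cINF_lower bdd) simp
  have nonneg: "0 \<le> (INF i. f i)" using assms by (intro cINF_greatest) auto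
  show "(INF i. ennreal (f i)) \<le> ennreal (INF i. f i)"
  proof (rule ennreal_le_epsilon)
    fix e :: real assume "0 < e"
    then obtain i where "f i < (INF i. f i) + e"
      using cINF_less_iff[of UNIV f "(INF i. f i) + e"] bdd by auto
    then have "ennreal (f i) \<le> ennreal (INF i. f i) + ennreal e"
      using nonneg \<open>0 < e\<close> by (simp add: ennreal_leI flip: ennreal_plus)
    moreover have "(INF i. ennreal (f i)) \<le> ennreal (f i)" by (rule INF_lower) simp
    ultimately show "(INF i. ennreal (f i)) \<le> ennreal (INF i. f i) + ennreal e"
      by (rule order_trans[rotated])
  qed
qed

section \<open>The truncated prediction controller\<close>

text \<open>If \<open>m\<close> bounds the second moments of the disturbances, \<open>c\<close> bounds the expectation of \<open>f\<close>.\<close>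

definition dominated :: "nat \<Rightarrow> real \<Rightarrow> ((nat \<Rightarrow> real^'n) \<Rightarrow> real) \<Rightarrow> real \<Rightarrow> bool" where
  "dominated T m f c \<longleftrightarrow> (\<exists>b0 b. 0 \<le> b0 \<and> (\<forall>s. 0 \<le> b s) \<and>
     (\<forall>w. f w \<le> b0 + (\<Sum>s<T. b s * (norm (w s))\<^sup>2)) \<and> b0 + m * (\<Sum>s<T. b s) \<le> c)"

lemma dominated_const: "0 \<le> a \<Longrightarrow> dominated T m (\<lambda>_. a) a"
  unfolding dominated_def by (intro exI[of _ a] exI[of _ "\<lambda>_. 0"]) auto

lemma dominated_noise: "s < T \<Longrightarrow> dominated T m (\<lambda>w. (norm (w s))\<^sup>2) m"
  unfolding dominated_def
  by (intro exI[of _ 0] exI[of _ "\<lambda>i. if i = s then 1 else 0"])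
    (auto simp: if_distrib[of "\<lambda>c. c * _"] sum.If_cases)

lemma dominated_mono:
  "dominated T m f c \<Longrightarrow> (\<And>w. g w \<le> f w) \<Longrightarrow> c \<le> d \<Longrightarrow> dominated T m g d"
  unfolding dominated_def by (meson order_trans)

lemma dominated_add:
  assumes "dominated T m f c" "dominated T m g d"
  shows "dominated T m (\<lambda>w. f w + g w) (c + d)"
proof -
  obtain b0 b where b: "0 \<le> b0" "\<forall>s. 0 \<le> b s" "\<forall>w. f w \<le> b0 + (\<Sum>s<T. b s * (norm (w s))\<^sup>2)"
    "b0 + m * (\<Sum>s<T. b s) \<le> c"
    using assms(1) unfolding dominated_def by blast
  obtain e0 e where e: "0 \<le> e0" "\<forall>s. 0 \<le> e s" "\<forall>w. g w \<le> e0 + (\<Sum>s<T. e s * (norm (w s))\<^sup>2)"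
    "e0 + m * (\<Sum>s<T. e s) \<le> d"
    using assms(2) unfolding dominated_def by blast
  show ?thesis
    unfolding dominated_def
  proof (intro exI[of _ "b0 + e0"] exI[of _ "\<lambda>s. b s + e s"] conjI allI)
    show "f w + g w \<le> b0 + e0 + (\<Sum>s<T. (b s + e s) * (norm (w s))\<^sup>2)" for w
      using b(3)[rule_format, of w] e(3)[rule_format, of w] by (simp add: distrib_right sum.distrib)
    show "b0 + e0 + m * (\<Sum>s<T. b s + e s) \<le> c + d"
      using b(4) e(4) by (simp add: distrib_left sum.distrib)
  qed (use b e in auto)
qed

lemma dominated_scale:
  assumes "dominated T m f c" "0 \<le> a"
  shows "dominated T m (\<lambda>w. a * f w) (a * c)"
proof -
  obtain b0 b where b: "0 \<le> b0" "\<forall>s. 0 \<le> b s" "\<forall>w. f w \<le> b0 + (\<Sum>s<T. b s * (norm (w s))\<^sup>2)"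
    "b0 + m * (\<Sum>s<T. b s) \<le> c"
    using assms(1) unfolding dominated_def by blast
  show ?thesis
    unfolding dominated_def
  proof (intro exI[of _ "a * b0"] exI[of _ "\<lambda>s. a * b s"] conjI allI)
    show "a * f w \<le> a * b0 + (\<Sum>s<T. a * b s * (norm (w s))\<^sup>2)" for w
      using mult_left_mono[OF b(3)[rule_format, of w] assms(2)]
      by (simp add: distrib_left sum_distrib_left mult_ac)
    show "a * b0 + m * (\<Sum>s<T. a * b s) \<le> a * c"
      using mult_left_mono[OF b(4) assms(2)] by (simp add: distrib_left sum_distrib_left mult_ac)
  qed (use b assms(2) in auto)
qed

lemma dominated_sum:
  assumes "finite I" "\<And>i. i \<in> I \<Longrightarrow> dominated T m (f i) (c i)"
  shows "dominated T m (\<lambda>w. \<Sum>i\<in>I. f i w) (\<Sum>i\<in>I. c i)"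
  using assms by (induction I rule: finite_induct) (auto intro: dominated_add dominated_const[of 0])

lemma dominated_filt:
  assumes "0 \<le> l" "0 \<le> a" "\<And>s. s < t \<Longrightarrow> dominated T m (b s) e"
  shows "dominated T m (\<lambda>w. filt l a (\<lambda>s. b s w) t) (filt l a (\<lambda>_. e) t)"
  using assms(3)
  by (induction t) (auto intro!: dominated_add dominated_scale dominated_const assms(1,2))

text \<open>One factor \<open>1 / (1 - l)\<close> comes from Jensen's inequality, the other from the
  geometric series. The bound is uniform in t.\<close>

lemma dominated_stable_recursion:
  fixes E :: "real^'n^'n" and y r :: "(nat \<Rightarrow> real^'m) \<Rightarrow> nat \<Rightarrow> real^'n"
  assumes l: "0 \<le> l" "l < 1"
    and C: "\<And>k x. norm (matpow E k *v x) \<le> C * l ^ k * norm x"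
    and y: "\<And>w s. s < t \<Longrightarrow> y w (Suc s) = E *v y w s + r w s" and y0: "\<And>w. y w 0 = a"
    and r: "\<And>s. s < t \<Longrightarrow> dominated T m (\<lambda>w. (norm (r w s))\<^sup>2) e" and "0 \<le> e"
  shows "dominated T m (\<lambda>w. (norm (y w t))\<^sup>2) (C\<^sup>2 * ((norm a)\<^sup>2 + e / (1 - l)\<^sup>2))"
proof (rule dominated_mono)
  show "dominated T m (\<lambda>w. C\<^sup>2 * filt l ((norm a)\<^sup>2) (\<lambda>s. 1 / (1 - l) * (norm (r w s))\<^sup>2) t)
      (C\<^sup>2 * filt l ((norm a)\<^sup>2) (\<lambda>_. 1 / (1 - l) * e) t)"
    using l r by (intro dominated_scale dominated_filt) auto
  show "(norm (y w t))\<^sup>2 \<le> C\<^sup>2 * filt l ((norm a)\<^sup>2) (\<lambda>s. 1 / (1 - l) * (norm (r w s))\<^sup>2) t" for w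
    using stable_recursion_sq[where y = "y w" and r = "r w", OF l C y] by (simp add: y0)
  have "filt l ((norm a)\<^sup>2) (\<lambda>_. 1 / (1 - l) * e) t \<le> (norm a)\<^sup>2 + (1 / (1 - l) * e) / (1 - l)"
    using l \<open>0 \<le> e\<close> by (intro filt_const_le) auto
  then show "C\<^sup>2 * filt l ((norm a)\<^sup>2) (\<lambda>_. 1 / (1 - l) * e) t \<le> C\<^sup>2 * ((norm a)\<^sup>2 + e / (1 - l)\<^sup>2)"
    by (intro mult_left_mono) (auto simp: power2_eq_square)
qed

text \<open>The moment bound enters the upper estimates here, through its instances with equal
  times.\<close>

lemma (in disturbance) nn_integral_quadratic_le:
  assumes "second_moments_le W m" "0 \<le> b0" "\<And>s. 0 \<le> b s"
  shows "(\<integral>\<^sup>+w. ennreal (b0 + (\<Sum>s<T. b s * (norm (w s))\<^sup>2)) \<partial>W) \<le> ennreal (b0 + m * (\<Sum>s<T. b s))"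
proof -
  interpret prob_space W by (rule prob_space_W)
  have int: "integrable W (\<lambda>w. (norm (w s))\<^sup>2)" and le: "(\<integral>w. (norm (w s))\<^sup>2 \<partial>W) \<le> m" for s
    using assms(1) by (auto simp: second_moments_le_def power2_norm_eq_inner)
  have "(\<integral>\<^sup>+w. ennreal (b0 + (\<Sum>s<T. b s * (norm (w s))\<^sup>2)) \<partial>W)
      = ennreal (\<integral>w. b0 + (\<Sum>s<T. b s * (norm (w s))\<^sup>2) \<partial>W)"
    using assms(2,3) int by (intro nn_integral_eq_integral) (auto intro!: add_nonneg_nonneg sum_nonneg)
  also have "(\<integral>w. b0 + (\<Sum>s<T. b s * (norm (w s))\<^sup>2) \<partial>W) = b0 + (\<Sum>s<T. b s * (\<integral>w. (norm (w s))\<^sup>2 \<partial>W))"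
    using int by (simp add: prob_space)
  also have "\<dots> \<le> b0 + (\<Sum>s<T. b s * m)"
    using assms(3) le by (intro add_left_mono sum_mono mult_left_mono) auto
  finally show ?thesis by (simp add: sum_distrib_left mult.commute ennreal_leI)
qed

lemma (in disturbance) nn_integral_dominated:
  assumes "second_moments_le W m" "dominated T m f c"
  shows "(\<integral>\<^sup>+w. ennreal (f w) \<partial>W) \<le> ennreal c"
proof -
  obtain b0 b where b: "0 \<le> b0" "\<And>s. 0 \<le> b s" "\<And>w. f w \<le> b0 + (\<Sum>s<T. b s * (norm (w s))\<^sup>2)"
    "b0 + m * (\<Sum>s<T. b s) \<le> c"
    using assms(2) unfolding dominated_def by blast
  have "(\<integral>\<^sup>+w. ennreal (f w) \<partial>W) \<le> (\<integral>\<^sup>+w. ennreal (b0 + (\<Sum>s<T. b s * (norm (w s))\<^sup>2)) \<partial>W)"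
    by (intro nn_integral_mono ennreal_leI b)
  also have "\<dots> \<le> ennreal c"
    using nn_integral_quadratic_le[OF assms(1) b(1,2), where T = T] ennreal_leI[OF b(4)] by (rule order_trans)
  finally show ?thesis .
qed

text \<open>The quadratic majorant behind \<open>dominated\<close> is measurable and sees only
  disturbances before T, so it can take the place of f as the h of
  \<open>predictive_value_le_policy\<close>.\<close>

lemma (in disturbance) predictive_value_le_dominated:
  assumes causal: "\<And>t. depends_below (t + k) (\<lambda>w. p w t)" and G: "\<And>w. G (p w) w \<le> ennreal (f w)"
    and m: "second_moments_le W m" and dom: "dominated T m f c"
  shows "predictive_value W K k T G \<le> ennreal c"
proof -
  obtain b0 b where b: "0 \<le> b0" "\<And>s. 0 \<le> b s" "\<And>w. f w \<le> b0 + (\<Sum>s<T. b s * (norm (w s))\<^sup>2)"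
    "b0 + m * (\<Sum>s<T. b s) \<le> c"
    using dom unfolding dominated_def by blast
  define h :: "(nat \<Rightarrow> real^'n) \<Rightarrow> ennreal"
    where "h w = ennreal (b0 + (\<Sum>s<T. b s * (norm (w s))\<^sup>2))" for w
  have [measurable]: "(\<lambda>w. w s) \<in> seq_space \<rightarrow>\<^sub>M (borel :: (real^'n) measure)" for s
    by (rule measurable_component_singleton) simp
  have h: "h \<in> borel_measurable seq_space" unfolding h_def by measurable
  have "depends_below T h" by (auto simp: depends_below_def h_def)
  moreover have "G (p w) w \<le> h w" for w
    unfolding h_def by (rule order_trans[OF G]) (intro ennreal_leI b(3))
  ultimately have "predictive_value W K k T G \<le> (\<integral>\<^sup>+w. h w \<partial>W)"
    by (intro predictive_value_le_policy[where p = p] causal h)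
  also have "\<dots> \<le> ennreal (b0 + m * (\<Sum>s<T. b s))"
    unfolding h_def by (rule nn_integral_quadratic_le[OF m b(1,2)])
  finally show ?thesis using ennreal_leI[OF b(4)] by (rule order_trans)
qed

lemma spectral_norm_le:
  fixes M :: "real^'n^'m"
  shows "(\<And>x. norm (M *v x) \<le> c * norm x) \<Longrightarrow> spectral_norm M \<le> c"
  unfolding spectral_norm_def by (rule onorm_le)

context lqr
begin

lemma closed_loop_bound:
  obtains C where "0 \<le> C" "\<And>k x. norm (matpow F k *v x) \<le> C * ((1 + spectral_radius F) / 2) ^ k * norm x"
proof -
  have "spectral_radius F < (1 + spectral_radius F) / 2" using spectral_radius_closed_loop by simp
  from matpow_bound[OF this] that show thesis by auto
qed

text \<open>Read backwards from the end of the window, the preview is a stable recursion with matrix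
  \<open>transpose F\<close> driven by P w, so its second moment is bounded whatever the window
  length.\<close>

lemma dominated_preview:
  "\<exists>C\<ge>0. \<forall>T m t n. 0 \<le> m \<longrightarrow> t + n \<le> T \<longrightarrow> dominated T m (\<lambda>w. (norm (preview n w t))\<^sup>2) (C * m)"
proof (rule closed_loop_bound)
  fix C :: real
  define l where "l = (1 + spectral_radius F) / 2"
  assume "\<And>k x. norm (matpow F k *v x) \<le> C * ((1 + spectral_radius F) / 2) ^ k * norm x"
  then have C: "norm (matpow (transpose F) k *v x) \<le> C * l ^ k * norm x" for k x
    unfolding transpose_matpow[symmetric] l_def by (rule norm_transpose_le)
  have l: "0 \<le> l" "l < 1"
    using spectral_radius_closed_loop spectral_radius_nonneg[of F] by (auto simp: l_def)
  define D where "D = C\<^sup>2 * ((spectral_norm P)\<^sup>2 / (1 - l)\<^sup>2)"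
  have "dominated T m (\<lambda>w. (norm (preview n w t))\<^sup>2) (D * m)" if "0 \<le> m" "t + n \<le> T" for T m t n
  proof -
    \<comment> \<open>The index t + n - n is the last instance of the reversed time t + n - s over
      which the recursion runs.\<close>
    have "dominated T m (\<lambda>w. (norm (preview n w (t + n - n)))\<^sup>2)
        (C\<^sup>2 * ((norm (0 :: real^'n))\<^sup>2 + (spectral_norm P)\<^sup>2 * m / (1 - l)\<^sup>2))"
    proof (rule dominated_stable_recursion[where y = "\<lambda>w s. preview s w (t + n - s)"
          and r = "\<lambda>w s. P *v w (t + n - Suc s)", OF l C])
      show "preview (Suc s) w (t + n - Suc s)
          = transpose F *v preview s w (t + n - s) + P *v w (t + n - Suc s)" if "s < n" for w s
        using that by (simp add: preview_Suc Suc_diff_Suc)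
      show "dominated T m (\<lambda>w. (norm (P *v w (t + n - Suc s)))\<^sup>2) ((spectral_norm P)\<^sup>2 * m)"
        if "s < n" for s
      proof (rule dominated_mono[OF dominated_scale[OF dominated_noise]])
        show "t + n - Suc s < T" using that \<open>t + n \<le> T\<close> by simp
        show "(norm (P *v w (t + n - Suc s)))\<^sup>2 \<le> (spectral_norm P)\<^sup>2 * (norm (w (t + n - Suc s)))\<^sup>2" for w
          by (rule norm_matrix_vector_sq_le)
      qed simp_all
    qed (use \<open>0 \<le> m\<close> in auto)
    then show ?thesis by (simp add: D_def mult.assoc)
  qed
  moreover have "0 \<le> D" by (simp add: D_def)
  ultimately show ?thesis by blast
qed

definition correction :: "real^'n^'d" where
  "correction = matrix_inv gram ** transpose B"

text \<open>The controller that would be optimal for terminal weight \<open>P\<close> if the disturbances after the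
  prediction window vanished.\<close>

primrec policy_state :: "nat \<Rightarrow> nat \<Rightarrow> real^'n \<Rightarrow> (nat \<Rightarrow> real^'n) \<Rightarrow> nat \<Rightarrow> real^'n" where
  "policy_state k T x0 w 0 = x0"
| "policy_state k T x0 w (Suc t) = F *v policy_state k T x0 w t
    + (w t - B *v (correction *v preview (min k (T - t)) w t))"

definition policy :: "nat \<Rightarrow> nat \<Rightarrow> real^'n \<Rightarrow> (nat \<Rightarrow> real^'n) \<Rightarrow> nat \<Rightarrow> real^'d" where
  "policy k T x0 w t = - (gain *v policy_state k T x0 w t) - correction *v preview (min k (T - t)) w t"

text \<open>Controls in \<open>cost\<close> are plain sequences, so the feedback controller carries
  its own copy of the state; here the copy is identified with the real one.\<close>

lemma state_policy: "state A B x0 (policy k T x0 w) w t = policy_state k T x0 w t"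
  by (induction t)
    (simp_all add: policy_def F_mult matrix_vector_mult_diff_distrib vec.neg)

lemma preview_depends: "t + n \<le> s \<Longrightarrow> depends_below s (\<lambda>w. preview n w t)"
  by (auto simp: depends_below_def preview_def intro!: sum.cong)


lemma policy_causal: "depends_below (t + k) (\<lambda>w. policy k T x0 w t)"
  unfolding depends_below_def
proof (intro allI impI)
  fix w w' :: "nat \<Rightarrow> real^'n"
  assume eq: "\<forall>i<t + k. w i = w' i"
  have preview: "preview (min k (T - s)) w s = preview (min k (T - s)) w' s" if "s \<le> t" for s
    by (rule depends_belowD[OF preview_depends[of s _ "t + k"]]) (use that eq in auto)
  have "policy_state k T x0 w s = policy_state k T x0 w' s" if "s \<le> t" for s
    using that by (induction s) (use eq preview in auto)
  with preview show "policy k T x0 w t = policy k T x0 w' t" by (simp add: policy_def)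
qed

text \<open>By \<open>preview_add\<close> only the unseen tail survives. When the window reaches
  past the horizon, truncated subtraction makes that tail empty and both sides vanish.\<close>

lemma deviation_policy:
  "deviation T w t (policy_state k T x0 w t) (policy k T x0 w t)
    = correction *v (matpow (transpose F) k *v preview (T - t - k) w (t + k))"
proof (cases "k \<le> T - t")
  case True
  then have "preview (T - t) w t = preview k w t + matpow (transpose F) k *v preview (T - t - k) w (t + k)"
    by (metis le_add_diff_inverse preview_add)
  with True show ?thesis
    by (simp add: deviation_def policy_def correction_def matrix_vector_mul_assoc[symmetric]
        matrix_vector_right_distrib min_absorb1)
qed (simp add: deviation_def policy_def correction_def matrix_vector_mul_assoc[symmetric])

lemma dominated_deviation:
  "\<exists>C\<ge>0. \<forall>T m k t x0. 0 \<le> m \<longrightarrow> t < T \<longrightarrow> dominated T m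
    (\<lambda>w. (norm (deviation T w t (policy_state k T x0 w t) (policy k T x0 w t)))\<^sup>2)
    (C * (spectral_norm (matpow F k))\<^sup>2 * m)"
proof -
  obtain C where C: "C \<ge> 0" "\<And>T m t n. 0 \<le> m \<Longrightarrow> t + n \<le> T \<Longrightarrow>
      dominated T m (\<lambda>w. (norm (preview n w t))\<^sup>2) (C * m)"
    using dominated_preview by blast
  define D where "D = (spectral_norm correction)\<^sup>2 * C"
  have "dominated T m (\<lambda>w. (norm (deviation T w t (policy_state k T x0 w t) (policy k T x0 w t)))\<^sup>2)
      (D * (spectral_norm (matpow F k))\<^sup>2 * m)" if "0 \<le> m" "t < T" for T m k t x0
  proof (rule dominated_mono)
    let ?a = "(spectral_norm correction)\<^sup>2 * (spectral_norm (matpow F k))\<^sup>2"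
    show "dominated T m (\<lambda>w. ?a * (norm (preview (T - t - k) w (t + k)))\<^sup>2) (?a * (C * m))"
    proof (cases "t + k \<le> T")
      case True
      with that show ?thesis by (intro dominated_scale C) auto
    next
      case False
      then show ?thesis using C(1) that(1)
        by (intro dominated_mono[OF dominated_const[of 0]]) auto
    qed
    show "(norm (deviation T w t (policy_state k T x0 w t) (policy k T x0 w t)))\<^sup>2
        \<le> ?a * (norm (preview (T - t - k) w (t + k)))\<^sup>2" for w
    proof -
      let ?z = "preview (T - t - k) w (t + k)"
      have "norm (matpow (transpose F) k *v ?z) \<le> spectral_norm (matpow F k) * norm ?z"
        unfolding transpose_matpow[symmetric] by (intro norm_transpose_le norm_matrix_vector_le)
      then have "(norm (matpow (transpose F) k *v ?z))\<^sup>2 \<le> (spectral_norm (matpow F k))\<^sup>2 * (norm ?z)\<^sup>2"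
        by (metis norm_ge_zero power_mono power_mult_distrib)
      from order_trans[OF norm_matrix_vector_sq_le mult_left_mono[OF this]] show ?thesis
        by (simp add: deviation_policy mult.assoc)
    qed
    show "?a * (C * m) \<le> D * (spectral_norm (matpow F k))\<^sup>2 * m" by (simp add: D_def)
  qed
  moreover have "0 \<le> D" using C by (simp add: D_def)
  ultimately show ?thesis by blast
qed

text \<open>F is stable, and its inputs, the disturbance and the preview term, have uniformly
  bounded second moments. Hence the terminal mismatch between P and Qf costs only a
  constant.\<close>

lemma dominated_policy_state:
  "\<exists>C\<ge>0. \<forall>T m k x0. 0 \<le> m \<longrightarrow>
    dominated T m (\<lambda>w. (norm (policy_state k T x0 w T))\<^sup>2) (C * ((norm x0)\<^sup>2 + m))"
proof (rule closed_loop_bound)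
  fix C :: real
  define l where "l = (1 + spectral_radius F) / 2"
  assume "\<And>k x. norm (matpow F k *v x) \<le> C * ((1 + spectral_radius F) / 2) ^ k * norm x"
  then have C: "norm (matpow F k *v x) \<le> C * l ^ k * norm x" for k x unfolding l_def .
  have l: "0 \<le> l" "l < 1"
    using spectral_radius_closed_loop spectral_radius_nonneg[of F] by (auto simp: l_def)
  obtain Cp where Cp: "Cp \<ge> 0" "\<And>T m t n. 0 \<le> m \<Longrightarrow> t + n \<le> T \<Longrightarrow>
      dominated T m (\<lambda>w. (norm (preview n w t))\<^sup>2) (Cp * m)"
    using dominated_preview by blast
  define e where "e = 2 + 2 * ((spectral_norm (B ** correction))\<^sup>2 * Cp)"
  have "0 \<le> e" using Cp by (simp add: e_def)
  define D where "D = C\<^sup>2 * (1 + e / (1 - l)\<^sup>2)"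
  have "dominated T m (\<lambda>w. (norm (policy_state k T x0 w T))\<^sup>2) (D * ((norm x0)\<^sup>2 + m))"
    if "0 \<le> m" for T m k x0
  proof (rule dominated_mono)
    show "dominated T m (\<lambda>w. (norm (policy_state k T x0 w T))\<^sup>2)
        (C\<^sup>2 * ((norm x0)\<^sup>2 + (e * m) / (1 - l)\<^sup>2))"
    proof (rule dominated_stable_recursion[where y = "policy_state k T x0"
          and r = "\<lambda>w t. w t - B *v (correction *v preview (min k (T - t)) w t)", OF l C])
      fix t assume "t < T"
      show "dominated T m (\<lambda>w. (norm (w t - B *v (correction *v preview (min k (T - t)) w t)))\<^sup>2) (e * m)"
      proof (rule dominated_mono)
        show "dominated T m (\<lambda>w. 2 * (norm (w t))\<^sup>2
            + 2 * ((spectral_norm (B ** correction))\<^sup>2 * (norm (preview (min k (T - t)) w t))\<^sup>2))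
            (2 * m + 2 * ((spectral_norm (B ** correction))\<^sup>2 * (Cp * m)))"
          using \<open>t < T\<close> \<open>0 \<le> m\<close>
          by (intro dominated_add dominated_scale dominated_noise Cp) auto
        fix w :: "nat \<Rightarrow> real^'n"
        show "(norm (w t - B *v (correction *v preview (min k (T - t)) w t)))\<^sup>2 \<le> 2 * (norm (w t))\<^sup>2
            + 2 * ((spectral_norm (B ** correction))\<^sup>2 * (norm (preview (min k (T - t)) w t))\<^sup>2)"
          using norm_add_sq_le[of "w t" "- (B *v (correction *v preview (min k (T - t)) w t))"]
            norm_matrix_vector_sq_le[of "B ** correction" "preview (min k (T - t)) w t"]
          by (simp add: matrix_vector_mul_assoc)
      qed (simp add: e_def algebra_simps)
    qed (use \<open>0 \<le> m\<close> \<open>0 \<le> e\<close> in auto)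
    have "(norm x0)\<^sup>2 + (e * m) / (1 - l)\<^sup>2 \<le> (1 + e / (1 - l)\<^sup>2) * ((norm x0)\<^sup>2 + m)"
    proof -
      have "0 \<le> e / (1 - l)\<^sup>2 * (norm x0)\<^sup>2" using \<open>0 \<le> e\<close> by simp
      with \<open>0 \<le> m\<close> show ?thesis by (simp add: distrib_left distrib_right)
    qed
    then show "C\<^sup>2 * ((norm x0)\<^sup>2 + (e * m) / (1 - l)\<^sup>2) \<le> D * ((norm x0)\<^sup>2 + m)"
      unfolding D_def mult.assoc by (intro mult_left_mono) auto
  qed simp
  moreover have "0 \<le> D" using \<open>0 \<le> e\<close> by (simp add: D_def)
  ultimately show ?thesis by blast
qed

section \<open>Regret of the controller and finiteness of the cost\<close>

lemma cost_nonneg: "0 \<le> cost A B Q R Qf x0 T u w"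
  unfolding cost_def Let_def using form_nonneg by (intro add_nonneg_nonneg sum_nonneg) auto

lemma INF_cost_le: "(INF u. cost A B Q R Qf x0 T u w) \<le> cost A B Q R Qf x0 T u w"
  by (rule cINF_lower) (auto intro!: bdd_belowI[of _ 0] cost_nonneg)

lemma dominated_policy_regret:
  "\<exists>C\<ge>0. \<forall>T m k x0. 0 \<le> m \<longrightarrow>
    dominated T m (\<lambda>w. cost A B Q R Qf x0 T (policy k T x0 w) w - (INF u. cost A B Q R Qf x0 T u w))
      (C * ((spectral_norm (matpow F k))\<^sup>2 * real T * m + (norm x0)\<^sup>2 + m))"
proof -
  obtain C where C: "C \<ge> 0" "\<And>T x0 u v w. cost A B Q R Qf x0 T u w - cost A B Q R Qf x0 T v w
    \<le> C * ((\<Sum>t<T. (norm (deviation T w t (state A B x0 u w t) (u t)))\<^sup>2) + (norm (state A B x0 u w T))\<^sup>2)"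
    using cost_diff_le by blast
  obtain Cd where Cd: "Cd \<ge> 0" "\<And>T m k t x0. 0 \<le> m \<Longrightarrow> t < T \<Longrightarrow> dominated T m
    (\<lambda>w. (norm (deviation T w t (policy_state k T x0 w t) (policy k T x0 w t)))\<^sup>2)
    (Cd * (spectral_norm (matpow F k))\<^sup>2 * m)"
    using dominated_deviation by blast
  obtain Cx where Cx: "Cx \<ge> 0" "\<And>T m k x0. 0 \<le> m \<Longrightarrow>
    dominated T m (\<lambda>w. (norm (policy_state k T x0 w T))\<^sup>2) (Cx * ((norm x0)\<^sup>2 + m))"
    using dominated_policy_state by blast
  define D where "D = C * max Cd Cx"
  have "dominated T m (\<lambda>w. cost A B Q R Qf x0 T (policy k T x0 w) w - (INF u. cost A B Q R Qf x0 T u w))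
      (D * ((spectral_norm (matpow F k))\<^sup>2 * real T * m + (norm x0)\<^sup>2 + m))" if "0 \<le> m" for T m k x0
  proof (rule dominated_mono)
    show "dominated T m (\<lambda>w. C * ((\<Sum>t<T. (norm (deviation T w t (policy_state k T x0 w t) (policy k T x0 w t)))\<^sup>2)
        + (norm (policy_state k T x0 w T))\<^sup>2))
      (C * ((\<Sum>t<T. Cd * (spectral_norm (matpow F k))\<^sup>2 * m) + Cx * ((norm x0)\<^sup>2 + m)))"
      using that by (intro dominated_scale dominated_add dominated_sum C Cd Cx) auto
    fix w
    let ?D = "C * ((\<Sum>t<T. (norm (deviation T w t (policy_state k T x0 w t) (policy k T x0 w t)))\<^sup>2)
        + (norm (policy_state k T x0 w T))\<^sup>2)"
    have "cost A B Q R Qf x0 T (policy k T x0 w) w - ?D \<le> cost A B Q R Qf x0 T v w" for v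
      using C(2)[of x0 T "policy k T x0 w" w v] by (simp add: state_policy)
    then have "cost A B Q R Qf x0 T (policy k T x0 w) w - ?D \<le> (INF u. cost A B Q R Qf x0 T u w)"
      by (intro cINF_greatest) auto
    then show "cost A B Q R Qf x0 T (policy k T x0 w) w - (INF u. cost A B Q R Qf x0 T u w) \<le> ?D"
      by simp
    have "Cd * ((spectral_norm (matpow F k))\<^sup>2 * real T * m) + Cx * ((norm x0)\<^sup>2 + m)
        \<le> max Cd Cx * ((spectral_norm (matpow F k))\<^sup>2 * real T * m) + max Cd Cx * ((norm x0)\<^sup>2 + m)"
      using that by (intro add_mono mult_right_mono) auto
    from mult_left_mono[OF this C(1)]
    show "C * ((\<Sum>t<T. Cd * (spectral_norm (matpow F k))\<^sup>2 * m) + Cx * ((norm x0)\<^sup>2 + m))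
        \<le> D * ((spectral_norm (matpow F k))\<^sup>2 * real T * m + (norm x0)\<^sup>2 + m)"
      by (simp add: D_def algebra_simps)
  qed
  moreover have "0 \<le> D" using C(1) Cd(1) by (simp add: D_def le_max_iff_disj)
  ultimately show ?thesis by blast
qed

lemma dominated_zero_control_state: "0 \<le> m \<Longrightarrow> t \<le> T \<Longrightarrow> \<exists>c. dominated T m (\<lambda>w. (norm (state A B x0 (\<lambda>_. 0) w t))\<^sup>2) c"
proof (induction t)
  case 0
  show ?case using dominated_const[of "(norm x0)\<^sup>2"] by auto
next
  case (Suc t)
  then obtain c where "dominated T m (\<lambda>w. (norm (state A B x0 (\<lambda>_. 0) w t))\<^sup>2) c" by auto
  then have "dominated T m (\<lambda>w. 2 * ((spectral_norm A)\<^sup>2 * (norm (state A B x0 (\<lambda>_. 0) w t))\<^sup>2) + 2 * (norm (w t))\<^sup>2)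
      (2 * ((spectral_norm A)\<^sup>2 * c) + 2 * m)"
    using Suc.prems by (intro dominated_add dominated_scale dominated_noise) auto
  moreover have "(norm (state A B x0 (\<lambda>_. 0) w (Suc t)))\<^sup>2
      \<le> 2 * ((spectral_norm A)\<^sup>2 * (norm (state A B x0 (\<lambda>_. 0) w t))\<^sup>2) + 2 * (norm (w t))\<^sup>2" for w
    using norm_add_sq_le[of "A *v state A B x0 (\<lambda>_. 0) w t" "w t"]
      norm_matrix_vector_sq_le[of A "state A B x0 (\<lambda>_. 0) w t"] by simp
  ultimately have "dominated T m (\<lambda>w. (norm (state A B x0 (\<lambda>_. 0) w (Suc t)))\<^sup>2)
      (2 * ((spectral_norm A)\<^sup>2 * c) + 2 * m)"
    by (rule dominated_mono) simp
  then show ?case ..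
qed

text \<open>Only finiteness is wanted, so the constant may grow with T. It makes the clairvoyant
  cost finite, hence its subtraction in the reals meaningful.\<close>

lemma dominated_zero_control_cost: "0 \<le> m \<Longrightarrow> \<exists>c. dominated T m (cost A B Q R Qf x0 T (\<lambda>_. 0)) c"
proof -
  assume "0 \<le> m"
  have form: "\<exists>c. dominated T m (\<lambda>w. state A B x0 (\<lambda>_. 0) w t \<bullet> (M *v state A B x0 (\<lambda>_. 0) w t)) c"
    if t: "t \<le> T" for t and M :: "real^'n^'n"
  proof -
    obtain c where "dominated T m (\<lambda>w. (norm (state A B x0 (\<lambda>_. 0) w t))\<^sup>2) c"
      using dominated_zero_control_state[OF \<open>0 \<le> m\<close> t] by blast
    then have "dominated T m (\<lambda>w. spectral_norm M * (norm (state A B x0 (\<lambda>_. 0) w t))\<^sup>2) (spectral_norm M * c)"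
      by (intro dominated_scale spectral_norm_nonneg)
    moreover have "x \<bullet> (M *v x) \<le> spectral_norm M * (norm x)\<^sup>2" for x
      using order_trans[OF norm_cauchy_schwarz mult_left_mono[OF norm_matrix_vector_le norm_ge_zero], of x M x]
      by (simp add: power2_eq_square mult_ac)
    ultimately have "dominated T m (\<lambda>w. state A B x0 (\<lambda>_. 0) w t \<bullet> (M *v state A B x0 (\<lambda>_. 0) w t))
        (spectral_norm M * c)"
      by (rule dominated_mono) simp
    then show ?thesis ..
  qed
  have "\<exists>c. \<forall>t. t \<le> T \<longrightarrow>
      dominated T m (\<lambda>w. state A B x0 (\<lambda>_. 0) w t \<bullet> (Q *v state A B x0 (\<lambda>_. 0) w t)) (c t)"
    by (intro choice allI) (use form in blast)
  then obtain c where c: "\<And>t. t \<le> T \<Longrightarrow>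
      dominated T m (\<lambda>w. state A B x0 (\<lambda>_. 0) w t \<bullet> (Q *v state A B x0 (\<lambda>_. 0) w t)) (c t)"
    by blast
  from form[of T Qf] obtain d where d:
      "dominated T m (\<lambda>w. state A B x0 (\<lambda>_. 0) w T \<bullet> (Qf *v state A B x0 (\<lambda>_. 0) w T)) d"
    by auto
  have "dominated T m (\<lambda>w. (\<Sum>t<T. state A B x0 (\<lambda>_. 0) w t \<bullet> (Q *v state A B x0 (\<lambda>_. 0) w t))
      + state A B x0 (\<lambda>_. 0) w T \<bullet> (Qf *v state A B x0 (\<lambda>_. 0) w T)) ((\<Sum>t<T. c t) + d)"
    by (intro dominated_add dominated_sum c d) auto
  then have "dominated T m (cost A B Q R Qf x0 T (\<lambda>_. 0)) ((\<Sum>t<T. c t) + d)"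
    by (rule dominated_mono) (auto simp: cost_def Let_def)
  then show ?thesis ..
qed

end

section \<open>Upper bound on the regret\<close>

locale lqr_disturbance = lqr A B Q R Qf P + disturbance W K
  for A :: "real^'n^'n" and B :: "real^'d^'n" and Q R Qf P
    and W :: "(nat \<Rightarrow> real^'n) measure" and K
begin

abbreviation optimal_cost :: "real^'n \<Rightarrow> nat \<Rightarrow> (nat \<Rightarrow> real^'n) \<Rightarrow> real" where
  "optimal_cost x0 T w \<equiv> INF u. cost A B Q R Qf x0 T u w"

lemma optimal_cost_nonneg: "0 \<le> optimal_cost x0 T w"
  by (intro cINF_greatest cost_nonneg) simp

text \<open>Pathwise, cost is regret plus clairvoyant cost, and the latter is free of controls, so
  \<open>predictive_value_add\<close> splits it off. As an identity in \<open>ennreal\<close> it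
  precedes any finiteness argument.\<close>

lemma STO_eq: "STO A B Q R Qf x0 W K k T = Reg A B Q R Qf x0 W K k T + (\<integral>\<^sup>+w. ennreal (optimal_cost x0 T w) \<partial>W)"
proof -
  have "(\<lambda>u w. ennreal (cost A B Q R Qf x0 T u w))
      = (\<lambda>u w. ennreal (cost A B Q R Qf x0 T u w - optimal_cost x0 T w) + ennreal (optimal_cost x0 T w))"
    using INF_cost_le optimal_cost_nonneg by (intro ext) (simp flip: ennreal_plus)
  moreover have "(\<lambda>w. ennreal (optimal_cost x0 T w)) \<in> borel_measurable seq_space"
    using borel_measurable_INF_cost[OF cost_nonneg] by simp
  moreover have "depends_below T (\<lambda>w. ennreal (optimal_cost x0 T w))"
    unfolding depends_below_def
  proof (intro allI impI)
    fix w w' :: "nat \<Rightarrow> real^'n" assume "\<forall>i<T. w i = w' i"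
    then have "cost A B Q R Qf x0 T u w = cost A B Q R Qf x0 T u w'" for u
      by (intro depends_belowD[OF cost_depends]) auto
    then show "ennreal (optimal_cost x0 T w) = ennreal (optimal_cost x0 T w')" by simp
  qed
  ultimately show ?thesis
    unfolding STO_def Reg_def by (simp only: predictive_value_add)
qed

text \<open>For k = T no expectation is left inside \<open>stages\<close>, and its base case imposes
  no constraint on the controls.\<close>

lemma STO_full: "STO A B Q R Qf x0 W K T T = (\<integral>\<^sup>+w. ennreal (optimal_cost x0 T w) \<partial>W)"
proof -
  have eq: "stages K T T G 0 u = (\<lambda>w. INF v. G v w)" for G :: "(nat \<Rightarrow> real^'d) \<Rightarrow> (nat \<Rightarrow> real^'n) \<Rightarrow> ennreal" and u
    by (simp add: fun_eq_iff)
  show ?thesis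
    unfolding STO_def predictive_value_def diff_self_eq_0
    by (simp only: eq INF_ennreal_eq[OF cost_nonneg])
qed

lemma nn_integral_optimal_cost:
  assumes "second_moments_le W m" "0 \<le> m"
  shows "(\<integral>\<^sup>+w. ennreal (optimal_cost x0 T w) \<partial>W) < \<infinity>"
proof -
  obtain c where "dominated T m (cost A B Q R Qf x0 T (\<lambda>_. 0)) c"
    using dominated_zero_control_cost[OF assms(2)] by blast
  then have "dominated T m (optimal_cost x0 T) c" by (rule dominated_mono) (auto intro: INF_cost_le)
  from nn_integral_dominated[OF assms(1) this] show ?thesis
    by (rule le_less_trans) simp
qed

lemma Reg_le:
  "\<exists>C\<ge>0. \<forall>k T x0 m. 0 \<le> m \<longrightarrow> second_moments_le W m \<longrightarrow> Reg A B Q R Qf x0 W K k T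
    \<le> ennreal (C * ((spectral_norm (matpow F k))\<^sup>2 * real T * m + (norm x0)\<^sup>2 + m))"
proof -
  obtain C where C: "C \<ge> 0" "\<And>T m k x0. 0 \<le> m \<Longrightarrow>
    dominated T m (\<lambda>w. cost A B Q R Qf x0 T (policy k T x0 w) w - optimal_cost x0 T w)
      (C * ((spectral_norm (matpow F k))\<^sup>2 * real T * m + (norm x0)\<^sup>2 + m))"
    using dominated_policy_regret by blast
  have "Reg A B Q R Qf x0 W K k T
    \<le> ennreal (C * ((spectral_norm (matpow F k))\<^sup>2 * real T * m + (norm x0)\<^sup>2 + m))"
    if "0 \<le> m" "second_moments_le W m" for k T x0 m
    unfolding Reg_def
    by (rule predictive_value_le_dominated[where p = "policy k T x0"])
      (rule policy_causal order_refl that(2) C(2)[OF that(1)])+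
  with C(1) show ?thesis by blast
qed

lemma Reg_properties:
  assumes "second_moments_le W m" "0 \<le> m"
  shows "Reg A B Q R Qf x0 W K k T < \<infinity>" "STO A B Q R Qf x0 W K k T < \<infinity>"
    "STO A B Q R Qf x0 W K T T < \<infinity>"
    "enn2real (Reg A B Q R Qf x0 W K k T)
      = enn2real (STO A B Q R Qf x0 W K k T) - enn2real (STO A B Q R Qf x0 W K T T)"
proof -
  have V: "(\<integral>\<^sup>+w. ennreal (optimal_cost x0 T w) \<partial>W) < \<infinity>"
    by (rule nn_integral_optimal_cost[OF assms(1,2)])
  obtain c where "Reg A B Q R Qf x0 W K k T \<le> ennreal c"
    using Reg_le assms by blast
  then show R: "Reg A B Q R Qf x0 W K k T < \<infinity>" by (rule le_less_trans) simp
  with V show "STO A B Q R Qf x0 W K k T < \<infinity>" by (simp add: STO_eq)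
  show "STO A B Q R Qf x0 W K T T < \<infinity>" using V by (simp add: STO_full)
  show "enn2real (Reg A B Q R Qf x0 W K k T)
      = enn2real (STO A B Q R Qf x0 W K k T) - enn2real (STO A B Q R Qf x0 W K T T)"
    using V R by (simp add: STO_full STO_eq enn2real_plus)
qed

lemma Reg_bigo:
  assumes "second_moments_le W m" "0 \<le> m"
  shows "(\<lambda>(k, T). enn2real (Reg A B Q R Qf x0 W K k T))
    \<in> O[admissible](\<lambda>(k, T). (spectral_norm (matpow F k))\<^sup>2 * real T + 1)"
proof -
  obtain C where C: "C \<ge> 0" "\<And>k T. Reg A B Q R Qf x0 W K k T
    \<le> ennreal (C * ((spectral_norm (matpow F k))\<^sup>2 * real T * m + (norm x0)\<^sup>2 + m))"
    using Reg_le assms by meson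
  show ?thesis
  \<comment> \<open>The factor \<open>(norm x0)\<^sup>2 + m\<close> dominates both the coefficient m
    of the rate and the additive constant.\<close>
  proof (rule bigoI[where c = "C * ((norm x0)\<^sup>2 + m)"], unfold admissible_def eventually_principal, safe)
    fix k T :: nat
    let ?a = "(spectral_norm (matpow F k))\<^sup>2 * real T"
    have "enn2real (Reg A B Q R Qf x0 W K k T) \<le> C * (?a * m + (norm x0)\<^sup>2 + m)"
      using C assms(2) by (intro enn2real_leI) auto
    also have "\<dots> \<le> C * (((norm x0)\<^sup>2 + m) * (?a + 1))"
      using C(1) by (intro mult_left_mono) (auto simp: algebra_simps)
    finally show "norm (enn2real (Reg A B Q R Qf x0 W K k T)) \<le> C * ((norm x0)\<^sup>2 + m) * norm (?a + 1)"
      by (simp add: mult.assoc)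
  qed
qed

end

lemma (in lqr) rate_bigo:
  "(\<lambda>(k, T). (spectral_norm (matpow F k))\<^sup>2 * real T + 1)
    \<in> O[admissible](\<lambda>(k, T). ((1 + spectral_radius F) / 2) ^ (2 * k) * real T + 1)"
proof (rule closed_loop_bound)
  fix C :: real
  let ?l = "(1 + spectral_radius F) / 2"
  assume C: "0 \<le> C" "\<And>k x. norm (matpow F k *v x) \<le> C * ?l ^ k * norm x"
  have "0 \<le> ?l" using spectral_radius_nonneg[of F] by simp
  show ?thesis
  proof (rule bigoI[where c = "C\<^sup>2 + 1"], unfold admissible_def eventually_principal, safe)
    fix k T :: nat
    have "(spectral_norm (matpow F k))\<^sup>2 \<le> (C * ?l ^ k)\<^sup>2"
      by (intro power_mono spectral_norm_le C spectral_norm_nonneg)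
    then have "(spectral_norm (matpow F k))\<^sup>2 * real T \<le> C\<^sup>2 * (?l ^ (2 * k) * real T)"
      using mult_right_mono[of "(spectral_norm (matpow F k))\<^sup>2" "(C * ?l ^ k)\<^sup>2" "real T"]
      by (simp add: power_mult_distrib power_mult[symmetric] mult_ac)
    moreover have "0 \<le> C\<^sup>2" by simp
    moreover have "0 \<le> ?l ^ (2 * k) * real T" using \<open>0 \<le> ?l\<close> by simp
    ultimately have "(spectral_norm (matpow F k))\<^sup>2 * real T + 1 \<le> (C\<^sup>2 + 1) * (?l ^ (2 * k) * real T + 1)"
      unfolding distrib_left distrib_right by linarith
    with \<open>0 \<le> ?l ^ (2 * k) * real T\<close> show "norm ((spectral_norm (matpow F k))\<^sup>2 * real T + 1)
        \<le> (C\<^sup>2 + 1) * norm (?l ^ (2 * k) * real T + 1)"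
      by simp
  qed
qed

section \<open>A tight example\<close>

text \<open>With terminal weight P the stationary gains are optimal at every time of a finite
  horizon, and the regret becomes an exact sum of squares.\<close>

locale lqr_stationary = lqr A B Q R P P
  for A :: "real^'n^'n" and B :: "real^'d^'n" and Q R P
begin

abbreviation dev_along :: "nat \<Rightarrow> real^'n \<Rightarrow> (nat \<Rightarrow> real^'d) \<Rightarrow> (nat \<Rightarrow> real^'n) \<Rightarrow> nat \<Rightarrow> real^'d" where
  "dev_along T x0 u w t \<equiv> deviation T w t (state A B x0 u w t) (u t)"

text \<open>\<open>policy T\<close> sees the whole horizon and has zero deviation, which kills the
  linear part. \<open>sum_costate\<close> with the difference trajectory in both slots and no
  disturbance turns the quadratic part into squares.\<close>

lemma cost_eq:
  "cost A B Q R P x0 T u w = cost A B Q R P x0 T (policy T T x0 w) w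
    + (\<Sum>t<T. dev_along T x0 u w t \<bullet> (gram *v dev_along T x0 u w t))"
proof -
  define v where "v = policy T T x0 w"
  define x where "x = state A B x0 v w"
  define d where "d t = u t - v t" for t
  define y where "y t = state A B x0 u w t - x t" for t
  have y: "y 0 = 0" "y (Suc t) = A *v y t + B *v d t" for t
    by (simp_all add: y_def x_def d_def matrix_vector_mult_diff_distrib)
  have x: "x (Suc t) = A *v x t + B *v v t + w t" for t by (simp add: x_def)
  have opt: "deviation T w t (x t) (v t) = 0" for t
    using deviation_policy[of T w t T x0] by (simp add: x_def v_def state_policy)
  have dev: "dev_along T x0 u w t = d t + gain *v y t" for t
    using opt[of t] by (simp add: deviation_def d_def y_def matrix_vector_mult_diff_distrib algebra_simps)
  have "cost A B Q R P x0 T u w = cost A B Q R P x0 T v w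
      + 2 * ((\<Sum>t<T. x t \<bullet> (Q *v y t) + v t \<bullet> (R *v d t)) + x T \<bullet> (P *v y T))
      + ((\<Sum>t<T. y t \<bullet> (Q *v y t) + d t \<bullet> (R *v d t)) + y T \<bullet> (P *v y T))"
    by (rule cost_expand) (simp_all add: d_def y_def x_def)
  also have "(\<Sum>t<T. x t \<bullet> (Q *v y t) + v t \<bullet> (R *v d t)) + x T \<bullet> (P *v y T) = 0"
    using sum_costate[of T x v w y d, OF x y(1) y(2)] by (simp add: opt)
  also have "(\<Sum>t<T. y t \<bullet> (Q *v y t) + d t \<bullet> (R *v d t)) + y T \<bullet> (P *v y T)
      = (\<Sum>t<T. (d t + gain *v y t) \<bullet> (gram *v (d t + gain *v y t)))"
    using sum_costate[of T y d "\<lambda>_. 0" y d] y by (simp add: deviation_def preview_def)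
  finally show ?thesis by (simp add: dev v_def)
qed

lemma gram_ge: "u \<bullet> (R *v u) \<le> u \<bullet> (gram *v u)"
  using form_nonneg(3)[of "B *v u"] by (simp add: gram_inner)

lemma gram_form_nonneg: "0 \<le> u \<bullet> (gram *v u)"
  using gram_ge form_nonneg(4) by (rule order_trans[rotated])

lemma cost_minus_INF:
  "cost A B Q R P x0 T u w - (INF u'. cost A B Q R P x0 T u' w)
    = (\<Sum>t<T. dev_along T x0 u w t \<bullet> (gram *v dev_along T x0 u w t))"
proof -
  have "cost A B Q R P x0 T (policy T T x0 w) w \<le> cost A B Q R P x0 T u' w" for u'
    unfolding cost_eq[of x0 T u'] by (simp add: sum_nonneg gram_form_nonneg)
  then have "(INF u'. cost A B Q R P x0 T u' w) = cost A B Q R P x0 T (policy T T x0 w) w"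
    by (intro antisym INF_cost_le cINF_greatest) auto
  then show ?thesis by (simp add: cost_eq[of x0 T u])
qed

text \<open>From time T - k on the window covers the rest of the horizon, so only T - k deviations
  are nonzero, and no terminal term appears.\<close>

lemma dominated_policy_regret_stationary:
  "\<exists>C\<ge>0. \<forall>T m k x0. 0 \<le> m \<longrightarrow> k \<le> T \<longrightarrow>
    dominated T m (\<lambda>w. cost A B Q R P x0 T (policy k T x0 w) w - (INF u. cost A B Q R P x0 T u w))
      (C * (spectral_norm (matpow F k))\<^sup>2 * m * (real T - real k))"
proof -
  obtain C where C: "C \<ge> 0" "\<And>T m k t x0. 0 \<le> m \<Longrightarrow> t < T \<Longrightarrow> dominated T m
    (\<lambda>w. (norm (deviation T w t (policy_state k T x0 w t) (policy k T x0 w t)))\<^sup>2)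
    (C * (spectral_norm (matpow F k))\<^sup>2 * m)"
    using dominated_deviation by blast
  have "dominated T m (\<lambda>w. cost A B Q R P x0 T (policy k T x0 w) w - (INF u. cost A B Q R P x0 T u w))
      (spectral_norm gram * C * (spectral_norm (matpow F k))\<^sup>2 * m * (real T - real k))"
    if "0 \<le> m" "k \<le> T" for T m k x0
  proof (rule dominated_mono)
    let ?d = "\<lambda>w t. deviation T w t (policy_state k T x0 w t) (policy k T x0 w t)"
    show "dominated T m (\<lambda>w. \<Sum>t<T - k. spectral_norm gram * (norm (?d w t))\<^sup>2)
        (\<Sum>t<T - k. spectral_norm gram * (C * (spectral_norm (matpow F k))\<^sup>2 * m))"
      using that by (intro dominated_sum dominated_scale C spectral_norm_nonneg) auto
    fix w
    have zero: "?d w t = 0" if "t \<notin> {..<T - k}" for t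
      using that by (simp add: deviation_policy)
    have "cost A B Q R P x0 T (policy k T x0 w) w - (INF u. cost A B Q R P x0 T u w)
        = (\<Sum>t<T. ?d w t \<bullet> (gram *v ?d w t))"
      by (simp add: cost_minus_INF state_policy)
    also have "\<dots> = (\<Sum>t<T - k. ?d w t \<bullet> (gram *v ?d w t))"
      by (rule sum.mono_neutral_right) (auto simp: zero)
    also have "\<dots> \<le> (\<Sum>t<T - k. spectral_norm gram * (norm (?d w t))\<^sup>2)"
    proof (rule sum_mono)
      fix t
      show "?d w t \<bullet> (gram *v ?d w t) \<le> spectral_norm gram * (norm (?d w t))\<^sup>2"
        using order_trans[OF norm_cauchy_schwarz
            mult_left_mono[OF norm_matrix_vector_le norm_ge_zero], of "?d w t" gram "?d w t"]
        by (simp add: power2_eq_square mult_ac)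
    qed
    finally show "cost A B Q R P x0 T (policy k T x0 w) w - (INF u. cost A B Q R P x0 T u w)
        \<le> (\<Sum>t<T - k. spectral_norm gram * (norm (?d w t))\<^sup>2)" .
  qed (use that in \<open>simp add: of_nat_diff mult_ac\<close>)
  moreover have "0 \<le> spectral_norm gram * C" by (rule mult_nonneg_nonneg[OF spectral_norm_nonneg C(1)])
  ultimately show ?thesis by blast
qed

lemma Reg_bigo_stationary:
  assumes "disturbance W K" "second_moments_le W m" "0 \<le> m"
  shows "(\<lambda>(k, T). enn2real (Reg A B Q R P x0 W K k T))
    \<in> O[admissible](\<lambda>(k, T). (spectral_norm (matpow F k))\<^sup>2 * (real T - real k))"
proof -
  interpret disturbance W K by fact
  obtain C where C: "C \<ge> 0" "\<And>T m k x0. 0 \<le> m \<Longrightarrow> k \<le> T \<Longrightarrow>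
    dominated T m (\<lambda>w. cost A B Q R P x0 T (policy k T x0 w) w - (INF u. cost A B Q R P x0 T u w))
      (C * (spectral_norm (matpow F k))\<^sup>2 * m * (real T - real k))"
    using dominated_policy_regret_stationary by blast
  show ?thesis
  proof (rule bigoI[where c = "C * m"], unfold admissible_def eventually_principal, safe)
    fix k T :: nat assume "k \<le> T"
    have "Reg A B Q R P x0 W K k T \<le> ennreal (C * (spectral_norm (matpow F k))\<^sup>2 * m * (real T - real k))"
      unfolding Reg_def
      by (rule predictive_value_le_dominated[where p = "policy k T x0"])
        (rule policy_causal order_refl assms(2) C(2)[OF assms(3) \<open>k \<le> T\<close>])+
    then have "enn2real (Reg A B Q R P x0 W K k T) \<le> C * (spectral_norm (matpow F k))\<^sup>2 * m * (real T - real k)"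
      using C(1) assms(3) \<open>k \<le> T\<close> by (intro enn2real_leI) auto
    then show "norm (enn2real (Reg A B Q R P x0 W K k T))
        \<le> C * m * norm ((spectral_norm (matpow F k))\<^sup>2 * (real T - real k))"
      using \<open>k \<le> T\<close> by (simp add: abs_mult mult_ac)
  qed
qed

end

text \<open>Rank-one matrices place the scalar example in arbitrary dimensions.\<close>

definition outer :: "real^'m \<Rightarrow> real^'n \<Rightarrow> real^'n^'m" where
  "outer x y = (\<chi> i j. x $ i * y $ j)"

lemma outer_mult [simp]: "outer x y *v z = (y \<bullet> z) *\<^sub>R x"
  by (simp add: vec_eq_iff outer_def matrix_vector_mult_def inner_vec_def sum_distrib_left mult_ac)

lemma transpose_outer [simp]: "transpose (outer x y) = outer y x"
  by (simp add: vec_eq_iff outer_def transpose_def mult.commute)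

lemma transpose_scaleR: "transpose (c *\<^sub>R M) = c *\<^sub>R transpose M" for M :: "real^'n^'m"
  by (simp add: vec_eq_iff transpose_def)

lemma spectral_radius_zero: "spectral_radius (0 :: real^'n^'n) < 1"
  unfolding spectral_radius_less_iff
proof
  fix c assume "c \<in> complex_eigenvalues (0 :: real^'n^'n)"
  then obtain v where "v \<noteq> 0" "cmat (0 :: real^'n^'n) *v v = c *s v" by (auto simp: complex_eigenvalues_def)
  moreover have "cmat (0 :: real^'n^'n) *v v = 0"
    by (simp add: vec_eq_iff matrix_vector_mult_def map_matrix_def)
  ultimately have "norm (c *s v) = 0" by simp
  with \<open>v \<noteq> 0\<close> show "cmod c < 1" by (simp add: norm_scale_complex)
qed

text \<open>The scalar system \<open>x' = x + u + w\<close> with weights \<open>q = 1/2\<close>, \<open>r = 1\<close>, for which \<open>p = 1\<close> and the closed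
  loop is \<open>1/2\<close>, placed on one coordinate axis of each space.\<close>

locale axis_system =
  fixes e :: "real^'n" and b :: "real^'d"
  assumes ee [simp]: "e \<bullet> e = 1" and bb [simp]: "b \<bullet> b = 1"
begin

text \<open>The Sherman-Morrison formula for the identity plus \<open>outer b b\<close>, where the
  denominator is 1 + b \<bullet> b = 2.\<close>

lemma gram_inv:
  "matrix_inv (mat 1 + transpose (outer e b) ** outer e e ** outer e b) *v z = z - (1/2) *\<^sub>R ((b \<bullet> z) *\<^sub>R b)"
proof -
  let ?G = "mat 1 + transpose (outer e b) ** outer e e ** outer e b"
  have G: "?G *v z = z + (b \<bullet> z) *\<^sub>R b" for z
    by (simp add: matrix_vector_mult_add_rdistrib flip: matrix_vector_mul_assoc)
  have "invertible ?G"
    unfolding invertible_left_inverse matrix_left_invertible_ker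
  proof (intro allI impI)
    fix z assume "?G *v z = 0"
    then have z: "z + (b \<bullet> z) *\<^sub>R b = 0" by (simp only: G)
    then have "b \<bullet> (z + (b \<bullet> z) *\<^sub>R b) = 0" by simp
    then have "b \<bullet> z = 0" by (simp add: inner_add_right)
    with z show "z = 0" by simp
  qed
  then have inv: "?G *v (matrix_inv ?G *v z) = z" by (rule invertible_matrix_inv_right)
  define v where "v = matrix_inv ?G *v z"
  have z: "v + (b \<bullet> v) *\<^sub>R b = z" using inv unfolding G v_def .
  then have "b \<bullet> (v + (b \<bullet> v) *\<^sub>R b) = b \<bullet> z" by simp
  then have "b \<bullet> v = (b \<bullet> z) / 2" by (simp add: inner_add_right)
  with z have "v = z - ((b \<bullet> z) / 2) *\<^sub>R b" by (metis add_diff_cancel_right')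
  then show ?thesis by (simp add: v_def)
qed

lemma lqr_setting_axis:
  "lqr_setting (outer e e) (outer e b) ((1/2) *\<^sub>R outer e e) (mat 1) (outer e e) (outer e e)"
  unfolding lqr_setting_def
proof (intro conjI)
  show "sym_psd ((1/2) *\<^sub>R outer e e)" "sym_psd (outer e e)" "sym_psd (outer e e)"
    by (simp_all add: sym_psd_def transpose_scaleR scaleR_matrix_vector_assoc[symmetric] inner_commute)
  show "sym_pd (mat 1 :: real^'d^'d)"
    by (simp add: sym_pd_def transpose_mat)
  \<comment> \<open>The gain \<open>outer b e\<close> cancels the dynamics completely; the zero
    matrix is trivially stable.\<close>
  have "outer e e - outer e b ** outer b e = 0"
    by (simp add: matrix_eq matrix_vector_mult_diff_rdistrib flip: matrix_vector_mul_assoc)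
  then show "stabilizable (outer e e) (outer e b)"
    unfolding stabilizable_def using spectral_radius_zero by metis
  \<comment> \<open>The factor 2 compensates the weight 1/2 in Q.\<close>
  have "transpose (outer e e) - (1/2) *\<^sub>R outer e e ** (2 *\<^sub>R outer e e) = 0"
    by (simp add: matrix_eq matrix_vector_mult_diff_rdistrib scaleR_matrix_vector_assoc[symmetric]
        flip: matrix_vector_mul_assoc)
  then show "detectable (outer e e) ((1/2) *\<^sub>R outer e e)"
    unfolding detectable_def stabilizable_def using spectral_radius_zero by metis
  show "solves_riccati (outer e e) (outer e b) ((1/2) *\<^sub>R outer e e) (mat 1) (outer e e)"
    unfolding solves_riccati_def matrix_eq
  proof
    fix x
    let ?G = "mat 1 + transpose (outer e b) ** outer e e ** outer e b"
    have "((1/2) *\<^sub>R outer e e + transpose (outer e e) ** outer e e ** outer e e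
        - transpose (outer e e) ** outer e e ** outer e b ** matrix_inv ?G ** transpose (outer e b) ** outer e e ** outer e e) *v x
      = (1/2) *\<^sub>R ((e \<bullet> x) *\<^sub>R e) + (e \<bullet> x) *\<^sub>R e
        - outer e e *v (outer e e *v (outer e b *v (matrix_inv ?G *v ((e \<bullet> x) *\<^sub>R b))))"
      by (simp add: matrix_vector_mult_diff_rdistrib matrix_vector_mult_add_rdistrib
          scaleR_matrix_vector_assoc[symmetric] flip: matrix_vector_mul_assoc)
    \<comment> \<open>The scalar Riccati equation at p = 1, namely 1/2 + 1 - 1/2 = 1.\<close>
    also have "\<dots> = outer e e *v x"
      unfolding gram_inv by (simp add: inner_diff_right)
    finally show "outer e e *v x = ((1/2) *\<^sub>R outer e e + transpose (outer e e) ** outer e e ** outer e e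
        - transpose (outer e e) ** outer e e ** outer e b ** matrix_inv ?G ** transpose (outer e b) ** outer e e ** outer e e) *v x"
      by simp
  qed
qed

sublocale lqr_stationary "outer e e" "outer e b" "(1/2) *\<^sub>R outer e e" "mat 1" "outer e e"
  by unfold_locales (rule lqr_setting_axis)

lemma gram_inv_mult: "matrix_inv gram *v z = z - (1/2) *\<^sub>R ((b \<bullet> z) *\<^sub>R b)"
  unfolding gram_def by (rule gram_inv)

lemma gain_axis: "gain *v x = ((e \<bullet> x) / 2) *\<^sub>R b"
  unfolding gain_mult gram_inv_mult by (simp flip: scaleR_left.diff)

lemma F_axis: "F *v x = ((e \<bullet> x) / 2) *\<^sub>R e"
  unfolding F_mult gain_axis by (simp flip: scaleR_left.diff)

text \<open>Starts at the first power because the zeroth is the identity, which has rank one only in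
  dimension one.\<close>

lemma matpow_F_axis: "matpow F (Suc k) *v x = ((1/2) ^ Suc k * (e \<bullet> x)) *\<^sub>R e"
proof (induction k arbitrary: x)
  case 0
  show ?case by (simp add: matpow_Suc F_axis)
next
  case (Suc k)
  show ?case unfolding matpow_Suc_vec[of _ "Suc k"] Suc F_axis by simp
qed

lemma spectral_norm_matpow_F: "1 \<le> k \<Longrightarrow> spectral_norm (matpow F k) \<le> (1/2) ^ k"
proof (rule spectral_norm_le)
  fix x assume "1 \<le> k"
  then obtain j where k: "k = Suc j" by (cases k) auto
  have "norm e = 1" by (simp add: norm_eq_sqrt_inner)
  then have "\<bar>e \<bullet> x\<bar> \<le> norm x" using Cauchy_Schwarz_ineq2[of e x] by simp
  with \<open>norm e = 1\<close> show "norm (matpow F k *v x) \<le> (1/2) ^ k * norm x"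
    unfolding k matpow_F_axis by (simp add: abs_mult mult_left_mono)
qed

lemma transpose_F_axis: "transpose F *v e = (1/2) *\<^sub>R e"
proof -
  have "(transpose F *v e) \<bullet> y = ((1/2) *\<^sub>R e) \<bullet> y" for y
    by (simp add: inner_transpose F_axis)
  then show ?thesis by (metis vector_eq_rdot)
qed

lemma inner_preview: "e \<bullet> preview n w t = (\<Sum>i<n. (1/2) ^ i * (e \<bullet> w (t + i)))"
proof -
  have "matpow (transpose F) i *v e = ((1/2) ^ i) *\<^sub>R e" for i
    by (induction i) (simp_all add: matpow_Suc_vec transpose_F_axis matrix_vector_mult_scaleR)
  then show ?thesis
    unfolding preview_def inner_sum_right by (simp add: matrix_vector_mult_scaleR mult.commute)
qed

text \<open>The deviation, with disturbances from time \<open>S\<close> on replaced by their mean.\<close>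

definition mean_deviation :: "nat \<Rightarrow> (nat \<Rightarrow> real^'d) \<Rightarrow> (nat \<Rightarrow> real^'n) \<Rightarrow> nat \<Rightarrow> real" where
  "mean_deviation S u w t = b \<bullet> u t + (e \<bullet> state (outer e e) (outer e b) 0 u w t) / 2
    + (\<Sum>i<S - t. (1/2) ^ i * (e \<bullet> w (t + i))) / 2"

lemma inner_deviation: "b \<bullet> dev_along T 0 u w t = mean_deviation T u w t"
  unfolding deviation_def gain_axis gram_inv_mult mean_deviation_def
  by (simp add: inner_add_right inner_diff_right inner_preview)

lemma sum_mean_deviation_le:
  "(\<Sum>t<T. (mean_deviation T u w t)\<^sup>2) \<le> cost (outer e e) (outer e b) ((1/2) *\<^sub>R outer e e) (mat 1) (outer e e) 0 T u w
    - (INF u'. cost (outer e e) (outer e b) ((1/2) *\<^sub>R outer e e) (mat 1) (outer e e) 0 T u' w)"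
  unfolding cost_minus_INF
proof (rule sum_mono)
  fix t
  let ?z = "dev_along T 0 u w t"
  have "norm b = 1" by (simp add: norm_eq_sqrt_inner)
  then have "\<bar>b \<bullet> ?z\<bar> \<le> norm ?z" using Cauchy_Schwarz_ineq2[of b ?z] by simp
  then have "(b \<bullet> ?z)\<^sup>2 \<le> (norm ?z)\<^sup>2" by (metis abs_ge_zero power2_abs power_mono)
  also have "\<dots> \<le> ?z \<bullet> (gram *v ?z)" using gram_ge[of ?z] by (simp add: dot_square_norm)
  finally show "(mean_deviation T u w t)\<^sup>2 \<le> ?z \<bullet> (gram *v ?z)" by (simp add: inner_deviation)
qed

lemma state_control_cong:
  "(\<And>i. i < t \<Longrightarrow> u i = u' i) \<Longrightarrow> state A' B' x0 u w t = state A' B' x0 u' w t"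
  by (induction t) auto

lemma mean_deviation_control_cong: "(\<And>i. i \<le> t \<Longrightarrow> u i = u' i) \<Longrightarrow> mean_deviation S u w t = mean_deviation S u' w t"
proof -
  assume eq: "\<And>i. i \<le> t \<Longrightarrow> u i = u' i"
  have "state (outer e e) (outer e b) 0 u w t = state (outer e e) (outer e b) 0 u' w t"
    by (rule state_control_cong) (simp add: eq)
  with eq show ?thesis by (simp add: mean_deviation_def)
qed

text \<open>Revealing w s leaves the state at t unchanged and adds one term of the preview. Its
  exponent is s - t from the powers of F, plus one from the inverse of \<open>gram\<close>.\<close>

lemma mean_deviation_update:
  assumes "t \<le> s"
  shows "mean_deviation (Suc s) u (w(s := y)) t = mean_deviation s u w t + (1/2) ^ Suc (s - t) * (e \<bullet> y)"
proof -
  have "state (outer e e) (outer e b) 0 u (w(s := y)) t = state (outer e e) (outer e b) 0 u w t"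
    by (rule depends_belowD[OF state_depends]) (use assms in auto)
  moreover have "(\<Sum>i<s - t. (1/2) ^ i * (e \<bullet> (w(s := y)) (t + i))) = (\<Sum>i<s - t. (1/2) ^ i * (e \<bullet> w (t + i)))"
    by (rule sum.cong) auto
  ultimately show ?thesis
    using assms by (simp add: mean_deviation_def Suc_diff_le add_divide_distrib)
qed

section \<open>The fair sign disturbance and the lower bound\<close>

definition coin :: "(real^'n) measure" where
  "coin = distr (measure_pmf (bernoulli_pmf (1/2))) borel (\<lambda>c. if c then e else - e)"

lemma sets_coin [simp]: "sets coin = sets borel" by (simp add: coin_def)

lemma prob_space_coin: "prob_space coin"
  unfolding coin_def by (intro measure_pmf.prob_space_distr) simp

lemma nn_integral_coin:
  assumes "g \<in> borel_measurable borel" "\<And>y. 0 \<le> g y"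
  shows "(\<integral>\<^sup>+y. ennreal (g y) \<partial>coin) = ennreal ((g e + g (- e)) / 2)"
proof -
  have "(\<integral>\<^sup>+y. ennreal (g y) \<partial>coin)
      = (\<integral>\<^sup>+c. ennreal (g (if c then e else - e)) \<partial>measure_pmf (bernoulli_pmf (1/2)))"
    unfolding coin_def using assms(1) by (intro nn_integral_distr) auto
  also have "\<dots> = ennreal (g e * (1/2)) + ennreal (g (- e) * (1/2))"
  proof -
    have half: "ennreal x * ennreal (1/2) = ennreal (x * (1/2))" if "0 \<le> x" for x
      by (rule ennreal_mult[symmetric]) (use that in auto)
    have "(1 :: real) - 1/2 = 1/2" by simp
    then show ?thesis
      by (subst nn_integral_bernoulli_pmf) (simp_all only: if_True if_False half[OF assms(2)], simp_all)
  qed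
  also have "\<dots> = ennreal ((g e + g (- e)) / 2)"
    using assms(2) by (simp add: add_divide_distrib flip: ennreal_plus)
  finally show ?thesis .
qed

lemma AE_coin: "AE y in coin. norm y = 1"
proof -
  have "norm e = 1" by (simp add: norm_eq_sqrt_inner)
  then show ?thesis unfolding coin_def by (subst AE_distr_iff) auto
qed

text \<open>A disturbance with mean zero and variance one that is still unknown when \<open>u t\<close> is chosen adds
  its variance to the square of every deviation that it enters.\<close>

lemma stages_lower:
  assumes G: "\<And>u w. ennreal (\<Sum>t<T. (mean_deviation T u w t)\<^sup>2) \<le> G u w"
  shows "j \<le> T - k \<Longrightarrow> ennreal ((\<Sum>t<T - k - j. (mean_deviation (T - j) u w t)\<^sup>2) + real j * (1/4) ^ Suc k)
    \<le> stages (\<lambda>_ _. coin) k T G j u w"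
proof (induction j arbitrary: u w)
  case 0
  \<comment> \<open>The last k controls are still free here, so only the first T - k deviations,
    already determined by u, are kept.\<close>
  have "ennreal (\<Sum>t<T - k. (mean_deviation T u w t)\<^sup>2) \<le> G v w" if "\<forall>i<T - k. v i = u i" for v
  proof -
    have "(\<Sum>t<T - k. (mean_deviation T u w t)\<^sup>2) = (\<Sum>t<T - k. (mean_deviation T v w t)\<^sup>2)"
      using that by (intro sum.cong refl arg_cong[where f = "\<lambda>x. x\<^sup>2"] mean_deviation_control_cong) auto
    also have "\<dots> \<le> (\<Sum>t<T. (mean_deviation T v w t)\<^sup>2)" by (rule sum_mono2) auto
    finally show ?thesis using order_trans[OF ennreal_leI G] by blast
  qed
  then show ?case by (auto intro!: INF_greatest)
next
  case (Suc j)
  define t0 where "t0 = T - k - Suc j"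
  define s where "s = t0 + k"
  have s: "T - j = Suc s" "T - k - j = Suc t0" "T - Suc j = s"
    using Suc.prems by (simp_all add: s_def t0_def)
  have "ennreal ((\<Sum>t<t0. (mean_deviation s u w t)\<^sup>2) + real (Suc j) * (1/4) ^ Suc k)
      \<le> (\<integral>\<^sup>+y. stages (\<lambda>_ _. coin) k T G j (u(t0 := a)) (w(s := y)) \<partial>coin)" for a
  proof -
    let ?u = "u(t0 := a)"
    \<comment> \<open>The induction hypothesis as a function of the disturbance about to be drawn.
      It is continuous, so its integral can be evaluated even though \<open>stages\<close> is only
      bounded below.\<close>
    define g where "g y = (\<Sum>t<Suc t0. (mean_deviation s ?u w t + (1/2) ^ Suc (s - t) * (e \<bullet> y))\<^sup>2) + real j * (1/4) ^ Suc k"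
      for y
    have "(\<Sum>t<t0. (mean_deviation s u w t)\<^sup>2) + real (Suc j) * (1/4) ^ Suc k
        \<le> (\<Sum>t<Suc t0. (mean_deviation s ?u w t)\<^sup>2 + ((1/2) ^ Suc (s - t))\<^sup>2) + real j * (1/4) ^ Suc k"
    proof -
      have "(\<Sum>t<t0. (mean_deviation s u w t)\<^sup>2) = (\<Sum>t<t0. (mean_deviation s ?u w t)\<^sup>2)"
        by (intro sum.cong refl arg_cong[where f = "\<lambda>x. x\<^sup>2"] mean_deviation_control_cong) auto
      also have "\<dots> \<le> (\<Sum>t<t0. (mean_deviation s ?u w t)\<^sup>2 + ((1/2) ^ Suc (s - t))\<^sup>2)"
        by (rule sum_mono) simp
      finally have "(\<Sum>t<t0. (mean_deviation s u w t)\<^sup>2) \<le> (\<Sum>t<t0. (mean_deviation s ?u w t)\<^sup>2 + ((1/2) ^ Suc (s - t))\<^sup>2)" .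
      \<comment> \<open>The newest deviation, at t0 = s - k, contributes this variance. Increments
        of the earlier deviations are simply dropped.\<close>
      moreover have "((1/2) ^ Suc (s - t0))\<^sup>2 = (1/4 :: real) ^ Suc k"
        unfolding power2_eq_square power_mult_distrib[symmetric] by (simp add: s_def)
      ultimately show ?thesis
        using zero_le_power2[of "mean_deviation s ?u w t0"]
        unfolding sum.lessThan_Suc of_nat_Suc distrib_right by linarith
    qed
    also have "\<dots> = (g e + g (- e)) / 2"
    proof -
      \<comment> \<open>Averaging over the two signs cancels the cross terms, which is where the
        mean zero is used.\<close>
      have "(x + y)\<^sup>2 + (x - y)\<^sup>2 = 2 * (x\<^sup>2 + y\<^sup>2)" for x y :: real
        by (simp add: power2_eq_square algebra_simps)
      then have "g e + g (- e) = 2 * (\<Sum>t<Suc t0. (mean_deviation s ?u w t)\<^sup>2 + ((1/2) ^ Suc (s - t))\<^sup>2)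
          + 2 * (real j * (1/4) ^ Suc k)"
        unfolding g_def sum_distrib_left by (simp add: sum.distrib[symmetric] del: sum.lessThan_Suc)
      then show ?thesis by simp
    qed
    finally have "ennreal ((\<Sum>t<t0. (mean_deviation s u w t)\<^sup>2) + real (Suc j) * (1/4) ^ Suc k)
        \<le> (\<integral>\<^sup>+y. ennreal (g y) \<partial>coin)"
    proof (subst nn_integral_coin)
      show "g \<in> borel_measurable borel"
        unfolding g_def[abs_def] by (intro borel_measurable_continuous_onI continuous_intros)
      show "0 \<le> g y" for y
        unfolding g_def by (intro add_nonneg_nonneg sum_nonneg) auto
    qed (rule ennreal_leI)
    also have "\<dots> \<le> (\<integral>\<^sup>+y. stages (\<lambda>_ _. coin) k T G j ?u (w(s := y)) \<partial>coin)"
    proof (rule nn_integral_mono)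
      fix y
      have "g y = (\<Sum>t<T - k - j. (mean_deviation (T - j) ?u (w(s := y)) t)\<^sup>2) + real j * (1/4) ^ Suc k"
        unfolding g_def s by (intro arg_cong2[where f = "(+)"] sum.cong refl)
          (use s_def in \<open>auto simp: mean_deviation_update simp del: power_Suc\<close>)
      then show "ennreal (g y) \<le> stages (\<lambda>_ _. coin) k T G j ?u (w(s := y))"
        by (simp only:) (rule Suc.IH, use Suc.prems in simp)
    qed
    finally show ?thesis .
  qed
  then show ?case
    unfolding s stages.simps Let_def t0_def[symmetric] s_def[symmetric] by (intro INF_greatest)
qed

abbreviation coin_law :: "(nat \<Rightarrow> real^'n) measure" where
  "coin_law \<equiv> PiM UNIV (\<lambda>_. coin)"

lemma sets_PiM_coin: "sets (PiM I (\<lambda>_. coin)) = sets (PiM I (\<lambda>_. borel))"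
  by (intro sets_PiM_cong) auto

text \<open>Independence makes the constant kernel a conditional law. The event is a cylinder over
  the first t + 1 coordinates, and Fubini integrates out the last of them.\<close>

lemma disturbance_coin: "disturbance coin_law (\<lambda>_ _. coin)"
proof
  interpret product_prob_space "\<lambda>_ :: nat. coin" UNIV
    by (intro product_prob_spaceI prob_space_coin)
  show "joint_law coin_law"
    unfolding joint_law_def by (simp add: sets_PiM_coin prob_space_axioms)
  have "coin \<in> space (prob_algebra borel)"
    by (simp add: space_prob_algebra prob_space_coin)
  moreover have "emeasure coin_law {w \<in> space coin_law. restrict w {..<t} \<in> S \<and> w t \<in> X}
      = (\<integral>\<^sup>+w. indicator S (restrict w {..<t}) * emeasure coin X \<partial>coin_law)"
    if S: "S \<in> sets (prefix_space t)" and X: "X \<in> sets borel" for t S X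
  proof -
    let ?J = "insert t {..<t}"
    have S': "S \<in> sets (PiM {..<t} (\<lambda>_. coin))" using S by (simp add: sets_PiM_coin)
    have X': "X \<in> sets coin" using X by simp
    define E where "E = {p \<in> space (PiM ?J (\<lambda>_. coin)). restrict p {..<t} \<in> S \<and> p t \<in> X}"
    have r: "(\<lambda>p. restrict p {..<t}) \<in> PiM ?J (\<lambda>_. coin) \<rightarrow>\<^sub>M PiM {..<t} (\<lambda>_. coin)"
      by (rule measurable_restrict_subset) auto
    have c: "(\<lambda>p. p t) \<in> PiM ?J (\<lambda>_. coin) \<rightarrow>\<^sub>M coin"
      by (rule measurable_component_singleton) simp
    have "E = ((\<lambda>p. restrict p {..<t}) -` S \<inter> space (PiM ?J (\<lambda>_. coin)))
        \<inter> ((\<lambda>p. p t) -` X \<inter> space (PiM ?J (\<lambda>_. coin)))"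
      by (auto simp: E_def)
    then have E: "E \<in> sets (PiM ?J (\<lambda>_. coin))"
      using measurable_sets[OF r S'] measurable_sets[OF c X'] by auto
    have restr: "restrict (restrict w ?J) {..<t} = restrict w {..<t}" for w :: "nat \<Rightarrow> real^'n"
      by auto
    have "{w \<in> space coin_law. restrict w {..<t} \<in> S \<and> w t \<in> X} = emb UNIV ?J E"
      by (auto simp: prod_emb_def E_def space_PiM restr)
    then have "emeasure coin_law {w \<in> space coin_law. restrict w {..<t} \<in> S \<and> w t \<in> X} = emeasure (PiM ?J (\<lambda>_. coin)) E"
      using E by (simp add: emeasure_PiM_emb')
    also have "\<dots> = (\<integral>\<^sup>+p. indicator E p \<partial>PiM ?J (\<lambda>_. coin))" using E by simp
    also have "\<dots> = (\<integral>\<^sup>+p. \<integral>\<^sup>+y. indicator E (p(t := y)) \<partial>coin \<partial>PiM {..<t} (\<lambda>_. coin))"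
      using E by (intro product_nn_integral_insert) auto
    also have "\<dots> = (\<integral>\<^sup>+p. indicator S p * emeasure coin X \<partial>PiM {..<t} (\<lambda>_. coin))"
    proof (rule nn_integral_cong)
      fix p assume p: "p \<in> space (PiM {..<t} (\<lambda>_. coin))"
      have "restrict (p(t := y)) {..<t} = p" for y
        using p by (auto simp: space_PiM PiE_def extensional_def fun_eq_iff)
      moreover have "p(t := y) \<in> space (PiM ?J (\<lambda>_. coin))" if "y \<in> space coin" for y
        using p that by (auto simp: space_PiM PiE_def extensional_def)
      ultimately have "indicator E (p(t := y)) = indicator S p * (indicator X y :: ennreal)" if "y \<in> space coin" for y
        using that by (auto simp: E_def indicator_def)
      then have "(\<integral>\<^sup>+y. indicator E (p(t := y)) \<partial>coin) = (\<integral>\<^sup>+y. indicator S p * indicator X y \<partial>coin)"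
        by (rule nn_integral_cong)
      then show "(\<integral>\<^sup>+y. indicator E (p(t := y)) \<partial>coin) = indicator S p * emeasure coin X"
        using X' by (simp add: nn_integral_cmult)
    qed
    also have "\<dots> = (\<integral>\<^sup>+p. indicator S p * emeasure coin X \<partial>distr coin_law (PiM {..<t} (\<lambda>_. coin)) (\<lambda>w. restrict w {..<t}))"
      by (subst distr_PiM_restrict_finite) auto
    also have "\<dots> = (\<integral>\<^sup>+w. indicator S (restrict w {..<t}) * emeasure coin X \<partial>coin_law)"
      using S' by (intro nn_integral_distr measurable_restrict_subset) auto
    finally show ?thesis .
  qed
  ultimately show "cond_laws coin_law (\<lambda>_ _. coin)"
    unfolding cond_laws_def by auto
qed

text \<open>Disturbances are almost surely unit vectors, so Cauchy-Schwarz bounds every product by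
  1.\<close>

lemma second_moments_coin: "second_moments_le coin_law 1"
  unfolding second_moments_le_def
proof (intro allI conjI)
  fix t t'
  interpret prob_space coin_law by (intro prob_space_PiM prob_space_coin)
  have "AE w in coin_law. norm (w i) = 1" for i
    using AE_PiM_component[of UNIV "\<lambda>_. coin" i "\<lambda>y. norm y = 1"] AE_coin prob_space_coin by auto
  from this[of t] this[of t'] have AE: "AE w in coin_law. \<bar>w t \<bullet> w t'\<bar> \<le> 1"
  proof eventually_elim
    case (elim w)
    then show ?case using Cauchy_Schwarz_ineq2[of "w t" "w t'"] by simp
  qed
  have [measurable]: "(\<lambda>w. w i) \<in> coin_law \<rightarrow>\<^sub>M borel" for i
    unfolding measurable_cong_sets[OF sets_PiM_coin refl] by (rule measurable_component_singleton) simp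
  show int: "integrable coin_law (\<lambda>w. w t \<bullet> w t')"
    using AE by (intro integrable_const_bound[where B = 1]) auto
  show "(\<integral>w. w t \<bullet> w t' \<partial>coin_law) \<le> 1"
    using AE by (intro integral_le_const int) (auto elim!: eventually_mono)
qed

abbreviation coin_Reg :: "nat \<Rightarrow> nat \<Rightarrow> ennreal" where
  "coin_Reg k T \<equiv> Reg (outer e e) (outer e b) ((1/2) *\<^sub>R outer e e) (mat 1) (outer e e) 0
    coin_law (\<lambda>_ _. coin) k T"

text \<open>\<open>stages_lower\<close> at j = T - k, where no deviation is left in the sum and only
  the accumulated variances remain.\<close>

lemma coin_Reg_ge: "ennreal (real (T - k) * (1/4) ^ Suc k) \<le> coin_Reg k T"
proof -
  interpret prob_space coin_law by (intro prob_space_PiM prob_space_coin)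
  have "ennreal (real (T - k) * (1/4) ^ Suc k) = (\<integral>\<^sup>+w. ennreal (real (T - k) * (1/4) ^ Suc k) \<partial>coin_law)"
    by (simp add: emeasure_space_1)
  also have "\<dots> \<le> coin_Reg k T"
    unfolding Reg_def predictive_value_def
  proof (rule nn_integral_mono)
    fix w
    show "ennreal (real (T - k) * (1/4) ^ Suc k) \<le> stages (\<lambda>_ _. coin) k T (\<lambda>u w. ennreal
        (cost (outer e e) (outer e b) ((1/2) *\<^sub>R outer e e) (mat 1) (outer e e) 0 T u w
         - (INF u'. cost (outer e e) (outer e b) ((1/2) *\<^sub>R outer e e) (mat 1) (outer e e) 0 T u' w)))
        (T - k) (\<lambda>_. 0) w"
      using stages_lower[of T _ "T - k" k "\<lambda>_. 0" w, OF ennreal_leI[OF sum_mean_deviation_le]] by simp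
  qed
  finally show ?thesis .
qed

lemma coin_Reg_bigtheta:
  "(\<lambda>(k, T). enn2real (coin_Reg k T))
    \<in> \<Theta>[admissible](\<lambda>(k, T). (spectral_norm (matpow F k))\<^sup>2 * (real T - real k))"
proof (rule bigthetaI)
  interpret lqr_disturbance "outer e e" "outer e b" "(1/2) *\<^sub>R outer e e" "mat 1" "outer e e" "outer e e"
      coin_law "\<lambda>_ _. coin"
    by (intro lqr_disturbance.intro lqr_axioms disturbance_coin)
  show "(\<lambda>(k, T). enn2real (coin_Reg k T))
      \<in> O[admissible](\<lambda>(k, T). (spectral_norm (matpow F k))\<^sup>2 * (real T - real k))"
    by (rule Reg_bigo_stationary[OF disturbance_coin second_moments_coin]) simp
  show "(\<lambda>(k, T). enn2real (coin_Reg k T))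
      \<in> \<Omega>[admissible](\<lambda>(k, T). (spectral_norm (matpow F k))\<^sup>2 * (real T - real k))"
    unfolding bigomega_iff_bigo
  \<comment> \<open>The constant 4 makes up for the extra factor 1/4 in
    \<open>(1/4) ^ Suc k\<close>.\<close>
  proof (rule bigoI[where c = 4], unfold admissible_def eventually_principal, safe)
    fix k T :: nat assume k: "1 \<le> k" "k \<le> T"
    have "(spectral_norm (matpow F k))\<^sup>2 \<le> ((1/2) ^ k)\<^sup>2"
      by (intro power_mono spectral_norm_matpow_F k spectral_norm_nonneg)
    also have "\<dots> = (1/4) ^ k" by (simp add: power2_eq_square flip: power_mult_distrib)
    finally have "(spectral_norm (matpow F k))\<^sup>2 * (real T - real k) \<le> 4 * (real (T - k) * (1/4) ^ Suc k)"
      using k mult_right_mono[of "(spectral_norm (matpow F k))\<^sup>2" "(1/4) ^ k" "real T - real k"]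
      by (simp add: of_nat_diff mult_ac)
    also have "real (T - k) * (1/4) ^ Suc k \<le> enn2real (coin_Reg k T)"
    proof -
      have "coin_Reg k T < \<infinity>" by (rule Reg_properties(1)[OF second_moments_coin]) simp
      then have "ennreal (real (T - k) * (1/4) ^ Suc k) \<le> ennreal (enn2real (coin_Reg k T))"
        using coin_Reg_ge[of T k] by simp
      then show ?thesis by (subst (asm) ennreal_le_iff) auto
    qed
    finally show "norm ((spectral_norm (matpow F k))\<^sup>2 * (real T - real k)) \<le> 4 * norm (enn2real (coin_Reg k T))"
      using k by (simp add: abs_mult)
  qed
qed

end

theorem theorem4p7:
  shows
  "(\<forall>(A :: real^'n^'n) (B :: real^'d^'n) Q R Qf P x0 W K m F lam.
      lqr_setting A B Q R Qf P \<and> joint_law W \<and> cond_laws W K \<and> 0 < m \<and> second_moments_le W m \<and>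
      F = closed_loop A B R P \<and> lam = (1 + spectral_radius F) / 2 \<longrightarrow>
        (\<forall>k T. 1 \<le> k \<and> k \<le> T \<longrightarrow>
           Reg A B Q R Qf x0 W K k T < \<infinity> \<and> STO A B Q R Qf x0 W K k T < \<infinity> \<and>
           STO A B Q R Qf x0 W K T T < \<infinity> \<and>
           enn2real (Reg A B Q R Qf x0 W K k T) =
             enn2real (STO A B Q R Qf x0 W K k T) - enn2real (STO A B Q R Qf x0 W K T T)) \<and>
        (\<lambda>(k, T). enn2real (Reg A B Q R Qf x0 W K k T))
          \<in> O[admissible](\<lambda>(k, T). (spectral_norm (matpow F k))\<^sup>2 * real T + 1) \<and>
        (\<lambda>(k, T). (spectral_norm (matpow F k))\<^sup>2 * real T + 1)
          \<in> O[admissible](\<lambda>(k, T). lam ^ (2 * k) * real T + 1) \<and>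
        (\<lambda>(k, T). enn2real (Reg A B Q R Qf x0 W K k T))
          \<in> O[admissible](\<lambda>(k, T). lam ^ (2 * k) * real T + 1)) \<and>
   (\<exists>(A :: real^'n^'n) (B :: real^'d^'n) Q R Qf P x0 W K m F.
      lqr_setting A B Q R Qf P \<and> joint_law W \<and> cond_laws W K \<and> 0 < m \<and> second_moments_le W m \<and>
      F = closed_loop A B R P \<and>
      (\<lambda>(k, T). enn2real (Reg A B Q R Qf x0 W K k T))
        \<in> \<Theta>[admissible](\<lambda>(k, T). (spectral_norm (matpow F k))\<^sup>2 * (real T - real k)))"
proof (rule conjI, intro allI impI, elim conjE)
    fix A :: "real^'n^'n" and B :: "real^'d^'n" and Q R Qf P x0 and W :: "(nat \<Rightarrow> real^'n) measure" and K and m lam :: real and F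
    assume setting: "lqr_setting A B Q R Qf P" and W: "joint_law W" "cond_laws W K"
      and m: "0 < m" "second_moments_le W m"
      and F: "F = closed_loop A B R P" and lam: "lam = (1 + spectral_radius F) / 2"
    interpret lqr_disturbance A B Q R Qf P W K by unfold_locales fact+
    have rate: "(\<lambda>(k, T). (spectral_norm (matpow F k))\<^sup>2 * real T + 1)
        \<in> O[admissible](\<lambda>(k, T). lam ^ (2 * k) * real T + 1)"
      unfolding lam F by (rule rate_bigo)
    have Reg: "(\<lambda>(k, T). enn2real (Reg A B Q R Qf x0 W K k T))
        \<in> O[admissible](\<lambda>(k, T). (spectral_norm (matpow F k))\<^sup>2 * real T + 1)"
      unfolding F using m by (intro Reg_bigo) auto
    show "(\<forall>k T. 1 \<le> k \<and> k \<le> T \<longrightarrow>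
           Reg A B Q R Qf x0 W K k T < \<infinity> \<and> STO A B Q R Qf x0 W K k T < \<infinity> \<and>
           STO A B Q R Qf x0 W K T T < \<infinity> \<and>
           enn2real (Reg A B Q R Qf x0 W K k T) =
             enn2real (STO A B Q R Qf x0 W K k T) - enn2real (STO A B Q R Qf x0 W K T T)) \<and>
        (\<lambda>(k, T). enn2real (Reg A B Q R Qf x0 W K k T))
          \<in> O[admissible](\<lambda>(k, T). (spectral_norm (matpow F k))\<^sup>2 * real T + 1) \<and>
        (\<lambda>(k, T). (spectral_norm (matpow F k))\<^sup>2 * real T + 1)
          \<in> O[admissible](\<lambda>(k, T). lam ^ (2 * k) * real T + 1) \<and>
        (\<lambda>(k, T). enn2real (Reg A B Q R Qf x0 W K k T))
          \<in> O[admissible](\<lambda>(k, T). lam ^ (2 * k) * real T + 1)"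
      using Reg_properties[OF m(2) less_imp_le[OF m(1)]] Reg rate landau_o.big_trans[OF Reg rate]
      by blast
next
  \<comment> \<open>Any coordinate would do; \<open>undefined\<close> names one in each index
    type.\<close>
  interpret axis_system "axis undefined 1 :: real^'n" "axis undefined 1 :: real^'d"
    by unfold_locales (simp_all add: inner_axis_axis)
  interpret disturbance coin_law "\<lambda>_ _. coin" by (rule disturbance_coin)
  show "\<exists>(A :: real^'n^'n) (B :: real^'d^'n) Q R Qf P x0 W K m F.
      lqr_setting A B Q R Qf P \<and> joint_law W \<and> cond_laws W K \<and> 0 < m \<and> second_moments_le W m \<and>
      F = closed_loop A B R P \<and>
      (\<lambda>(k, T). enn2real (Reg A B Q R Qf x0 W K k T))
        \<in> \<Theta>[admissible](\<lambda>(k, T). (spectral_norm (matpow F k))\<^sup>2 * (real T - real k))"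
    using lqr_setting_axis law cond second_moments_coin coin_Reg_bigtheta zero_less_one by blast
qed

end
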